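(* Let $K\subset\mathbb{R}^2$ be a compact convex set with boundary of class $C^2$ and support function of class $C^2$, let $F$ be the area of $K$ and $L$ the length of $\partial K$, and let $\omega=\omega(P)$ be the visual angle of $K$ from the point $P$. Then, for every integer $m\ge 1$, $$\int_{P\notin K}(\omega^m-\sin^m\omega)\,dP\le -\pi^m F+M_m\frac{L^2}{2\pi},\qquad\text{where } M_m=\int_0^\pi\frac{(\omega^m-\sin^m\omega)'}{1-\cos\omega}\,d\omega .$$ Equality holds only for circles.
   Context: The support function of a compact convex set $K$ is the $2\pi$-periodic function $p(\varphi)=\sup\{x\cos\varphi+y\sin\varphi : (x,y)\in K\}$. For $P\notin K$, the visual angle $\omega(P)$ is the angle between the two tangent lines from $P$ to $\partial K$ (the angle at $P$ under which $K$ is seen). $dP$ denotes the area measure on $\mathbb{R}^2$, and $\int_{P\notin K}$ is integration over $\mathbb{R}^2\setminus K$. The prime in $M_m$ denotes the derivative with respect to $\omega$.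
   Formalization: "Equality holds only for circles" is proved for m ≥ 3 only, because it is false for m = 1 (Crofton: equality for every K) and m = 2 (equality for non-circular constant width, e.g. p = 1 + cos(3φ)/20); the inequality holds for all m ≥ 1. *)

theory Defs
  imports "HOL-Analysis.Analysis"
begin

definition C2_differentiable :: "(real \<Rightarrow> 'a::real_normed_vector) \<Rightarrow> bool" where
  "C2_differentiable f \<longleftrightarrow>
     (\<exists>f'. (\<forall>t. (f has_vector_derivative f' t) (at t)) \<and> f' C1_differentiable_on UNIV)"

definition support_function :: "(real^2) set \<Rightarrow> real \<Rightarrow> real" where
  "support_function K \<phi> = (SUP x\<in>K. x $ 1 * cos \<phi> + x $ 2 * sin \<phi>)"

(* A boundary of class C^2: the frontier is traced once by a regular C^2 curve. The curve is given
   on the whole line with period 1, so that it also closes up in a C^2 way. A convex compact set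
   with such a frontier has nonempty interior, since points and segments contain no simple
   closed curve. *)
definition C2_boundary_curve :: "(real^2) set \<Rightarrow> (real \<Rightarrow> real^2) \<Rightarrow> bool" where
  "C2_boundary_curve K \<gamma> \<longleftrightarrow>
     C2_differentiable \<gamma> \<and> (\<forall>t. vector_derivative \<gamma> (at t) \<noteq> 0) \<and>
     (\<forall>t. \<gamma> (t + 1) = \<gamma> t) \<and> simple_path \<gamma> \<and> path_image \<gamma> = frontier K"

definition curve_length :: "(real \<Rightarrow> real^2) \<Rightarrow> real" where
  "curve_length \<gamma> = integral {0..1} (\<lambda>t. norm (vector_derivative \<gamma> (at t)))"

(* u is the unit direction from P of a ray that meets K and lies on a supporting line of K,
   that is, of a tangent line from P. *)
definition tangent_direction :: "(real^2) set \<Rightarrow> real^2 \<Rightarrow> real^2 \<Rightarrow> bool" where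
  "tangent_direction K P u \<longleftrightarrow>
     norm u = 1 \<and> (\<exists>t\<ge>0. P + t *\<^sub>R u \<in> K) \<and>
     (\<exists>n. n \<noteq> 0 \<and> n \<bullet> u = 0 \<and> (\<forall>x\<in>K. 0 \<le> n \<bullet> (x - P)))"

(* For a compact convex K with nonempty interior and P outside K there are exactly two tangent
   directions, pointing towards K, so this is the angle of the two tangent lines that contains K.
   For P in K the value is irrelevant. *)
definition visual_angle :: "(real^2) set \<Rightarrow> real^2 \<Rightarrow> real" where
  "visual_angle K P =
     (THE \<omega>. \<exists>u v. u \<noteq> v \<and> tangent_direction K P u \<and> tangent_direction K P v \<and>
                 \<omega> = arccos (u \<bullet> v))"

(* The integrand of M_m; at w = 0 the quotient is 0 / 0, a null set for the integral. *)
definition M_integrand :: "nat \<Rightarrow> real \<Rightarrow> real" where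
  "M_integrand m w = deriv (\<lambda>w. w ^ m - sin w ^ m) w / (1 - cos w)"

definition M_const :: "nat \<Rightarrow> real" where
  "M_const m = (LBINT w:{0..pi}. M_integrand m w)"

end

theory Submission
  imports Defs
begin

text \<open>
  Write p for the support function and f w = w^m - (sin w)^m. Every point outside K lies on exactly one
  positive half-tangent, and in the coordinates (direction a of the normal, distance r to the point of
  tangency) the area element is r dr da. Along a half-tangent the visual angle decreases, and it exceeds t
  exactly for r < tau t a, where tau t is a linear expression in p, its derivative and its translate.
  Hence the layer-cake formula turns the integral of f into the integral of f' t times half the integral
  of (tau t)^2, a quadratic form in p that Parseval's identity diagonalises. In the same way the area of K is
  diagonalised and L is the zeroth coefficient of p. Comparing modes, integral + pi^m * area equals
  M L^2 / (2 pi) plus the sum over k >= 1 of the energy of the k-th mode of p times a constant depending on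
  m and k only. That constant vanishes for k = 1 (translations) and is nonpositive for k >= 2, strictly so
  if m >= 3; and K is a disc iff p has no modes with k >= 2.
\<close>

section \<open>Fourier series of continuous periodic functions\<close>

text \<open>As a function of (a, r) the visual angle is only implicit, whereas its superlevel sets
  are explicit; this is why the integrand is cut into layers before the coordinates are changed.
  Sums and integrals are exchanged for nonnegative extended reals, because integrability over the
  unbounded exterior is not known beforehand: it comes out at the end, from the same sign of the
  mode constants that gives the inequality. The signs are the analytic core. The constants obey a
  recursion from k to k + 2 whose increments are alternating multiples of the cosine moments of f'.
  For m = 1 all constants with k >= 1 vanish, and the inequality is Crofton's identity, an equality
  for every K. For m = 2 exactly the odd ones vanish, so equality means that p has no even modes
  with k >= 2, that is, constant width. Hence equality forces a disc only for m >= 3.\<close>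

definition fourier_cos :: "(real \<Rightarrow> real) \<Rightarrow> nat \<Rightarrow> real" where
  "fourier_cos g k = integral {0..2*pi} (\<lambda>x. g x * cos (real k * x))"

definition fourier_sin :: "(real \<Rightarrow> real) \<Rightarrow> nat \<Rightarrow> real" where
  "fourier_sin g k = integral {0..2*pi} (\<lambda>x. g x * sin (real k * x))"

definition trig_sum :: "nat \<Rightarrow> (nat \<Rightarrow> real) \<Rightarrow> (nat \<Rightarrow> real) \<Rightarrow> real \<Rightarrow> real" where
  "trig_sum n a b x = (\<Sum>k\<le>n. a k * cos (real k * x) + b k * sin (real k * x))"

definition trig_poly :: "(real \<Rightarrow> real) \<Rightarrow> bool" where
  "trig_poly h \<longleftrightarrow> (\<exists>n a b. h = trig_sum n a b)"

text \<open>Integer frequencies, because the product formulas for two modes produce the difference i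
  - j, which may be negative.\<close>

lemma has_integral_cos_int:
  "((\<lambda>x. cos (real_of_int j * x)) has_integral (if j = 0 then 2*pi else 0)) {0..2*pi}"
proof (cases "j = 0")
  case True
  then show ?thesis using has_integral_const_real[of "1::real" 0 "2*pi"] by simp
next
  case False
  have "((\<lambda>x. cos (real_of_int j * x)) has_integral
          (sin (real_of_int j * (2*pi)) / j - sin (real_of_int j * 0) / j)) {0..2*pi}"
    using False by (intro fundamental_theorem_of_calculus)
      (auto intro!: derivative_eq_intros simp: has_real_derivative_iff_has_vector_derivative[symmetric])
  moreover have "sin (real_of_int j * (2*pi)) = 0"
    using sin_int_2pin[of j] by (simp add: mult.commute mult.left_commute)
  ultimately show ?thesis using False by simp
qed

lemma has_integral_sin_int:
  "((\<lambda>x. sin (real_of_int j * x)) has_integral 0) {0..2*pi}"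
proof (cases "j = 0")
  case False
  have "((\<lambda>x. sin (real_of_int j * x)) has_integral
          (- cos (real_of_int j * (2*pi)) / j - (- cos (real_of_int j * 0) / j))) {0..2*pi}"
    using False by (intro fundamental_theorem_of_calculus)
      (auto intro!: derivative_eq_intros simp: has_real_derivative_iff_has_vector_derivative[symmetric])
  moreover have "cos (real_of_int j * (2*pi)) = 1"
    using cos_int_2pin[of j] by (simp add: mult.commute mult.left_commute)
  ultimately show ?thesis by simp
qed simp

lemma has_integral_cos_cos:
  "((\<lambda>x. cos (real i * x) * cos (real j * x)) has_integral
     (if i = j then (if i = 0 then 2*pi else pi) else 0)) {0..2*pi}"
proof -
  have eq: "cos (real i * x) * cos (real j * x) =
      (cos (real_of_int (int i - int j) * x) + cos (real_of_int (int i + int j) * x)) / 2" for x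
    by (simp add: cos_times_cos left_diff_distrib distrib_right)
  show ?thesis unfolding eq
    by (rule has_integral_eq_rhs[OF has_integral_divide[OF has_integral_add[OF
          has_integral_cos_int has_integral_cos_int]]]) auto
qed

lemma has_integral_sin_sin:
  "((\<lambda>x. sin (real i * x) * sin (real j * x)) has_integral
     (if i = j \<and> i \<noteq> 0 then pi else 0)) {0..2*pi}"
proof -
  have eq: "sin (real i * x) * sin (real j * x) =
      (cos (real_of_int (int i - int j) * x) - cos (real_of_int (int i + int j) * x)) / 2" for x
    by (simp add: sin_times_sin left_diff_distrib distrib_right)
  show ?thesis unfolding eq
    by (rule has_integral_eq_rhs[OF has_integral_divide[OF has_integral_diff[OF
          has_integral_cos_int has_integral_cos_int]]]) auto
qed

lemma has_integral_sin_cos: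
  "((\<lambda>x. sin (real i * x) * cos (real j * x)) has_integral 0) {0..2*pi}"
proof -
  have eq: "sin (real i * x) * cos (real j * x) =
      (sin (real_of_int (int i + int j) * x) + sin (real_of_int (int i - int j) * x)) / 2" for x
    by (simp add: sin_times_cos left_diff_distrib distrib_right)
  show ?thesis unfolding eq
    by (rule has_integral_eq_rhs[OF has_integral_divide[OF has_integral_add[OF
          has_integral_sin_int has_integral_sin_int]]]) auto
qed

lemma trig_sum_pad:
  assumes "n \<le> N"
  shows "trig_sum n a b = trig_sum N (\<lambda>k. if k \<le> n then a k else 0) (\<lambda>k. if k \<le> n then b k else 0)"
proof
  fix x
  show "trig_sum n a b x = trig_sum N (\<lambda>k. if k \<le> n then a k else 0) (\<lambda>k. if k \<le> n then b k else 0) x"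
    unfolding trig_sum_def using assms by (intro sum.mono_neutral_cong_left) auto
qed

lemma trig_poly_add:
  assumes "trig_poly f" "trig_poly g" shows "trig_poly (\<lambda>x. f x + g x)"
proof -
  obtain n a b m c d where f: "f = trig_sum n a b" and g: "g = trig_sum m c d"
    using assms unfolding trig_poly_def by blast
  obtain a' b' c' d' where "f = trig_sum (max n m) a' b'" "g = trig_sum (max n m) c' d'"
    using trig_sum_pad[of n "max n m" a b] trig_sum_pad[of m "max n m" c d] f g by fastforce
  then have "(\<lambda>x. f x + g x) = trig_sum (max n m) (\<lambda>k. a' k + c' k) (\<lambda>k. b' k + d' k)"
    by (simp add: trig_sum_def fun_eq_iff sum.distrib algebra_simps)
  then show ?thesis unfolding trig_poly_def by blast
qed

lemma trig_poly_cmult: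
  assumes "trig_poly f" shows "trig_poly (\<lambda>x. c * f x)"
proof -
  obtain n a b where f: "f = trig_sum n a b"
    using assms unfolding trig_poly_def by blast
  have "(\<lambda>x. c * f x) = trig_sum n (\<lambda>k. c * a k) (\<lambda>k. c * b k)"
    by (simp add: f trig_sum_def fun_eq_iff sum_distrib_left algebra_simps)
  then show ?thesis unfolding trig_poly_def by blast
qed

lemma trig_poly_cos: "trig_poly (\<lambda>x. cos (real_of_int j * x))"
proof -
  have "(\<lambda>x. cos (real_of_int j * x)) = trig_sum (nat \<bar>j\<bar>) (\<lambda>k. if k = nat \<bar>j\<bar> then 1 else 0) (\<lambda>k. 0)"
    by (auto simp: trig_sum_def fun_eq_iff if_distrib[of "\<lambda>z. z * _"] sum.delta abs_if cong: if_cong)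
  then show ?thesis unfolding trig_poly_def by blast
qed

lemma trig_poly_sin: "trig_poly (\<lambda>x. sin (real_of_int j * x))"
proof -
  have "(\<lambda>x. sin (real_of_int j * x)) =
      trig_sum (nat \<bar>j\<bar>) (\<lambda>k. 0) (\<lambda>k. if k = nat \<bar>j\<bar> then of_int (sgn j) else 0)"
    by (auto simp: trig_sum_def fun_eq_iff if_distrib[of "\<lambda>z. z * _"] sum.delta abs_if sgn_if cong: if_cong)
  then show ?thesis unfolding trig_poly_def by blast
qed

lemma trig_poly_const: "trig_poly (\<lambda>x. c)"
  using trig_poly_cmult[OF trig_poly_cos[of 0], of c] by simp

lemma trig_poly_sum:
  "finite S \<Longrightarrow> (\<And>k. k \<in> S \<Longrightarrow> trig_poly (f k)) \<Longrightarrow> trig_poly (\<lambda>x. \<Sum>k\<in>S. f k x)"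
  by (induction S rule: finite_induct) (auto intro: trig_poly_const trig_poly_add)

lemma trig_poly_mult:
  assumes "trig_poly f" "trig_poly g" shows "trig_poly (\<lambda>x. f x * g x)"
proof -
  obtain n a b m c d where f: "f = trig_sum n a b" and g: "g = trig_sum m c d"
    using assms unfolding trig_poly_def by blast
  have eq: "(a i * cos (real i * x) + b i * sin (real i * x)) * (c j * cos (real j * x) + d j * sin (real j * x))
     = ((a i * c j - b i * d j) / 2 * cos (real_of_int (int i + int j) * x)
      + (a i * c j + b i * d j) / 2 * cos (real_of_int (int i - int j) * x))
      + ((a i * d j + b i * c j) / 2 * sin (real_of_int (int i + int j) * x)
      + (b i * c j - a i * d j) / 2 * sin (real_of_int (int i - int j) * x))" for i j x
    by (simp add: left_diff_distrib distrib_right cos_add sin_add cos_diff sin_diff)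
       (simp add: field_simps)
  have "trig_poly (\<lambda>x. \<Sum>i\<le>n. \<Sum>j\<le>m. (a i * cos (real i * x) + b i * sin (real i * x)) *
          (c j * cos (real j * x) + d j * sin (real j * x)))"
    unfolding eq by (intro trig_poly_sum trig_poly_add trig_poly_cmult trig_poly_cos trig_poly_sin finite_atMost)
  then show ?thesis by (simp add: f g trig_sum_def sum_product)
qed

lemma continuous_on_trig_sum [continuous_intros]: "continuous_on S (trig_sum n a b)"
  unfolding trig_sum_def by (intro continuous_intros)

lemma periodic_int:
  fixes f :: "real \<Rightarrow> 'a"
  assumes "\<And>t. f (t + c) = f t"
  shows "f (t + c * real_of_int k) = f t"
proof (induction k rule: int_induct[where k=0])
  case (step1 i)
  then show ?case using assms[of "t + c * real_of_int i"] by (simp add: algebra_simps)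
next
  case (step2 i)
  then show ?case using assms[of "t + c * real_of_int (i - 1)"] by (simp add: algebra_simps)
qed simp

text \<open>Trigonometric polynomials do not separate the endpoints of [0, 2 pi]. So
  \<open>g\<close> is carried over to the unit circle, where they form a separating algebra and
  Stone-Weierstrass applies.\<close>

lemma trig_poly_dense:
  fixes g :: "real \<Rightarrow> real"
  assumes cont: "continuous_on UNIV g" and per: "\<And>x. g (x + 2*pi) = g x" and "0 < e"
  obtains n a b where "\<And>x. x \<in> {0..2*pi} \<Longrightarrow> \<bar>g x - trig_sum n a b x\<bar> < e"
proof -
  have perZ: "g (x + 2*pi * real_of_int k) = g x" for x k
    by (rule periodic_int[of g "2*pi", OF per])
  define G where "G z = g (Arg2pi z)" for z
  have Gcis: "G (cis x) = g x" for x
  proof -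
    have "cis (Arg2pi (cis x)) = cis x"
      using Arg2pi_eq[of "cis x"] by (simp add: cis_conv_exp)
    then obtain k where "Arg2pi (cis x) = x + 2*pi * of_int k"
      using sin_cos_eq_iff[of "Arg2pi (cis x)" x] by (auto simp: complex_eq_iff)
    then show ?thesis by (simp add: G_def perZ)
  qed
  have sph: "sphere (0::complex) 1 = cis ` {0..2*pi}"
  proof -
    have "z \<in> cis ` {0..2*pi}" if "norm z = 1" for z
      using that Arg2pi_eq[of z] Arg2pi[of z] by (intro image_eqI[of _ _ "Arg2pi z"]) (auto simp: cis_conv_exp)
    then show ?thesis by auto
  qed
  \<comment> \<open>\<open>Arg2pi\<close> jumps at the positive real axis, so continuity of
    \<open>G\<close> is not inherited from it. Instead the preimage of a closed set is written as
    the image under \<open>cis\<close> of a compact set of angles.\<close>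
  have contG: "continuous_on (sphere 0 1) G"
    unfolding continuous_on_closed_vimage[OF closed_sphere]
  proof safe
    fix B :: "real set" assume "closed B"
    have "G -` B \<inter> sphere 0 1 = cis ` ({0..2*pi} \<inter> g -` B)"
      unfolding sph using Gcis by auto
    moreover have "compact ({0..2*pi} \<inter> g -` B)"
      using \<open>closed B\<close> cont by (intro compact_Int_closed continuous_closed_vimage)
        (auto simp: continuous_on_eq_continuous_at)
    ultimately show "closed (G -` B \<inter> sphere 0 1)"
      by (simp add: compact_imp_closed compact_continuous_image continuous_on_cis)
  qed
  define R where "R = {h. continuous_on (sphere (0::complex) 1) h \<and> trig_poly (\<lambda>x. h (cis x))}"
  interpret function_ring_on R "sphere (0::complex) 1"
  proof
    fix x y :: complex assume "x \<noteq> y"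
    have "Re \<in> R" "Im \<in> R"
      using trig_poly_cos[of 1] trig_poly_sin[of 1] by (auto simp: R_def intro!: continuous_intros)
    then show "\<exists>f\<in>R. f x \<noteq> f y" using \<open>x \<noteq> y\<close> complex_eq_iff by blast
  qed (auto simp: R_def intro!: continuous_intros trig_poly_add trig_poly_mult trig_poly_const)
  obtain h where h: "h \<in> R" "\<And>z. z \<in> sphere 0 1 \<Longrightarrow> \<bar>G z - h z\<bar> < e"
    using Stone_Weierstrass_basic[OF contG \<open>0 < e\<close>] by blast
  then obtain n a b where nab: "(\<lambda>x. h (cis x)) = trig_sum n a b"
    unfolding R_def trig_poly_def by blast
  have "\<bar>g x - trig_sum n a b x\<bar> < e" for x
    using h(2)[of "cis x"] Gcis[of x] fun_cong[OF nab, of x] by simp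
  then show ?thesis using that by blast
qed

text \<open>On a period the constant mode has squared norm 2 pi, the others pi.\<close>
definition fourier_wt :: "nat \<Rightarrow> real" where
  "fourier_wt k = (if k = 0 then 1/(2*pi) else 1/pi)"

definition fourier_energy :: "(real \<Rightarrow> real) \<Rightarrow> nat \<Rightarrow> real" where
  "fourier_energy g k = fourier_wt k * ((fourier_cos g k)\<^sup>2 + (fourier_sin g k)\<^sup>2)"

lemma fourier_energy_nonneg: "0 \<le> fourier_energy g k"
  by (simp add: fourier_energy_def fourier_wt_def)

lemma has_integral_mult_trig_sum:
  assumes cont: "continuous_on {0..2*pi} g"
  shows "((\<lambda>x. g x * trig_sum n a b x) has_integral
           (\<Sum>k\<le>n. a k * fourier_cos g k + b k * fourier_sin g k)) {0..2*pi}"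
proof -
  have c: "((\<lambda>x. g x * cos (real k * x)) has_integral fourier_cos g k) {0..2*pi}" for k
    unfolding fourier_cos_def
    by (intro integrable_integral integrable_continuous_real continuous_intros cont)
  have s: "((\<lambda>x. g x * sin (real k * x)) has_integral fourier_sin g k) {0..2*pi}" for k
    unfolding fourier_sin_def
    by (intro integrable_integral integrable_continuous_real continuous_intros cont)
  have "((\<lambda>x. \<Sum>k\<le>n. a k * (g x * cos (real k * x)) + b k * (g x * sin (real k * x))) has_integral
           (\<Sum>k\<le>n. a k * fourier_cos g k + b k * fourier_sin g k)) {0..2*pi}"
    by (intro has_integral_sum has_integral_add has_integral_mult_right c s) auto
  then show ?thesis
    by (simp add: trig_sum_def sum_distrib_left algebra_simps)
qed

lemma fourier_cos_trig_sum:
  assumes "k \<le> n" shows "fourier_cos (trig_sum n a b) k = a k / fourier_wt k"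
proof -
  have "((\<lambda>x. \<Sum>i\<le>n. a i * (cos (real i * x) * cos (real k * x)) + b i * (sin (real i * x) * cos (real k * x))) has_integral
           (\<Sum>i\<le>n. a i * (if i = k then (if i = 0 then 2*pi else pi) else 0) + b i * 0)) {0..2*pi}"
    by (intro has_integral_sum has_integral_add has_integral_mult_right has_integral_cos_cos has_integral_sin_cos) auto
  moreover have "(\<Sum>i\<le>n. a i * (if i = k then (if i = 0 then 2*pi else pi) else 0) + b i * 0) = a k / fourier_wt k"
    using assms by (simp add: if_distrib[of "\<lambda>z. _ * z"] sum.delta fourier_wt_def cong: if_cong)
  ultimately show ?thesis
    unfolding fourier_cos_def trig_sum_def sum_distrib_right by (simp add: distrib_right mult.assoc integral_unique)
qed

lemma fourier_sin_trig_sum: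
  assumes "k \<le> n" shows "fourier_sin (trig_sum n a b) k = (if k = 0 then 0 else b k / fourier_wt k)"
proof -
  have "((\<lambda>x. \<Sum>i\<le>n. a i * (sin (real k * x) * cos (real i * x)) + b i * (sin (real i * x) * sin (real k * x))) has_integral
           (\<Sum>i\<le>n. a i * 0 + b i * (if i = k \<and> i \<noteq> 0 then pi else 0))) {0..2*pi}"
    by (intro has_integral_sum has_integral_add has_integral_mult_right has_integral_sin_sin has_integral_sin_cos) auto
  moreover have "(\<Sum>i\<le>n. a i * 0 + b i * (if i = k \<and> i \<noteq> 0 then pi else 0)) = (if k = 0 then 0 else b k / fourier_wt k)"
  proof (cases "k = 0")
    case True
    then show ?thesis by (auto intro!: sum.neutral)
  next
    case False
    have "(\<Sum>i\<le>n. a i * 0 + b i * (if i = k \<and> i \<noteq> 0 then pi else 0)) = (\<Sum>i\<le>n. if i = k then b i * pi else 0)"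
      using False by (intro sum.cong) auto
    then show ?thesis using assms False by (simp add: sum.delta fourier_wt_def)
  qed
  ultimately show ?thesis
    unfolding fourier_sin_def trig_sum_def sum_distrib_right
    by (simp add: distrib_right mult.assoc mult.commute[of "cos _" "sin _"] integral_unique)
qed

text \<open>The case split on k = 0 records that the sine of frequency 0 is the zero function and
  has no squared norm to contribute.\<close>

lemma has_integral_diff_trig_sum:
  assumes cont: "continuous_on {0..2*pi} g"
  shows "((\<lambda>x. (g x - trig_sum n a b x)\<^sup>2) has_integral
           (integral {0..2*pi} (\<lambda>x. (g x)\<^sup>2)
            - 2 * (\<Sum>k\<le>n. a k * fourier_cos g k + b k * fourier_sin g k)
            + (\<Sum>k\<le>n. (a k)\<^sup>2 / fourier_wt k + (if k = 0 then 0 else (b k)\<^sup>2 / fourier_wt k)))) {0..2*pi}"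
proof -
  let ?T = "trig_sum n a b"
  have "((\<lambda>x. ?T x * ?T x) has_integral
          (\<Sum>k\<le>n. a k * fourier_cos ?T k + b k * fourier_sin ?T k)) {0..2*pi}"
    by (intro has_integral_mult_trig_sum continuous_intros)
  also have "(\<Sum>k\<le>n. a k * fourier_cos ?T k + b k * fourier_sin ?T k)
      = (\<Sum>k\<le>n. (a k)\<^sup>2 / fourier_wt k + (if k = 0 then 0 else (b k)\<^sup>2 / fourier_wt k))"
    by (intro sum.cong) (auto simp: fourier_cos_trig_sum fourier_sin_trig_sum power2_eq_square)
  finally have TT: "((\<lambda>x. ?T x * ?T x) has_integral \<dots>) {0..2*pi}" .
  have gg: "((\<lambda>x. (g x)\<^sup>2) has_integral integral {0..2*pi} (\<lambda>x. (g x)\<^sup>2)) {0..2*pi}"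
    by (intro integrable_integral integrable_continuous_real continuous_intros cont)
  show ?thesis
    using has_integral_add[OF has_integral_diff[OF gg has_integral_mult_right[OF has_integral_mult_trig_sum[OF cont, of n a b], of 2]] TT]
    by (simp add: power2_eq_square algebra_simps)
qed

text \<open>Bessel's inequality bounds the partial sums from above. In the other direction, the
  error of the Fourier partial sum is at most that of any trigonometric sum of the same degree, so
  uniform density closes the gap.\<close>

theorem parseval:
  fixes g :: "real \<Rightarrow> real"
  assumes cont: "continuous_on UNIV g" and per: "\<And>x. g (x + 2*pi) = g x"
  shows "fourier_energy g sums integral {0..2*pi} (\<lambda>x. (g x)\<^sup>2)"
proof -
  let ?I = "integral {0..2*pi} (\<lambda>x. (g x)\<^sup>2)"
  have cont': "continuous_on {0..2*pi} g" using cont continuous_on_subset by blast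
  have wt: "fourier_wt k > 0" for k by (simp add: fourier_wt_def)
  have s0: "fourier_sin g 0 = 0" by (simp add: fourier_sin_def)
  have bessel: "(\<Sum>k\<le>n. fourier_energy g k) \<le> ?I" for n
  proof -
    let ?a = "\<lambda>k. fourier_wt k * fourier_cos g k" and ?b = "\<lambda>k. fourier_wt k * fourier_sin g k"
    have "0 \<le> ?I - 2 * (\<Sum>k\<le>n. ?a k * fourier_cos g k + ?b k * fourier_sin g k)
            + (\<Sum>k\<le>n. (?a k)\<^sup>2 / fourier_wt k + (if k = 0 then 0 else (?b k)\<^sup>2 / fourier_wt k))"
      by (rule has_integral_nonneg[OF has_integral_diff_trig_sum[OF cont']]) simp
    also have "(\<Sum>k\<le>n. ?a k * fourier_cos g k + ?b k * fourier_sin g k) = (\<Sum>k\<le>n. fourier_energy g k)"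
      by (simp add: fourier_energy_def power2_eq_square algebra_simps)
    also have "(\<Sum>k\<le>n. (?a k)\<^sup>2 / fourier_wt k + (if k = 0 then 0 else (?b k)\<^sup>2 / fourier_wt k)) = (\<Sum>k\<le>n. fourier_energy g k)"
      using wt by (intro sum.cong) (auto simp: fourier_energy_def power2_eq_square s0 field_simps less_imp_neq[symmetric])
    finally show ?thesis by simp
  qed
  have best: "?I - (\<Sum>k\<le>n. fourier_energy g k) \<le> integral {0..2*pi} (\<lambda>x. (g x - trig_sum n a b x)\<^sup>2)" for n a b
  proof -
    have "2 * (a k * fourier_cos g k + b k * fourier_sin g k)
        \<le> fourier_energy g k + ((a k)\<^sup>2 / fourier_wt k + (if k = 0 then 0 else (b k)\<^sup>2 / fourier_wt k))" for k
    proof -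
      have *: "2 * (x * y) \<le> fourier_wt k * y\<^sup>2 + x\<^sup>2 / fourier_wt k" for x y
      proof -
        have "0 \<le> (fourier_wt k * y - x)\<^sup>2 / fourier_wt k" using wt[of k] by simp
        also have "\<dots> = fourier_wt k * y\<^sup>2 + x\<^sup>2 / fourier_wt k - 2 * (x * y)"
          using wt[of k] by (simp add: power2_eq_square field_simps)
        finally show ?thesis by simp
      qed
      show ?thesis using *[of "a k" "fourier_cos g k"] *[of "b k" "fourier_sin g k"] s0
        by (cases "k = 0") (auto simp: fourier_energy_def algebra_simps)
    qed
    then have "(\<Sum>k\<le>n. 2 * (a k * fourier_cos g k + b k * fourier_sin g k))
        \<le> (\<Sum>k\<le>n. fourier_energy g k + ((a k)\<^sup>2 / fourier_wt k + (if k = 0 then 0 else (b k)\<^sup>2 / fourier_wt k)))"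
      by (intro sum_mono)
    then show ?thesis
      using integral_unique[OF has_integral_diff_trig_sum[OF cont', of n a b]]
      by (simp add: sum.distrib sum_distrib_left)
  qed
  have "(\<lambda>n. \<Sum>k\<le>n. fourier_energy g k) \<longlonglongrightarrow> ?I"
  proof (rule LIMSEQ_I)
    fix r :: real assume "0 < r"
    \<comment> \<open>Over one period the square of \<open>e\<close> integrates to r / 2.\<close>
    define e where "e = sqrt (r / (4*pi))"
    have "0 < e" "e\<^sup>2 = r / (4*pi)" using \<open>0 < r\<close> by (simp_all add: e_def)
    then obtain n a b where T: "\<And>x. x \<in> {0..2*pi} \<Longrightarrow> \<bar>g x - trig_sum n a b x\<bar> < e"
      using trig_poly_dense[OF cont per] by blast
    have "integral {0..2*pi} (\<lambda>x. (g x - trig_sum n a b x)\<^sup>2) \<le> integral {0..2*pi} (\<lambda>x. e\<^sup>2)"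
      using T \<open>0 < e\<close> by (intro integral_le has_integral_integrable[OF has_integral_diff_trig_sum[OF cont']])
        (auto simp: abs_le_square_iff[symmetric] intro: less_imp_le)
    also have "\<dots> < r" using \<open>e\<^sup>2 = _\<close> \<open>0 < r\<close> by (simp add: field_simps)
    finally have n: "?I - (\<Sum>k\<le>n. fourier_energy g k) < r" using best[of n a b] by linarith
    have "norm ((\<Sum>k\<le>N. fourier_energy g k) - ?I) < r" if "N \<ge> n" for N
    proof -
      have "(\<Sum>k\<le>n. fourier_energy g k) \<le> (\<Sum>k\<le>N. fourier_energy g k)"
        using that by (intro sum_mono2) (auto simp: fourier_energy_nonneg)
      then show ?thesis using n bessel[of N] by simp
    qed
    then show "\<exists>no. \<forall>n\<ge>no. norm ((\<Sum>k\<le>n. fourier_energy g k) - ?I) < r" by blast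
  qed
  then show ?thesis by (simp add: sums_def_le)
qed

section \<open>The mode constants and their signs\<close>

lemma antiderivative_real:
  fixes f :: "real \<Rightarrow> real"
  assumes "continuous_on UNIV f"
  obtains A where "\<And>x. (A has_real_derivative f x) (at x)"
  using einterval_antiderivative[of "-\<infinity>" \<infinity> f] assms
  by (auto simp: continuous_on_eq_continuous_at has_real_derivative_iff_has_vector_derivative)

lemma has_integral_antiderivative:
  fixes A :: "real \<Rightarrow> real"
  assumes "a \<le> b" "\<And>x. (A has_real_derivative f x) (at x)"
  shows "(f has_integral (A b - A a)) {a..b}"
  using assms(1) by (intro fundamental_theorem_of_calculus)
    (auto simp: has_real_derivative_iff_has_vector_derivative[symmetric] intro: DERIV_subset[OF assms(2)])

text \<open>Oddness makes \<open>A (pi - x)\<close> a second antiderivative of \<open>h\<close>, and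
  comparing the increments of the two shows that the integral equals its own negative.\<close>

lemma integral_odd_about_half_pi:
  fixes h :: "real \<Rightarrow> real"
  assumes "continuous_on UNIV h" "\<And>x. h (pi - x) = - h x"
  shows "(h has_integral 0) {0..pi}"
proof -
  obtain A where A: "\<And>x. (A has_real_derivative h x) (at x)"
    using antiderivative_real[OF assms(1)] by blast
  have "((\<lambda>x. A (pi - x)) has_real_derivative h (pi - x) * (0 - 1)) (at x)" for x
    by (rule DERIV_chain2[OF A]) (auto intro!: derivative_eq_intros)
  then have "((\<lambda>x. A (pi - x)) has_real_derivative h x) (at x)" for x
    by (simp add: assms(2))
  from has_integral_antiderivative[OF _ this, of 0 pi] has_integral_antiderivative[OF _ A, of 0 pi]
  have h: "(h has_integral (A 0 - A pi)) {0..pi}" "(h has_integral (A pi - A 0)) {0..pi}" by simp_all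
  then have "A 0 - A pi = A pi - A 0" by (rule has_integral_unique)
  then show ?thesis using h(1) by simp
qed

lemma integral_pos_if_continuous:
  fixes f :: "real \<Rightarrow> real"
  assumes "continuous_on {a..b} f" "\<And>x. x \<in> {a..b} \<Longrightarrow> 0 \<le> f x" "c \<in> {a..b}" "0 < f c" "a < b"
  shows "0 < integral {a..b} f"
proof -
  have hi: "(f has_integral integral {a..b} f) {a..b}"
    using assms(1) by (intro integrable_integral integrable_continuous_real)
  then have "0 \<le> integral {a..b} f" using assms(2) by (rule has_integral_nonneg)
  moreover have "integral {a..b} f \<noteq> 0"
  proof
    assume "integral {a..b} f = 0"
    then have "f c = 0"
      using has_integral_0_cbox_imp_0[of a b f c] hi assms by (auto simp: box_real)
    then show False using assms by simp
  qed
  ultimately show ?thesis by linarith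
qed

lemma has_integral_cos_pi:
  assumes "j \<noteq> 0"
  shows "((\<lambda>x. cos (real_of_int j * x)) has_integral 0) {0..pi}"
proof -
  have "((\<lambda>x. sin (real_of_int j * x) / j) has_real_derivative cos (real_of_int j * x)) (at x)" for x
    using assms by (auto intro!: derivative_eq_intros)
  from has_integral_antiderivative[OF _ this, of 0 pi] show ?thesis
    using sin_npi_int[of j] by (simp add: mult.commute)
qed

lemma has_integral_sin_pi:
  assumes "odd j"
  shows "((\<lambda>x. sin (real_of_int j * x)) has_integral (2 / j)) {0..pi}"
proof -
  have j: "j \<noteq> 0" using assms by auto
  have "((\<lambda>x. - cos (real_of_int j * x) / j) has_real_derivative sin (real_of_int j * x)) (at x)" for x
    using j by (auto intro!: derivative_eq_intros)
  from has_integral_antiderivative[OF _ this, of 0 pi] show ?thesis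
    using cos_npi_int[of j] assms by (simp add: mult.commute)
qed

lemma cos_nat_reflect: "even n \<Longrightarrow> cos (real n * (pi - x)) = cos (real n * x)"
  by (auto simp: right_diff_distrib cos_diff cos_npi sin_npi)

text \<open>Two integrations by parts packed into one antiderivative, whose sine terms cancel on
  differentiation. The exponents start at j + 2 so that no truncated subtraction occurs.\<close>

lemma has_integral_power_cos:
  assumes "n \<ge> 1"
  shows "((\<lambda>w. (real n)\<^sup>2 * (w^(j+2) * cos (real n * w)) + real ((j+2)*(j+1)) * (w^j * cos (real n * w)))
           has_integral (real (j+2) * pi^(j+1) * (-1)^n)) {0..pi}"
proof -
  let ?A = "\<lambda>w. real n * w^(j+2) * sin (real n * w) + real (j+2) * w^(j+1) * cos (real n * w)"
  have "(?A has_real_derivative ((real n)\<^sup>2 * (w^(j+2) * cos (real n * w)) + real ((j+2)*(j+1)) * (w^j * cos (real n * w)))) (at w)" for w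
    by (rule derivative_eq_intros refl)+ (simp add: power2_eq_square algebra_simps)
  from has_integral_antiderivative[OF _ this, of 0 pi] show ?thesis by (simp add: cos_npi sin_npi)
qed

lemma has_integral_power_pi:
  "((\<lambda>w. real ((j+2)*(j+1)) * w^j) has_integral (real (j+2) * pi^(j+1))) {0..pi}"
proof -
  have "((\<lambda>w. real (j+2) * w^(j+1)) has_real_derivative (real ((j+2)*(j+1)) * w^j)) (at w)" for w
    by (rule derivative_eq_intros refl)+ (simp add: algebra_simps)
  from has_integral_antiderivative[OF _ this, of 0 pi] show ?thesis by simp
qed

lemma has_integral_id_cos:
  assumes "n \<ge> 1"
  shows "((\<lambda>w. w * cos (real n * w)) has_integral (((-1)^n - 1) / (real n)\<^sup>2)) {0..pi}"
proof -
  have "((\<lambda>w. (real n * w * sin (real n * w) + cos (real n * w)) / (real n)\<^sup>2) has_real_derivative (w * cos (real n * w))) (at w)" for w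
    using assms by (auto intro!: derivative_eq_intros simp: power2_eq_square field_simps)
  from has_integral_antiderivative[OF _ this, of 0 pi] show ?thesis
    by (simp add: cos_npi sin_npi diff_divide_distrib)
qed

text \<open>For even n the boundary term in \<open>has_integral_power_cos\<close> equals that of the
  pure power in \<open>has_integral_power_pi\<close>. Subtracting, n^2 times the integral becomes
  the integral of (j + 2) (j + 1) w^j (1 - cos (n w)), which is positive.\<close>

lemma integral_power_cos_even_pos:
  assumes "n \<ge> 1" "even n"
  shows "integral {0..pi} (\<lambda>w. w^(j+2) * cos (real n * w)) > 0"
proof -
  let ?J = "integral {0..pi} (\<lambda>w. w^(j+2) * cos (real n * w))"
  have J: "((\<lambda>w. w^(j+2) * cos (real n * w)) has_integral ?J) {0..pi}"
    by (intro integrable_integral integrable_continuous_real continuous_intros)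
  have "((\<lambda>w. real ((j+2)*(j+1)) * w^j - ((real n)\<^sup>2 * (w^(j+2) * cos (real n * w)) + real ((j+2)*(j+1)) * (w^j * cos (real n * w)))
        + (real n)\<^sup>2 * (w^(j+2) * cos (real n * w)))
      has_integral (real (j+2) * pi^(j+1) - real (j+2) * pi^(j+1) * (-1)^n + (real n)\<^sup>2 * ?J)) {0..pi}"
    by (intro has_integral_add has_integral_diff has_integral_power_pi has_integral_power_cos assms has_integral_mult_right J)
  then have "((\<lambda>w. real ((j+2)*(j+1)) * (w^j * (1 - cos (real n * w)))) has_integral ((real n)\<^sup>2 * ?J)) {0..pi}"
    using assms by (simp add: algebra_simps)
  then have eq: "(real n)\<^sup>2 * ?J = integral {0..pi} (\<lambda>w. real ((j+2)*(j+1)) * (w^j * (1 - cos (real n * w))))"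
    by (rule integral_unique[symmetric])
  have cosm: "cos (real n * (pi / real n)) = -1" using assms by simp
  have "0 < integral {0..pi} (\<lambda>w. real ((j+2)*(j+1)) * (w^j * (1 - cos (real n * w))))"
  proof (rule integral_pos_if_continuous[where c = "pi / real n"])
    have "0 < pi / real n" using assms(1) by simp
    moreover have "0 < real ((j+2)*(j+1))" by (subst of_nat_0_less_iff) simp
    ultimately show "0 < real ((j+2)*(j+1)) * ((pi / real n)^j * (1 - cos (real n * (pi / real n))))"
      unfolding cosm by (intro mult_pos_pos zero_less_power) simp_all
    show "0 \<le> real ((j+2)*(j+1)) * (x^j * (1 - cos (real n * x)))" if "x \<in> {0..pi}" for x
      using that by (intro mult_nonneg_nonneg zero_le_power) simp_all
    have "pi / real n \<le> pi / 1" by (rule divide_left_mono) (use assms(1) in auto)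
    moreover have "0 \<le> pi / real n" by (rule divide_nonneg_nonneg) auto
    ultimately show "pi / real n \<in> {0..pi}" unfolding div_by_1 by (rule atLeastAtMost_iff[THEN iffD2, OF conjI, rotated])
  qed (intro continuous_intros pi_gt_zero)+
  then have "0 < (real n)\<^sup>2 * ?J" unfolding eq .
  then show ?thesis by (rule zero_less_mult_pos) (use assms in simp)
qed

lemma x_cos_le_sin:
  assumes "0 \<le> x" "x \<le> pi" shows "x * cos x \<le> sin (x::real)"
proof -
  have "(\<lambda>x. sin x - x * cos x) 0 \<le> (\<lambda>x. sin x - x * cos x) x"
  proof (rule DERIV_nonneg_imp_nondecreasing[OF assms(1)])
    fix y assume "0 \<le> y" "y \<le> x"
    then have "0 \<le> y * sin y" using assms by (intro mult_nonneg_nonneg sin_ge_zero) auto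
    then show "\<exists>z. ((\<lambda>x. sin x - x * cos x) has_real_derivative z) (at y) \<and> 0 \<le> z"
      by (intro exI[of _ "y * sin y"]) (auto intro!: derivative_eq_intros)
  qed
  then show ?thesis by simp
qed

section \<open>The derivative of w^m - (sin w)^m and the constant M\<close>

definition pow_sin_deriv :: "nat \<Rightarrow> real \<Rightarrow> real" where
  "pow_sin_deriv m w = real m * (w^(m-1) - sin w^(m-1) * cos w)"

lemma DERIV_pow_sin_deriv:
  "((\<lambda>w. w^m - sin w^m) has_real_derivative pow_sin_deriv m w) (at w)"
  by (auto intro!: derivative_eq_intros simp: pow_sin_deriv_def algebra_simps)

lemma continuous_on_pow_sin_deriv [continuous_intros]: "continuous_on S (pow_sin_deriv m)"
  unfolding pow_sin_deriv_def by (intro continuous_intros)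

lemma pow_sin_deriv_nonneg:
  assumes "0 \<le> w" "w \<le> pi" shows "0 \<le> pow_sin_deriv m w"
proof -
  have s: "0 \<le> sin w" using assms by (intro sin_ge_zero)
  have "sin w^(m-1) * cos w \<le> sin w^(m-1) * 1" using s by (intro mult_left_mono) auto
  also have "\<dots> \<le> w^(m-1)" using s assms sin_x_le_x by (simp add: power_mono)
  finally show ?thesis by (simp add: pow_sin_deriv_def)
qed

text \<open>This keeps the integrand of M bounded near 0, where its denominator vanishes. Powers are
  treated by induction through w^(n+1) - s^(n+1) = w (w^n - s^n) + s^n (w - s) with s = sin w,
  together with w - s <= w (1 - cos w).\<close>

lemma pow_sin_deriv_le:
  obtains B where "\<And>w. 0 \<le> w \<Longrightarrow> w \<le> pi \<Longrightarrow> pow_sin_deriv m w \<le> B * (1 - cos w)"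
proof -
  have "\<exists>B. \<forall>w. 0 \<le> w \<and> w \<le> pi \<longrightarrow> w^n - sin w^n \<le> B * (1 - cos w)" for n
  proof (induction n)
    case 0
    show ?case by (intro exI[of _ 0]) simp
  next
    case (Suc n)
    then obtain B where B: "\<And>w. 0 \<le> w \<Longrightarrow> w \<le> pi \<Longrightarrow> w^n - sin w^n \<le> B * (1 - cos w)" by blast
    have "w^Suc n - sin w^Suc n \<le> (pi * \<bar>B\<bar> + pi) * (1 - cos w)" if w: "0 \<le> w" "w \<le> pi" for w
    proof -
      have s: "0 \<le> sin w" "sin w^n \<le> 1" using w by (auto intro!: sin_ge_zero power_le_one)
      have c: "0 \<le> 1 - cos w" by simp
      have 1: "w * (w^n - sin w^n) \<le> pi * (\<bar>B\<bar> * (1 - cos w))"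
      proof -
        have "w^n - sin w^n \<le> \<bar>B\<bar> * (1 - cos w)"
          using B[OF w] mult_right_mono[OF abs_ge_self[of B] c] by linarith
        moreover have "0 \<le> w^n - sin w^n" using s w by (simp add: power_mono sin_x_le_x)
        ultimately show ?thesis using w by (intro mult_mono) auto
      qed
      have "w - sin w \<le> w * (1 - cos w)" using x_cos_le_sin[OF w] by (simp add: algebra_simps)
      also have "\<dots> \<le> pi * (1 - cos w)" using w c by (intro mult_right_mono)
      finally have "w - sin w \<le> pi * (1 - cos w)" .
      moreover have "0 \<le> w - sin w" using w sin_x_le_x by simp
      ultimately have "sin w^n * (w - sin w) \<le> 1 * (pi * (1 - cos w))"
        using s by (intro mult_mono) auto
      with 1 show ?thesis by (simp add: algebra_simps)
    qed
    then show ?case by blast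
  qed
  then obtain B where B: "\<And>w. 0 \<le> w \<Longrightarrow> w \<le> pi \<Longrightarrow> w^(m-1) - sin w^(m-1) \<le> B * (1 - cos w)" by blast
  have "pow_sin_deriv m w \<le> (real m * (B + 1)) * (1 - cos w)" if w: "0 \<le> w" "w \<le> pi" for w
  proof -
    have "sin w^(m-1) \<le> 1" using w by (auto intro!: sin_ge_zero power_le_one)
    then have "sin w^(m-1) * (1 - cos w) \<le> 1 * (1 - cos w)" by (intro mult_right_mono) auto
    then have "w^(m-1) - sin w^(m-1) * cos w \<le> (B + 1) * (1 - cos w)"
      using B[OF w] by (simp add: algebra_simps)
    then show ?thesis unfolding pow_sin_deriv_def mult.assoc by (intro mult_left_mono) auto
  qed
  then show ?thesis using that by blast
qed

lemma cos_less_one_open: "0 < w \<Longrightarrow> w \<le> pi \<Longrightarrow> cos w < (1::real)"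
  using cos_monotone_0_pi[of 0 w] by simp

lemma M_integrand_eq: "M_integrand m w = pow_sin_deriv m w / (1 - cos w)"
  unfolding M_integrand_def using DERIV_imp_deriv[OF DERIV_pow_sin_deriv] by simp

lemma set_integrable_M_integrand: "set_integrable lborel {0..pi} (M_integrand m)"
proof -
  obtain B where B: "\<And>w. 0 \<le> w \<Longrightarrow> w \<le> pi \<Longrightarrow> pow_sin_deriv m w \<le> B * (1 - cos w)"
    using pow_sin_deriv_le by blast
  have [measurable]: "pow_sin_deriv m \<in> borel_measurable borel"
    by (intro borel_measurable_continuous_onI continuous_intros)
  have "norm (pow_sin_deriv m w / (1 - cos w)) \<le> \<bar>B\<bar>" if w: "w \<in> {0..pi}" for w
  proof (cases "w = 0")
    case False
    then have c: "0 < 1 - cos w" using cos_less_one_open w by auto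
    have "pow_sin_deriv m w / (1 - cos w) \<le> B" using B[of w] w c by (simp add: divide_le_eq)
    moreover have "0 \<le> pow_sin_deriv m w / (1 - cos w)" using c pow_sin_deriv_nonneg w by auto
    ultimately show ?thesis by simp
  qed simp
  then have bound: "norm (indicator {0..pi} w *\<^sub>R (pow_sin_deriv m w / (1 - cos w))) \<le> norm (indicator {0..pi} w *\<^sub>R \<bar>B\<bar>)" for w
    by (cases "w \<in> {0..pi}") simp_all
  have int: "integrable lborel (\<lambda>w::real. indicator {0..pi} w *\<^sub>R \<bar>B\<bar>)"
    by (intro integrable_scaleR_left impI integrable_real_indicator) auto
  have "integrable lborel (\<lambda>w. indicator {0..pi} w *\<^sub>R (pow_sin_deriv m w / (1 - cos w)))"
    by (rule Bochner_Integration.integrable_bound[OF int]) (measurable, rule AE_I2, rule bound)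
  then show ?thesis
    unfolding M_integrand_eq[abs_def] set_integrable_def .
qed

lemma has_integral_M: "((\<lambda>w. pow_sin_deriv m w / (1 - cos w)) has_integral M_const m) {0..pi}"
  using set_borel_integral_eq_integral[OF set_integrable_M_integrand, of m]
  unfolding M_const_def M_integrand_eq[abs_def] by (metis has_integral_integrable_integral)

text \<open>The numerator of the k-th Fourier multiplier of the area enclosed by the curve of points seen under
  the angle w, the denominator being (sin w)^2;
  at k = 0 it is 1 + cos w, which yields the weight 1 / (1 - cos w) in M.\<close>
definition iso_num :: "nat \<Rightarrow> real \<Rightarrow> real" where
  "iso_num k w = 1 + (-1)^k * (cos w * cos (real k * w) + real k * sin (real k * w) * sin w)"

definition mode_coeff :: "nat \<Rightarrow> nat \<Rightarrow> real" where
  "mode_coeff m k = integral {0..pi} (\<lambda>w. pow_sin_deriv m w * iso_num k w / (sin w)\<^sup>2)"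

section \<open>The two-step recursion for the mode constants\<close>

definition cos_moment :: "nat \<Rightarrow> nat \<Rightarrow> real" where
  "cos_moment m n = integral {0..pi} (\<lambda>w. pow_sin_deriv m w * cos (real n * w))"

lemma has_integral_cos_moment: "((\<lambda>w. pow_sin_deriv m w * cos (real n * w)) has_integral cos_moment m n) {0..pi}"
  unfolding cos_moment_def by (intro integrable_integral integrable_continuous_real continuous_intros)

text \<open>Both indices carry the same sign (-1)^k, and the difference contains the factor
  \<open>(sin w)\<^sup>2\<close>. The denominator in \<open>mode_coeff\<close> cancels against it,
  which leaves a single cosine moment as increment.\<close>

lemma iso_num_Suc_Suc:
  "iso_num (k + 2) w = iso_num k w + 2 * (-1)^k * (real k + 1) * (sin w)\<^sup>2 * cos (real (k+1) * w)"
proof -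
  \<comment> \<open>Around the middle angle \<open>a\<close> the two frequencies become a + w and a
    - w, and the products sin a sin w cos w cancel.\<close>
  define a where "a = real (k+1) * w"
  have eqs: "real (k+2) * w = a + w" "real k * w = a - w" by (simp_all add: a_def algebra_simps)
  have "cos w * cos (a + w) + real (k + 2) * sin (a + w) * sin w
      = cos w * cos (a - w) + real k * sin (a - w) * sin w + 2 * (real k + 1) * (sin w)\<^sup>2 * cos a"
    unfolding cos_add cos_diff sin_add sin_diff
    by (simp add: algebra_simps power2_eq_square)
  then have "(-1)^k * (cos w * cos (a + w) + real (k + 2) * sin (a + w) * sin w)
      = (-1)^k * (cos w * cos (a - w) + real k * sin (a - w) * sin w + 2 * (real k + 1) * (sin w)\<^sup>2 * cos a)" by (rule arg_cong)
  then show ?thesis unfolding iso_num_def eqs a_def[symmetric] by (simp add: algebra_simps)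
qed

lemma has_integral_mode_coeff_Suc_Suc:
  assumes "((\<lambda>w. pow_sin_deriv m w * iso_num k w / (sin w)\<^sup>2) has_integral b) {0..pi}"
  shows "((\<lambda>w. pow_sin_deriv m w * iso_num (k+2) w / (sin w)\<^sup>2) has_integral
           (b + 2 * (-1)^k * (real k + 1) * cos_moment m (k+1))) {0..pi}"
proof -
  have "((\<lambda>w. pow_sin_deriv m w * iso_num k w / (sin w)\<^sup>2 + 2 * (-1)^k * (real k + 1) * (pow_sin_deriv m w * cos (real (k+1) * w)))
     has_integral (b + 2 * (-1)^k * (real k + 1) * cos_moment m (k+1))) {0..pi}"
    by (intro has_integral_add assms has_integral_mult_right has_integral_cos_moment)
  then show ?thesis
  proof (rule has_integral_spike_finite[of "{0,pi}", rotated 2])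
    fix w assume "w \<in> {0..pi} - {0,pi}"
    then have "0 < sin w" by (intro sin_gt_zero) auto
    then show "pow_sin_deriv m w * iso_num (k+2) w / (sin w)\<^sup>2 = pow_sin_deriv m w * iso_num k w / (sin w)\<^sup>2 + 2 * (-1)^k * (real k + 1) * (pow_sin_deriv m w * cos (real (k+1) * w))"
      unfolding iso_num_Suc_Suc by (simp add: field_simps)
  qed simp
qed

lemma has_integral_mode_coeff_0: "((\<lambda>w. pow_sin_deriv m w * iso_num 0 w / (sin w)\<^sup>2) has_integral M_const m) {0..pi}"
proof (rule has_integral_spike_finite[of "{0,pi}", OF _ _ has_integral_M])
  fix w assume "w \<in> {0..pi} - {0,pi}"
  then have "0 < sin w" by (intro sin_gt_zero) auto
  then have "(sin w)\<^sup>2 = (1 + cos w) * (1 - cos w)" "(sin w)\<^sup>2 > 0"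
    by (auto simp: sin_squared_eq algebra_simps power2_eq_square)
  then show "pow_sin_deriv m w * iso_num 0 w / (sin w)\<^sup>2 = pow_sin_deriv m w / (1 - cos w)"
    by (auto simp: iso_num_def)
qed simp

lemma has_integral_mode_coeff_1: "((\<lambda>w. pow_sin_deriv m w * iso_num 1 w / (sin w)\<^sup>2) has_integral 0) {0..pi}"
proof -
  have "iso_num 1 w = 0" for w
    using sin_cos_squared_add2[of w] by (simp add: iso_num_def power2_eq_square)
  then show ?thesis by simp
qed

text \<open>The denominator vanishes at both ends of [0, pi], so existence is not a matter of
  continuity. It is passed on from k to k + 2, which is why the induction carries k and k + 1
  together.\<close>

lemma has_integral_mode_coeff: "((\<lambda>w. pow_sin_deriv m w * iso_num k w / (sin w)\<^sup>2) has_integral mode_coeff m k) {0..pi}"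
proof -
  have "(\<exists>b. ((\<lambda>w. pow_sin_deriv m w * iso_num k w / (sin w)\<^sup>2) has_integral b) {0..pi}) \<and>
        (\<exists>b. ((\<lambda>w. pow_sin_deriv m w * iso_num (Suc k) w / (sin w)\<^sup>2) has_integral b) {0..pi})"
  proof (induction k)
    case 0
    then show ?case using has_integral_mode_coeff_0 has_integral_mode_coeff_1 by auto
  next
    case (Suc k)
    then show ?case using has_integral_mode_coeff_Suc_Suc[of m k] by auto
  qed
  then show ?thesis unfolding mode_coeff_def using integrable_integral by blast
qed

lemma mode_coeff_0: "mode_coeff m 0 = M_const m" and mode_coeff_1: "mode_coeff m 1 = 0" and
  mode_coeff_Suc_Suc: "mode_coeff m (k+2) = mode_coeff m k + 2 * (-1)^k * (real k + 1) * cos_moment m (k+1)"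
  by (rule has_integral_unique[OF has_integral_mode_coeff has_integral_mode_coeff_0]
      has_integral_unique[OF has_integral_mode_coeff has_integral_mode_coeff_1]
      has_integral_unique[OF has_integral_mode_coeff has_integral_mode_coeff_Suc_Suc[OF has_integral_mode_coeff]])+

lemma has_integral_sin_power_cos_even:
  assumes "even n"
  shows "((\<lambda>w. sin w^j * cos w * cos (real n * w)) has_integral 0) {0..pi}"
  by (rule integral_odd_about_half_pi)
    (auto intro!: continuous_intros simp: cos_nat_reflect[OF assms])

text \<open>Multiplied by cos (n w) with even n, the part \<open>sin w^(m-1) * cos w\<close> is odd
  about pi/2 and integrates to 0, so only the pure power survives.\<close>

lemma cos_moment_even:
  assumes "even n"
  shows "cos_moment m n = real m * integral {0..pi} (\<lambda>w. w^(m-1) * cos (real n * w))"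
proof -
  let ?J = "integral {0..pi} (\<lambda>w. w^(m-1) * cos (real n * w))"
  have J: "((\<lambda>w. w^(m-1) * cos (real n * w)) has_integral ?J) {0..pi}"
    by (intro integrable_integral integrable_continuous_real continuous_intros)
  have "((\<lambda>w. real m * (w^(m-1) * cos (real n * w) - sin w^(m-1) * cos w * cos (real n * w))) has_integral
          real m * (?J - 0)) {0..pi}"
    by (intro has_integral_mult_right has_integral_diff J has_integral_sin_power_cos_even assms)
  then show ?thesis unfolding cos_moment_def
    by (intro integral_unique) (simp add: pow_sin_deriv_def algebra_simps)
qed

lemma cos_moment_even_pos:
  assumes "n \<ge> 1" "even n" "m \<ge> 3"
  shows "cos_moment m n > 0"
proof -
  obtain j where "m = j + 3" using assms(3) le_Suc_ex by (metis add.commute)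
  then show ?thesis using integral_power_cos_even_pos[OF assms(1,2), of j] by (simp add: cos_moment_even[OF assms(2)] numeral_3_eq_3 add.commute)
qed

lemma cos_moment_even_zero:
  assumes "n \<ge> 1" "even n" "m = 1 \<or> m = 2"
  shows "cos_moment m n = 0"
proof -
  have "((\<lambda>w. cos (real_of_int (int n) * w)) has_integral 0) {0..pi}"
    using assms by (intro has_integral_cos_pi) auto
  then have "integral {0..pi} (\<lambda>w. cos (real n * w)) = 0" by (simp add: integral_unique)
  moreover have "integral {0..pi} (\<lambda>w. w * cos (real n * w)) = 0"
    using integral_unique[OF has_integral_id_cos[OF assms(1)]] assms(2) by simp
  ultimately show ?thesis using assms(3) by (auto simp: cos_moment_even[OF assms(2)])
qed

section \<open>The exponents 1 and 2\<close>

lemma cos_moment_one: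
  assumes "n \<ge> 1" 
  shows "cos_moment 1 n = (if n = 1 then - pi / 2 else 0)"
proof -
  have c: "((\<lambda>w. cos (real_of_int (int n) * w)) has_integral 0) {0..pi}"
    using assms by (intro has_integral_cos_pi) auto
  have p: "((\<lambda>w. cos (real_of_int (int n + 1) * w)) has_integral 0) {0..pi}"
    using assms by (intro has_integral_cos_pi) auto
  have m: "((\<lambda>w. cos (real_of_int (int n - 1) * w)) has_integral (if n = 1 then pi else 0)) {0..pi}"
    using has_integral_cos_pi[of "int n - 1"] has_integral_const_real[of "1::real" 0 pi] by (cases "n = 1") auto
  have "((\<lambda>w. cos (real_of_int (int n) * w) - (cos (real_of_int (int n - 1) * w) + cos (real_of_int (int n + 1) * w)) / 2)
     has_integral (0 - ((if n = 1 then pi else 0) + 0) / 2)) {0..pi}"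
    by (intro has_integral_diff has_integral_add has_integral_divide c p m)
  moreover have "cos (real_of_int (int n) * w) - (cos (real_of_int (int n - 1) * w) + cos (real_of_int (int n + 1) * w)) / 2
     = pow_sin_deriv 1 w * cos (real n * w)" for w
    by (simp add: pow_sin_deriv_def left_diff_distrib distrib_right cos_add cos_diff)
  ultimately show ?thesis unfolding cos_moment_def by (auto intro!: integral_unique)
qed

lemma M_const_1: "M_const 1 = pi"
proof -
  have "((\<lambda>w. pow_sin_deriv 1 w / (1 - cos w)) has_integral pi) {0..pi}"
  proof (rule has_integral_spike_finite[of "{0}"])
    show "((\<lambda>w. 1) has_integral pi) {0..pi}" using has_integral_const_real[of "1::real" 0 pi] by simp
    fix w assume "w \<in> {0..pi} - {0}"
    then show "pow_sin_deriv 1 w / (1 - cos w) = 1" using cos_less_one_open[of w] by (simp add: pow_sin_deriv_def)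
  qed simp
  then show ?thesis using has_integral_M has_integral_unique by blast
qed

text \<open>Crofton's identity mode by mode. The first increment 2 (- pi / 2) cancels M = pi and
  thus kills mode 2, and all later increments are 0.\<close>

lemma mode_coeff_one_eq_0:
  assumes "k \<ge> 1" shows "mode_coeff 1 k = 0"
proof -
  have "mode_coeff 1 (Suc k) = 0 \<and> mode_coeff 1 (k + 2) = 0" for k
  proof (induction k)
    case 0
    show ?case using mode_coeff_1[of 1] mode_coeff_Suc_Suc[of 1 0] M_const_1 cos_moment_one[of 1] by (simp add: mode_coeff_0)
  next
    case (Suc k)
    show ?case using Suc mode_coeff_Suc_Suc[of 1 "Suc k"] by (simp add: cos_moment_one del: One_nat_def)
  qed
  then show ?thesis using assms by (metis Suc_le_D One_nat_def)
qed

text \<open>For m = 2 the odd cosine moments are positive from n = 3 on, so that the recursion gives no sign;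
  but here the coefficients have a closed form.\<close>
lemma mode_coeff_two_odd: "odd k \<Longrightarrow> mode_coeff 2 k = 0"
proof (induction k rule: induct_nat_012)
  case (ge2 n)
  then show ?case using mode_coeff_Suc_Suc[of 2 n] by (simp add: cos_moment_even_zero)
qed (use mode_coeff_1[of 2] in auto)

lemma cos_moment_two_odd:
  assumes "odd n"
  shows "cos_moment 2 n = 16 / ((real n)\<^sup>2 * ((real n)\<^sup>2 - 4))"
proof -
  have n: "n \<ge> 1" using assms by (cases n) auto
  have h: "(2 / x - 2 / y) / 2 = 1 / x - 1 / y" for x y :: real by (simp add: diff_divide_distrib)
  have s: "((\<lambda>w. sin (real_of_int (int n + 2) * w)) has_integral (2 / (int n + 2))) {0..pi}"
          "((\<lambda>w. sin (real_of_int (int n - 2) * w)) has_integral (2 / (int n - 2))) {0..pi}"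
    using has_integral_sin_pi[of "int n + 2"] has_integral_sin_pi[of "int n - 2"] assms by auto
  have "((\<lambda>w. 2 * (w * cos (real n * w)) - (sin (real_of_int (int n + 2) * w) - sin (real_of_int (int n - 2) * w)) / 2)
     has_integral (2 * (((-1)^n - 1) / (real n)\<^sup>2) - (2 / (int n + 2) - 2 / (int n - 2)) / 2)) {0..pi}"
    by (intro has_integral_diff has_integral_mult_right has_integral_divide has_integral_id_cos n s)
  moreover have "2 * (w * cos (real n * w)) - (sin (real_of_int (int n + 2) * w) - sin (real_of_int (int n - 2) * w)) / 2
     = pow_sin_deriv 2 w * cos (real n * w)" for w
  proof -
    have *: "sin (real_of_int (int n + 2) * w) - sin (real_of_int (int n - 2) * w) = 2 * cos (real n * w) * sin (2 * w)"
      by (simp add: left_diff_distrib distrib_right sin_add sin_diff)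
    show ?thesis unfolding * sin_double by (simp add: pow_sin_deriv_def algebra_simps)
  qed
  ultimately have "cos_moment 2 n = 2 * (((-1)^n - 1) / (real n)\<^sup>2) - (2 / (int n + 2) - 2 / (int n - 2)) / 2"
    unfolding cos_moment_def by (auto intro!: integral_unique)
  also have "\<dots> = 2 * (((-1)^n - 1) / (real n)\<^sup>2) - (2 / (real n + 2) - 2 / (real n - 2)) / 2" by simp
  also have "(2 / (real n + 2) - 2 / (real n - 2)) / 2 = 1 / (real n + 2) - 1 / (real n - 2)"
    using h by blast
  also have "2 * (((-1)^n - 1) / (real n)\<^sup>2) - (1 / (real n + 2) - 1 / (real n - 2)) = -4 / (real n)\<^sup>2 - (1 / (real n + 2) - 1 / (real n - 2))"
    using assms by simp
  also have "\<dots> = 16 / ((real n)\<^sup>2 * ((real n)\<^sup>2 - 4))"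
  proof -
    have ne: "real n \<noteq> 0" "real n - 2 \<noteq> 0" "real n + 2 \<noteq> 0" using assms n by auto
    have f: "(real n)\<^sup>2 - 4 = (real n - 2) * (real n + 2)" by (simp add: power2_eq_square algebra_simps)
    show ?thesis unfolding f using ne by (simp add: divide_simps power2_eq_square) (simp add: algebra_simps)
  qed
  finally show ?thesis .
qed

lemma M_const_2: "M_const 2 = 8"
proof -
  obtain B where B: "\<And>w. 0 \<le> w \<Longrightarrow> w \<le> pi \<Longrightarrow> pow_sin_deriv 2 w \<le> B * (1 - cos w)"
    using pow_sin_deriv_le by blast
  \<comment> \<open>Since - cot (w/2) is an antiderivative of 1 / (1 - cos w), integration by parts
    leads to this function; the logarithms of sin (w/2) cancel. The value -6 is the limit at 0,
    where w cot (w/2) tends to 2.\<close>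
  let ?A = "\<lambda>w. if w = 0 then - 6 else - 2 * w * (cos (w/2) / sin (w/2)) - 2 * cos w :: real"
  have lim: "((\<lambda>w. - 2 * w * (cos (w/2) / sin (w/2)) - 2 * cos w) \<longlongrightarrow> -6) (at (0::real))"
  proof -
    have "((\<lambda>w. - 4 * (cos (w/2) / (sin (w/2) / (w/2))) - 2 * cos w) \<longlongrightarrow> - 4 * (cos (0/2) / 1) - 2 * cos 0) (at (0::real))"
    proof (intro tendsto_intros)
      have "filterlim (\<lambda>w::real. w/2) (at 0) (at 0)"
        unfolding filterlim_at by (auto intro!: tendsto_eq_intros simp: eventually_at_filter)
      then show "((\<lambda>w::real. sin (w/2) / (w/2)) \<longlongrightarrow> 1) (at 0)"
        using filterlim_compose[of "\<lambda>x::real. sin x / x" "nhds 1" "at 0" "\<lambda>w. w/2" "at 0"] DERIV_sin[of "0::real"]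
        by (simp add: DERIV_def)
    qed auto
    then have "((\<lambda>w. - 4 * (cos (w/2) / (sin (w/2) / (w/2))) - 2 * cos w) \<longlongrightarrow> -6) (at (0::real))"
      by (rule tendsto_eq_rhs) simp
    moreover have "(\<lambda>w::real. - 4 * (cos (w/2) / (sin (w/2) / (w/2))) - 2 * cos w) = (\<lambda>w. - 2 * w * (cos (w/2) / sin (w/2)) - 2 * cos w)"
      by (simp add: fun_eq_iff)
    ultimately show ?thesis by (simp only:)
  qed
  have "((\<lambda>w. pow_sin_deriv 2 w / (1 - cos w)) has_integral (?A pi - ?A 0)) {0..pi}"
  proof (rule fundamental_theorem_of_calculus_interior)
    show "continuous_on {0..pi} ?A"
      unfolding continuous_on_eq_continuous_within
    proof
      fix x assume x: "x \<in> {0..pi}"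
      show "continuous (at x within {0..pi}) ?A"
      proof (cases "x = 0")
        case True
        have "(?A \<longlongrightarrow> -6) (at 0)"
          by (rule Lim_transform_eventually[OF lim]) (auto simp: eventually_at_filter)
        then show ?thesis using True by (auto simp: continuous_within intro: tendsto_within_subset)
      next
        case False
        then have "0 < sin (x/2)" using x by (intro sin_gt_zero) auto
        then have "isCont (\<lambda>w. - 2 * w * (cos (w/2) / sin (w/2)) - 2 * cos w) x"
          by (intro continuous_intros) auto
        moreover have "\<forall>\<^sub>F w in nhds x. - 2 * w * (cos (w/2) / sin (w/2)) - 2 * cos w = ?A w"
          using t1_space_nhds[of x 0] False by (auto elim: eventually_mono)
        then have "isCont (\<lambda>w. - 2 * w * (cos (w/2) / sin (w/2)) - 2 * cos w) x = isCont ?A x" by (rule isCont_cong)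
        ultimately have "isCont ?A x" by blast
        then show ?thesis by (rule continuous_at_imp_continuous_at_within)
      qed
    qed
    fix w assume w: "w \<in> {0<..<pi}"
    then have s: "0 < sin (w/2)" by (intro sin_gt_zero) auto
    have c: "1 - cos w = 2 * (sin (w/2))\<^sup>2" using cos_double_sin[of "w/2"] by simp
    have sw: "sin w = 2 * sin (w/2) * cos (w/2)" using sin_double[of "w/2"] by simp
    have "((\<lambda>w. - 2 * w * (cos (w/2) / sin (w/2)) - 2 * cos w) has_real_derivative
        (- 2 * (cos (w/2) / sin (w/2)) - 2 * w * ((- sin (w/2) * (1/2) * sin (w/2) - cos (w/2) * (cos (w/2) * (1/2))) / (sin (w/2) * sin (w/2))) + 2 * sin w)) (at w)"
      using s by (auto intro!: derivative_eq_intros) (simp add: field_simps)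
    also have "- sin (w/2) * (1/2) * sin (w/2) - cos (w/2) * (cos (w/2) * (1/2)) = - (1/2)"
      using sin_cos_squared_add[of "w/2"] unfolding power2_eq_square by argo
    also have "- 2 * (cos (w/2) / sin (w/2)) - 2 * w * (- (1/2) / (sin (w/2) * sin (w/2))) + 2 * sin w = pow_sin_deriv 2 w / (1 - cos w)"
    proof -
      have e1: "pow_sin_deriv 2 w = 2 * w - 2 * sin w * (1 - 2 * (sin (w/2))\<^sup>2)" 
      proof -
        have cw: "cos w = 1 - 2 * (sin (w/2))\<^sup>2" using c by linarith
        show ?thesis unfolding pow_sin_deriv_def cw by (simp add: algebra_simps)
      qed
      show ?thesis unfolding e1 c sw using s by (simp add: field_simps power2_eq_square)
    qed
    finally have "((\<lambda>w. - 2 * w * (cos (w/2) / sin (w/2)) - 2 * cos w) has_real_derivative pow_sin_deriv 2 w / (1 - cos w)) (at w)" .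
    then have "(?A has_real_derivative pow_sin_deriv 2 w / (1 - cos w)) (at w)"
      by (rule DERIV_cong_ev[THEN iffD1, rotated -1])
        (use t1_space_nhds[of w 0] w in \<open>auto elim: eventually_mono\<close>)
    then show "(?A has_vector_derivative pow_sin_deriv 2 w / (1 - cos w)) (at w)"
      by (simp add: has_real_derivative_iff_has_vector_derivative)
  qed simp
  then have "((\<lambda>w. pow_sin_deriv 2 w / (1 - cos w)) has_integral 8) {0..pi}" by simp
  then show ?thesis using has_integral_M has_integral_unique by blast
qed

text \<open>The increments telescope: 32 / ((k - 1) (k + 1) (k + 3)) is the difference of the values
  of - 8 / (k^2 - 1) at k + 2 and k. The induction starts at k = 0, where the formula gives the
  value 8 of M.\<close>

lemma mode_coeff_two_even:
  assumes "even k" shows "mode_coeff 2 k = - 8 / ((real k)\<^sup>2 - 1)"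
  using assms
proof (induction k rule: induct_nat_012)
  case 0
  then show ?case by (simp add: mode_coeff_0 M_const_2)
next
  case (ge2 n)
  have "mode_coeff 2 (n+2) = - 8 / ((real n)\<^sup>2 - 1) + 2 * (real n + 1) * (16 / ((real n + 1)\<^sup>2 * ((real n + 1)\<^sup>2 - 4)))"
    using ge2 cos_moment_two_odd[of "n+1"] mode_coeff_Suc_Suc[of 2 n] by (simp add: add.commute)
  also have "\<dots> = - 8 / ((real (n+2))\<^sup>2 - 1)"
  proof -
    have ne: "real n + 1 \<noteq> 0" "real n - 1 \<noteq> 0" "real n + 3 \<noteq> 0" using ge2 by auto
    have f: "(real n)\<^sup>2 - 1 = (real n - 1) * (real n + 1)" "(real n + 1)\<^sup>2 - 4 = (real n - 1) * (real n + 3)"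
      "(real (n+2))\<^sup>2 - 1 = (real n + 1) * (real n + 3)" by (simp_all add: power2_eq_square algebra_simps)
    show ?thesis unfolding f using ne by (simp add: divide_simps power2_eq_square) (simp add: algebra_simps)
  qed
  finally show ?case by simp
qed auto

section \<open>The exponents from 3 on\<close>

text \<open>For m at least 4 the third derivative d3 of w^m - (sin w)^m is nonnegative on [0, pi]; for m = 3
  it is not.\<close>
lemma cos_moment_odd_nonpos_ge4:
  assumes "m \<ge> 4" "odd n"
  shows "cos_moment m n \<le> 0"
proof -
  obtain q where m: "m = q + 4" using assms(1) le_Suc_ex by (metis add.commute)
  have n: "n \<ge> 1" using assms by (cases n) auto
  define d2 where "d2 w = real (q+4) * (real (q+3) * (w^(q+2) - sin w^(q+2) * (cos w)\<^sup>2) + sin w^(q+4))" for w :: real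
  define d3 where "d3 w = real (q+4) * (real ((q+3)*(q+2)) * (w^(q+1) - sin w^(q+1) * (cos w)^3) + real (3*q+10) * sin w^(q+3) * cos w)" for w :: real
  have pow_sin_deriv: "(pow_sin_deriv m has_real_derivative d2 w) (at w)" for w
    unfolding pow_sin_deriv_def[abs_def] m d2_def
    by (rule derivative_eq_intros refl)+ (simp add: algebra_simps power2_eq_square eval_nat_numeral)
  have d2: "(d2 has_real_derivative d3 w) (at w)" for w
    unfolding d2_def[abs_def] d3_def
    by (rule derivative_eq_intros refl)+ (simp add: algebra_simps power2_eq_square eval_nat_numeral)
  have c3: "continuous_on {0..pi} d3" unfolding d3_def[abs_def] by (intro continuous_intros)
  have d3: "d3 w \<ge> 0" if w: "0 \<le> w" "w \<le> pi" for w
  proof -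
    have s: "0 \<le> sin w" "sin w \<le> 1" using w by (auto intro!: sin_ge_zero)
    have "0 \<le> real ((q+3)*(q+2)) * (w^(q+1) - sin w^(q+1) * (cos w)^3) + real (3*q+10) * sin w^(q+3) * cos w"
    proof (cases "cos w \<ge> 0")
      case True
      have "sin w^(q+1) * (cos w)^3 \<le> sin w^(q+1) * 1"
        using True s by (intro mult_left_mono power_le_one) auto
      also have "\<dots> \<le> w^(q+1)" using s w sin_x_le_x by (simp add: power_mono del: power_Suc)
      finally show ?thesis using True s by (intro add_nonneg_nonneg mult_nonneg_nonneg) auto
    next
      case False
      \<comment> \<open>Where the cosine is negative, w exceeds pi/2 and hence 1, so the first term
        is at least (q + 3) (q + 2). The last term loses at most half of its coefficient, and (3 q +
        10) / 2 is smaller.\<close>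
      then have "w > pi/2" using cos_ge_zero[of w] w by fastforce
      then have "1 \<le> w" using pi_gt3 by simp
      then have 1: "1 \<le> w^(q+1)" by (rule one_le_power)
      have "(cos w)^3 \<le> 0" using False by (simp add: power_le_zero_eq)
      then have "sin w^(q+1) * (cos w)^3 \<le> 0" using s by (intro mult_nonneg_nonpos) auto
      with 1 have "real ((q+3)*(q+2)) * 1 \<le> real ((q+3)*(q+2)) * (w^(q+1) - sin w^(q+1) * (cos w)^3)"
        by (intro mult_left_mono) auto
      moreover have "- (1/2) \<le> sin w^(q+3) * cos w"
      proof -
        have "sin w * cos w \<ge> - (1/2)"
          using sin_cos_squared_add[of w] zero_le_power2[of "sin w + cos w"] unfolding power2_sum by linarith
        then have "sin w^(q+2) * (sin w * cos w) \<ge> sin w^(q+2) * (- (1/2))" using s by (intro mult_left_mono) auto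
        moreover have "sin w^(q+2) \<le> 1" using s by (intro power_le_one)
        ultimately show ?thesis by (simp add: algebra_simps eval_nat_numeral)
      qed
      then have "real (3*q+10) * (- (1/2)) \<le> real (3*q+10) * (sin w^(q+3) * cos w)" by (intro mult_left_mono) auto
      moreover have "real ((q+3)*(q+2)) * 1 + real (3*q+10) * (- (1/2)) \<ge> 0" by (simp add: algebra_simps)
      ultimately show ?thesis unfolding mult.assoc by linarith
    qed
    then show ?thesis unfolding d3_def by (intro mult_nonneg_nonneg) auto
  qed
  have d2_0: "d2 0 = 0" by (simp add: d2_def)
  have d2int: "(d3 has_integral (d2 pi - d2 0)) {0..pi}"
    by (rule has_integral_antiderivative[OF _ d2]) simp
  \<comment> \<open>Two integrations by parts leave the boundary term - \<open>d2 pi\<close>, as cos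
    (n pi) = -1. Adding the integral of \<open>d3\<close>, which is \<open>d2 pi\<close>, cancels it
    and turns cos (n w) into the nonnegative factor 1 + cos (n w).\<close>
  let ?F = "\<lambda>w. real n * pow_sin_deriv m w * sin (real n * w) + d2 w * cos (real n * w)"
  have "(?F has_real_derivative ((real n)\<^sup>2 * (pow_sin_deriv m w * cos (real n * w)) + d3 w * cos (real n * w))) (at w)" for w
    by (rule derivative_eq_intros pow_sin_deriv d2 refl | simp add: power2_eq_square algebra_simps)+
  from has_integral_antiderivative[OF _ this, of 0 pi]
  have "((\<lambda>w. (real n)\<^sup>2 * (pow_sin_deriv m w * cos (real n * w)) + d3 w * cos (real n * w)) has_integral (- d2 pi - d2 0)) {0..pi}"
    using assms by (simp add: cos_npi sin_npi)
  from has_integral_add[OF this d2int]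
  have "((\<lambda>w. (real n)\<^sup>2 * (pow_sin_deriv m w * cos (real n * w)) + d3 w * (1 + cos (real n * w))) has_integral 0) {0..pi}"
    by (simp add: d2_0 algebra_simps)
  from has_integral_diff[OF this has_integral_mult_right[OF has_integral_cos_moment[of m n], of "(real n)\<^sup>2"]]
  have "((\<lambda>w. d3 w * (1 + cos (real n * w))) has_integral (- (real n)\<^sup>2 * cos_moment m n)) {0..pi}"
    by simp
  then have "0 \<le> - (real n)\<^sup>2 * cos_moment m n"
    by (rule has_integral_nonneg) (use d3 cos_ge_minus_one in \<open>auto intro!: mult_nonneg_nonneg simp: add.commute[of 1] real_0_le_add_iff\<close>)
  then show ?thesis using n by (simp add: mult_le_0_iff)
qed

text \<open>Exact evaluation. The power contributes - 6 pi / n^2. Since (sin w)^2 cos w = (cos w -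
  cos (3 w)) / 4, the trigonometric part is felt only at n = 3, where it adds 3 pi / 8, less than
  the 2 pi / 3 lost to the power.\<close>

lemma cos_moment_odd_nonpos_3:
  assumes "odd n" "n \<ge> 3"
  shows "cos_moment 3 n \<le> 0"
proof -
  have n: "n \<ge> 1" using assms by simp
  let ?J = "integral {0..pi} (\<lambda>w. w^2 * cos (real n * w))"
  have J: "((\<lambda>w. w^2 * cos (real n * w)) has_integral ?J) {0..pi}"
    by (intro integrable_integral integrable_continuous_real continuous_intros)
  have C: "((\<lambda>w. cos (real_of_int j * w)) has_integral (if j = 0 then pi else 0)) {0..pi}" for j
    using has_integral_cos_pi[of j] has_integral_const_real[of "1::real" 0 pi] by auto
  have "((\<lambda>w. (real n)\<^sup>2 * (w^2 * cos (real n * w)) + 2 * cos (real_of_int (int n) * w)) has_integral ((real n)\<^sup>2 * ?J + 2 * (if int n = 0 then pi else 0))) {0..pi}"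
    by (intro has_integral_add has_integral_mult_right J C)
  moreover have "((\<lambda>w. (real n)\<^sup>2 * (w^2 * cos (real n * w)) + 2 * cos (real_of_int (int n) * w)) has_integral (- 2 * pi)) {0..pi}"
    using has_integral_power_cos[OF n, of 0] assms by (simp add: numeral_2_eq_2)
  ultimately have "(real n)\<^sup>2 * ?J + 2 * (if int n = 0 then pi else 0) = - 2 * pi"
    using has_integral_unique by blast
  then have J': "?J = - 2 * pi / (real n)\<^sup>2" using n by (simp add: field_simps)
  have "((\<lambda>w. 3 * (w^2 * cos (real n * w)) - 3/8 * ((cos (real_of_int (int n - 1) * w) + cos (real_of_int (int n + 1) * w))
             - (cos (real_of_int (int n - 3) * w) + cos (real_of_int (int n + 3) * w)))) has_integral
     (3 * ?J - 3/8 * (((if int n - 1 = 0 then pi else 0) + (if int n + 1 = 0 then pi else 0)) - ((if int n - 3 = 0 then pi else 0) + (if int n + 3 = 0 then pi else 0))))) {0..pi}"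
    by (intro has_integral_diff has_integral_add has_integral_mult_right J C)
  moreover have "3 * (w^2 * cos (real n * w)) - 3/8 * ((cos (real_of_int (int n - 1) * w) + cos (real_of_int (int n + 1) * w))
             - (cos (real_of_int (int n - 3) * w) + cos (real_of_int (int n + 3) * w))) = pow_sin_deriv 3 w * cos (real n * w)" for w
  proof -
    have e12: "cos (real_of_int (int n - 1) * w) + cos (real_of_int (int n + 1) * w) = 2 * cos (real n * w) * cos w"
         "cos (real_of_int (int n - 3) * w) + cos (real_of_int (int n + 3) * w) = 2 * cos (real n * w) * cos (3 * w)"
      by (simp_all add: left_diff_distrib distrib_right cos_add cos_diff)
    have e3: "cos (3*w) = cos w - 4 * (sin w)\<^sup>2 * cos w"
      unfolding sin_squared_eq cos_treble_cos by (simp add: power2_eq_square power3_eq_cube algebra_simps)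
    show ?thesis unfolding e12 e3 by (simp add: pow_sin_deriv_def algebra_simps power2_eq_square)
  qed
  ultimately have "cos_moment 3 n = 3 * ?J - 3/8 * (((if int n - 1 = 0 then pi else 0) + (if int n + 1 = 0 then pi else 0)) - ((if int n - 3 = 0 then pi else 0) + (if int n + 3 = 0 then pi else 0)))"
    unfolding cos_moment_def by (auto intro!: integral_unique)
  also have "\<dots> \<le> 0" unfolding J' using assms by (cases "n = 3") (auto simp: field_simps)
  finally show ?thesis .
qed

lemma cos_moment_odd_nonpos:
  assumes "odd n" "n \<ge> 3" "m \<ge> 3"
  shows "cos_moment m n \<le> 0"
  using cos_moment_odd_nonpos_3[OF assms(1,2)] cos_moment_odd_nonpos_ge4[OF _ assms(1), of m] assms(3)
  by (cases "m = 3") auto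

text \<open>Makes the factor \<open>u\<close> in the estimate of mode 2 increasing. After
  differentiation the claim is x sin x <= 2 (1 - cos x), which is \<open>x_cos_le_sin\<close> at the
  half angle.\<close>

lemma sq_div_one_minus_cos_mono:
  assumes "0 < a" "a \<le> b" "b \<le> pi"
  shows "a\<^sup>2 / (1 - cos a) \<le> b\<^sup>2 / (1 - cos (b::real))"
proof (rule DERIV_nonneg_imp_nondecreasing[OF assms(2)])
  fix x assume x: "a \<le> x" "x \<le> b"
  then have c: "0 < 1 - cos x" using cos_less_one_open[of x] assms by auto
  have "x * sin x \<le> 2 * (1 - cos x)"
  proof -
    have "(x/2) * cos (x/2) \<le> sin (x/2)" using x assms by (intro x_cos_le_sin) auto
    moreover have "0 \<le> sin (x/2)" using x assms by (intro sin_ge_zero) auto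
    ultimately have "4 * sin (x/2) * ((x/2) * cos (x/2)) \<le> 4 * sin (x/2) * sin (x/2)" by (intro mult_left_mono) auto
    then show ?thesis using cos_double_sin[of "x/2"] sin_double[of "x/2"] by (simp add: power2_eq_square algebra_simps)
  qed
  then have "0 \<le> x * (2 * (1 - cos x) - x * sin x)" using x assms by (intro mult_nonneg_nonneg) auto
  then have "0 \<le> x * (2 * (1 - cos x) - x * sin x) / ((1 - cos x) * (1 - cos x))" using c by simp
  moreover have "((\<lambda>x. x\<^sup>2 / (1 - cos x)) has_real_derivative x * (2 * (1 - cos x) - x * sin x) / ((1 - cos x) * (1 - cos x))) (at x)"
    using c by (auto intro!: derivative_eq_intros simp: power2_eq_square algebra_simps)
  ultimately show "\<exists>y. ((\<lambda>x. x\<^sup>2 / (1 - cos x)) has_real_derivative y) (at x) \<and> 0 \<le> y" by blast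
qed

text \<open>The derivative of w^m contributes the increasing function u against the factor W, which has mean 0
  and changes sign once, from plus to minus. The derivative of (sin w)^m contributes S, up to terms that
  are odd about pi/2.\<close>
lemma mode_coeff_2_neg:
  assumes "m \<ge> 3" shows "mode_coeff m 2 < 0"
proof -
  obtain q where m: "m = q + 3" using assms le_Suc_ex by (metis add.commute)
  \<comment> \<open>As a quadratic in cos w, the factor \<open>W\<close> below has the roots
    \<open>c0\<close> and (1 + sqrt 3) / 2. The second exceeds 1, so \<open>W\<close> changes sign
    only at \<open>w0\<close>.\<close>
  define c0 where "c0 = (1 - sqrt 3) / 2"
  have r3: "1 < sqrt 3" "sqrt 3 < 2" "sqrt 3 * sqrt 3 = 3" by (auto simp: real_less_lsqrt)
  then have c0: "-1 < c0" "c0 < 0" by (auto simp: c0_def)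
  have g1: "1 \<le> (1 + sqrt 3)/2" using r3(1) by simp
  define w0 where "w0 = arccos c0"
  have w0: "0 < w0" "w0 \<le> pi" "cos w0 = c0"
    using c0 arccos_lt_bounded[of c0] by (auto simp: w0_def intro: less_imp_le)
  define u where "u w = w^q * (w\<^sup>2 / (1 - cos w))" for w :: real
  define W where "W w = 1 + 2 * cos w - 2 * (cos w)\<^sup>2" for w :: real
  have Wfac: "W w = 2 * (cos w - c0) * ((1 + sqrt 3)/2 - cos w)" for w
    using r3 by (simp add: W_def c0_def power2_eq_square field_simps)
  have umono: "u a \<le> u b" if "0 < a" "a \<le> b" "b \<le> pi" for a b
    unfolding u_def using that sq_div_one_minus_cos_mono[OF that] cos_less_one_open[of a]
    by (intro mult_mono power_mono) auto
  \<comment> \<open>Up to \<open>w0\<close> the factor \<open>W\<close> is nonnegative and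
    \<open>u w\<close> is at most \<open>u w0\<close>; beyond it both relations reverse. So
    \<open>u\<close> may be frozen at \<open>w0\<close>, and the mean 0 of \<open>W\<close> then
    removes it.\<close>
  have key: "u w * W w \<le> u w0 * W w" if w: "0 < w" "w \<le> pi" for w
  proof (cases "w \<le> w0")
    case True
    then have "cos w \<ge> c0" using cos_monotone_0_pi_le[of w w0] w w0 by simp
    moreover have "cos w \<le> (1 + sqrt 3)/2" by (rule order_trans[OF cos_le_one g1])
    ultimately have "W w \<ge> 0" unfolding Wfac by simp
    then show ?thesis using umono[of w w0] True w w0 by (intro mult_right_mono) auto
  next
    case False
    then have "cos w \<le> c0" using cos_monotone_0_pi_le[of w0 w] w w0 by simp
    moreover have "cos w \<le> (1 + sqrt 3)/2" by (rule order_trans[OF cos_le_one g1])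
    ultimately have "W w \<le> 0" unfolding Wfac by (simp add: mult_nonpos_nonneg)
    then show ?thesis using umono[of w0 w] False w w0 by (intro mult_right_mono_neg) auto
  qed
  define S where "S = integral {0..pi} (\<lambda>w. sin w^q * ((cos w)\<^sup>2 * (3 - 2 * (cos w)\<^sup>2)))"
  have S: "((\<lambda>w. sin w^q * ((cos w)\<^sup>2 * (3 - 2 * (cos w)\<^sup>2))) has_integral S) {0..pi}"
    unfolding S_def by (intro integrable_integral integrable_continuous_real continuous_intros)
  have Spos: "S > 0" unfolding S_def
  proof (rule integral_pos_if_continuous[where c = "pi/4"])
    fix x :: real assume "x \<in> {0..pi}"
    moreover have "(cos x)\<^sup>2 \<le> 1" by (simp add: abs_square_le_1)
    ultimately show "0 \<le> sin x^q * ((cos x)\<^sup>2 * (3 - 2 * (cos x)\<^sup>2))"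
      by (intro mult_nonneg_nonneg zero_le_power[OF sin_ge_zero] zero_le_power2) auto
  qed (auto intro!: continuous_intros simp: cos_45 sin_45 power_divide)
  have W0: "(W has_integral 0) {0..pi}"
  proof -
    have "((\<lambda>w. 2 * sin w - sin w * cos w) has_real_derivative W w) (at w)" for w
    proof -
      have "((\<lambda>w. 2 * sin w - sin w * cos w) has_real_derivative (2 * cos w - (cos w * cos w - sin w * sin w))) (at w)"
        by (auto intro!: derivative_eq_intros)
      moreover have "2 * cos w - (cos w * cos w - sin w * sin w) = W w"
        using sin_cos_squared_add[of w] unfolding W_def power2_eq_square by argo
      ultimately show ?thesis by simp
    qed
    from has_integral_antiderivative[OF _ this, of 0 pi] show ?thesis by simp
  qed
  have odd: "((\<lambda>w. sin w^q * cos w) has_integral 0) {0..pi}"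
    by (rule integral_odd_about_half_pi) (auto intro!: continuous_intros)
  have U: "((\<lambda>w. real m * (u w0 * W w - (sin w^q * cos w + sin w^q * ((cos w)\<^sup>2 * (3 - 2 * (cos w)\<^sup>2)))))
     has_integral real m * (u w0 * 0 - (0 + S))) {0..pi}"
    by (intro has_integral_mult_right has_integral_diff has_integral_add W0 odd S)
  \<comment> \<open>At the two endpoints, where sin w = 0, the integrand is replaced by the bound
    itself, so that the comparison holds at every point.\<close>
  have Lw: "((\<lambda>w. if w \<in> {0,pi} then real m * (u w0 * W w - (sin w^q * cos w + sin w^q * ((cos w)\<^sup>2 * (3 - 2 * (cos w)\<^sup>2))))
       else pow_sin_deriv m w * iso_num 2 w / (sin w)\<^sup>2) has_integral mode_coeff m 2) {0..pi}"
    by (rule has_integral_spike_finite[of "{0,pi}", OF _ _ has_integral_mode_coeff]) auto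
  have "mode_coeff m 2 \<le> real m * (u w0 * 0 - (0 + S))"
  proof (rule has_integral_le[OF Lw U])
    fix w assume w: "w \<in> {0..pi}"
    show "(if w \<in> {0,pi} then real m * (u w0 * W w - (sin w^q * cos w + sin w^q * ((cos w)\<^sup>2 * (3 - 2 * (cos w)\<^sup>2))))
       else pow_sin_deriv m w * iso_num 2 w / (sin w)\<^sup>2) \<le> real m * (u w0 * W w - (sin w^q * cos w + sin w^q * ((cos w)\<^sup>2 * (3 - 2 * (cos w)\<^sup>2))))"
    proof (cases "w \<in> {0,pi}")
      case False
      then have w': "0 < w" "w < pi" using w by auto
      then have s: "0 < sin w" and c: "cos w < 1" by (auto intro!: sin_gt_zero cos_less_one_open)
      have s2: "(sin w)\<^sup>2 = (1 - cos w) * (1 + cos w)" by (simp add: sin_squared_eq power2_eq_square algebra_simps)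
      then have c1: "1 + cos w \<noteq> 0" using s by auto
      have "iso_num 2 w = (1 + cos w) * W w"
      proof -
        have "iso_num 2 w = 1 + cos w * (2 * (cos w)\<^sup>2 - 1) + 4 * (sin w)\<^sup>2 * cos w"
          using cos_double_cos[of w] sin_double[of w] by (simp add: iso_num_def power2_eq_square)
        also have "\<dots> = (1 + cos w) * W w" unfolding s2 W_def by (simp add: power2_eq_square algebra_simps)
        finally show ?thesis .
      qed
      then have "pow_sin_deriv m w * iso_num 2 w / (sin w)\<^sup>2 = pow_sin_deriv m w * W w / (1 - cos w)"
        unfolding s2 using c1 by simp
      have dfe: "pow_sin_deriv m w = real m * (w^q * w\<^sup>2 - sin w^q * (sin w)\<^sup>2 * cos w)"
        by (simp add: pow_sin_deriv_def m power_add power2_eq_square)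
      note \<open>pow_sin_deriv m w * iso_num 2 w / (sin w)\<^sup>2 = pow_sin_deriv m w * W w / (1 - cos w)\<close>
      also have "pow_sin_deriv m w * W w / (1 - cos w)
         = real m * (u w * W w - sin w^q * ((1 + cos w) * cos w * W w))"
        unfolding dfe
        unfolding s2 u_def using c by (simp add: field_simps)
      also have "(1 + cos w) * cos w * W w = cos w + (cos w)\<^sup>2 * (3 - 2 * (cos w)\<^sup>2)"
        unfolding W_def by (simp add: power2_eq_square algebra_simps)
      finally have "pow_sin_deriv m w * iso_num 2 w / (sin w)\<^sup>2 = real m * (u w * W w - (sin w^q * cos w + sin w^q * ((cos w)\<^sup>2 * (3 - 2 * (cos w)\<^sup>2))))"
        by (simp add: algebra_simps)
      then show ?thesis using False key[of w] w' by (auto intro!: mult_left_mono)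
    qed auto
  qed
  then show ?thesis using Spos m by (smt (verit) mult_pos_pos of_nat_0_less_iff assms mult_zero_right mult_minus_right zero_less_numeral less_le_trans)
qed

text \<open>The increment from j to j + 2 is nonpositive in both parities: (-1)^j meets a
  nonpositive odd moment for even j and a positive even moment for odd j. The case k = 2 needs its
  own estimate because mode 0 is M itself; k = 3 is strict because mode 1 vanishes and the moment of
  order 2 is positive.\<close>

lemma mode_coeff_neg:
  assumes "m \<ge> 3" "k \<ge> 2" shows "mode_coeff m k < 0"
  using assms(2)
proof (induction k rule: less_induct)
  case (less k)
  consider "k = 2" | "k = 3" | "k \<ge> 4" using less by linarith
  then show ?case
  proof cases
    case 1
    then show ?thesis using mode_coeff_2_neg[OF assms(1)] by simp
  next
    case 2
    then show ?thesis using mode_coeff_Suc_Suc[of m 1] cos_moment_even_pos[of 2 m] assms(1) mode_coeff_1[of m] by (simp add: numeral_3_eq_3 numeral_2_eq_2)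
  next
    case 3
    then obtain j where j: "k = j + 2" "j \<ge> 2" using le_Suc_ex[of 2 k] by (auto simp: add.commute)
    have b: "mode_coeff m j < 0" using less.IH[of j] j by simp
    have "2 * (-1)^j * (real j + 1) * cos_moment m (j+1) \<le> 0"
    proof (cases "even j")
      case True
      then have "cos_moment m (j+1) \<le> 0" using j assms(1) by (intro cos_moment_odd_nonpos) auto
      then show ?thesis using True by (simp add: mult_nonneg_nonpos)
    next
      case False
      then have "cos_moment m (j+1) > 0" using j assms(1) by (intro cos_moment_even_pos) auto
      then show ?thesis using False by (simp add: mult_nonpos_nonneg mult_nonneg_nonneg)
    qed
    then have "mode_coeff m (j+2) < 0" using b mode_coeff_Suc_Suc[of m j] by linarith
    then show ?thesis using j by simp
  qed
qed

lemma mode_coeff_nonpos: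
  assumes "m \<ge> 1" "k \<ge> 1" shows "mode_coeff m k \<le> 0"
proof -
  consider "m = 1" | "m = 2" | "m \<ge> 3" "k = 1" | "m \<ge> 3" "k \<ge> 2" using assms by linarith
  then show ?thesis
  proof cases
    case 2
    show ?thesis
    proof (cases "even k")
      case True
      then have "1 \<le> (real k)\<^sup>2" using assms by simp
      then show ?thesis using 2 True by (simp add: mode_coeff_two_even)
    qed (use 2 in \<open>simp add: mode_coeff_two_odd\<close>)
  qed (use mode_coeff_one_eq_0[OF assms(2)] mode_coeff_1[of m] mode_coeff_neg[of m k] in auto)
qed

section \<open>Tangents and the visual angle\<close>

definition nvec :: "real \<Rightarrow> real^2" where "nvec a = vector [cos a, sin a]"
definition tvec :: "real \<Rightarrow> real^2" where "tvec a = vector [- sin a, cos a]"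

lemma nvec_nth [simp]: "nvec a $ 1 = cos a" "nvec a $ 2 = sin a"
  and tvec_nth [simp]: "tvec a $ 1 = - sin a" "tvec a $ 2 = cos a"
  by (simp_all add: nvec_def tvec_def)

lemma inner_real2: "(x::real^2) \<bullet> y = x $ 1 * y $ 1 + x $ 2 * y $ 2"
  by (simp add: inner_vec_def sum_2)

lemma vec2_eq_iff: "(x::real^2) = y \<longleftrightarrow> x $ 1 = y $ 1 \<and> x $ 2 = y $ 2"
  by (simp add: vec_eq_iff forall_2)

lemma nvec_tvec_inner [simp]:
  "nvec a \<bullet> nvec a = 1" "tvec a \<bullet> tvec a = 1" "nvec a \<bullet> tvec a = 0" "tvec a \<bullet> nvec a = 0"
  by (simp_all add: inner_real2 flip: power2_eq_square)

lemma norm_nvec [simp]: "norm (nvec a) = 1" and norm_tvec [simp]: "norm (tvec a) = 1"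
  by (simp_all add: norm_eq_sqrt_inner)

lemma nvec_tvec_inner_diff:
  "tvec a \<bullet> nvec b = sin (b - a)" "nvec a \<bullet> tvec b = - sin (b - a)"
  "nvec a \<bullet> nvec b = cos (b - a)" "tvec a \<bullet> tvec b = cos (b - a)"
  by (simp_all add: inner_real2 sin_diff cos_diff)

lemma nvec_tvec_decomp: "x = (x \<bullet> nvec a) *\<^sub>R nvec a + (x \<bullet> tvec a) *\<^sub>R tvec a"
proof -
  have *: "cos a * (cos a * y) + sin a * (sin a * y) = y" for y
  proof -
    have h: "cos a * cos a + sin a * sin a = 1"
      using sin_cos_squared_add2[of a] by (simp add: power2_eq_square)
    have "(cos a * cos a + sin a * sin a) * y = y" unfolding h by simp
    then show ?thesis by (simp only: distrib_right mult.assoc)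
  qed
  show ?thesis by (simp add: vec2_eq_iff inner_real2 algebra_simps *)
qed

lemma nvec_pi [simp]: "nvec (a + pi) = - nvec a"
  by (simp add: vec2_eq_iff)

lemma nvec_2pi [simp]: "nvec (a + 2*pi) = nvec a"
  by (simp add: vec2_eq_iff)

lemma nvec_eq_iff: "nvec a = nvec b \<longleftrightarrow> (\<exists>k::int. a = b + 2 * pi * k)"
  using sin_cos_eq_iff[of a b] by (auto simp: vec2_eq_iff)

lemma tvec_eq_iff: "tvec a = tvec b \<longleftrightarrow> nvec a = nvec b"
  by (auto simp: vec2_eq_iff)

lemma sin_diff_zero_nvec:
  assumes "sin (b - a) = 0" shows "nvec b = nvec a \<or> nvec b = - nvec a"
proof -
  have "nvec b = (nvec b \<bullet> nvec a) *\<^sub>R nvec a + (nvec b \<bullet> tvec a) *\<^sub>R tvec a" by (rule nvec_tvec_decomp)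
  also have "nvec b \<bullet> tvec a = 0" using assms by (simp add: nvec_tvec_inner_diff sin_diff algebra_simps)
  also have "nvec b \<bullet> nvec a = cos (b - a)" by (simp add: nvec_tvec_inner_diff cos_diff)
  finally have "nvec b = cos (b - a) *\<^sub>R nvec a" by simp
  moreover have "cos (b - a) = 1 \<or> cos (b - a) = -1" using assms by (metis sin_zero_abs_cos_one abs_eq_iff')
  ultimately show ?thesis by auto
qed

lemma unit_vector_nvec:
  assumes "norm (u::real^2) = 1"
  obtains a where "0 \<le> a" "a < 2*pi" "u = nvec a"
proof -
  have "(u $ 1)\<^sup>2 + (u $ 2)\<^sup>2 = 1"
    using assms by (simp add: norm_eq_1 inner_real2 power2_eq_square)
  then obtain t where "0 \<le> t" "t < 2*pi" "u $ 1 = cos t" "u $ 2 = sin t"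
    using sincos_total_2pi by metis
  then show ?thesis using that[of t] by (simp add: vec2_eq_iff)
qed

lemma nvec_reduce:
  obtains b where "0 \<le> b" "b < 2*pi" "nvec b = nvec a"
  by (rule unit_vector_nvec[of "nvec a"]) (use that in auto)

text \<open>Applied to the gap between a support line and a point, this finds a tangent through the
  point; the sign of the derivative tells on which side of the point of tangency the point lies. The
  witness is the least argument in [a, b] at which g <= 0.\<close>

lemma downcrossing:
  fixes g :: "real \<Rightarrow> real"
  assumes d: "\<And>x. (g has_real_derivative g' x) (at x)" and ab: "a \<le> b" "0 < g a" "g b < 0"
  obtains c where "a \<le> c" "c \<le> b" "g c = 0" "g' c \<le> 0"
proof -
  have cont: "continuous_on S g" for S
    using d DERIV_isCont continuous_at_imp_continuous_on by blast
  define S where "S = {a..b} \<inter> g -` {..0}"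
  have "compact S" unfolding S_def
    by (intro compact_Int_closed continuous_closed_vimage) (use d DERIV_isCont in auto)
  moreover have "b \<in> S" using ab by (auto simp: S_def)
  ultimately obtain c where c: "c \<in> S" "\<And>x. x \<in> S \<Longrightarrow> c \<le> x"
    using compact_attains_inf[of S] by blast
  have pos: "0 < g x" if "a \<le> x" "x < c" for x
    using c(2)[of x] that c(1) by (force simp: S_def)
  have ac: "a < c" using c(1) ab by (cases "c = a") (auto simp: S_def)
  have "g c = 0"
  proof (rule ccontr)
    assume "g c \<noteq> 0"
    then have "g c < 0" using c(1) by (auto simp: S_def)
    then obtain z where "a \<le> z" "z \<le> c" "g z = 0"
      using IVT2'[of g c 0 a, OF _ _ _ cont] ab(2) ac less_imp_le by blast
    then have "z < c" using \<open>g c < 0\<close> by (cases "z = c") auto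
    then show False using pos[of z] \<open>a \<le> z\<close> \<open>g z = 0\<close> by simp
  qed
  moreover have "g' c \<le> 0"
  proof (rule ccontr)
    assume "\<not> g' c \<le> 0"
    then obtain e where e: "e > 0" "\<And>h. 0 < h \<Longrightarrow> h < e \<Longrightarrow> g (c - h) < g c"
      using DERIV_pos_inc_left[OF d, of c] by (auto simp: not_le)
    define h where "h = min (e/2) (c - a)"
    have "0 < h" "h < e" "a \<le> c - h" using e ac by (auto simp: h_def min_def)
    then show False using e(2)[of h] pos[of "c - h"] \<open>g c = 0\<close> by simp
  qed
  ultimately show ?thesis using that c(1) by (auto simp: S_def)
qed

section \<open>The support function and the points of tangency\<close>

locale planar_body =
  fixes K :: "(real^2) set" and p p' p'' :: "real \<Rightarrow> real"
  assumes compact_K: "compact K" and convex_K: "convex K" and interior_K: "interior K \<noteq> {}"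
    and p_eq: "p = support_function K"
    and dp: "\<And>a. (p has_real_derivative p' a) (at a)"
    and dp': "\<And>a. (p' has_real_derivative p'' a) (at a)"
begin

text \<open>The classical parametrisation of the boundary by the direction of the outer normal. That
  it takes values in K is \<open>contact_in_K\<close>.\<close>

definition contact :: "real \<Rightarrow> real^2" where "contact a = p a *\<^sub>R nvec a + p' a *\<^sub>R tvec a"

lemma K_nonempty: "K \<noteq> {}" using interior_K interior_subset by blast

lemma p_SUP: "p a = (SUP x\<in>K. x \<bullet> nvec a)"
  by (simp add: p_eq support_function_def inner_real2)

lemma p_bdd: "bdd_above ((\<lambda>x. x \<bullet> nvec a) ` K)"
  by (intro bounded_imp_bdd_above compact_imp_bounded compact_continuous_image compact_K continuous_intros)

lemma le_p: "x \<in> K \<Longrightarrow> x \<bullet> nvec a \<le> p a"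
  unfolding p_SUP by (rule cSUP_upper[OF _ p_bdd])

lemma p_attained: obtains x where "x \<in> K" "x \<bullet> nvec a = p a"
proof -
  have "continuous_on K (\<lambda>x. x \<bullet> nvec a)" by (intro continuous_intros)
  then obtain x where x: "x \<in> K" "\<And>y. y \<in> K \<Longrightarrow> y \<bullet> nvec a \<le> x \<bullet> nvec a"
    using continuous_attains_sup[OF compact_K K_nonempty] by blast
  then have "x \<bullet> nvec a = p a"
    unfolding p_SUP by (intro cSup_eq_maximum[symmetric]) auto
  then show ?thesis using that x by blast
qed

text \<open>Periodicity in the form used throughout: equality of directions replaces explicit
  multiples of 2 pi. For the derivative it follows from uniqueness of derivatives.\<close>

lemma p_cong: assumes "nvec a = nvec b" shows "p a = p b" "p' a = p' b" "tvec a = tvec b" "contact a = contact b"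
proof -
  show eq: "p a = p b" using assms by (simp add: p_SUP)
  show "tvec a = tvec b" using assms by (simp add: tvec_eq_iff)
  obtain k :: int where k: "a = b + 2*pi*k" using assms nvec_eq_iff by blast
  have "(\<lambda>x. p (x + 2*pi*k)) = p"
  proof
    fix x
    have "nvec (x + 2*pi*k) = nvec x" by (auto simp: nvec_eq_iff)
    then show "p (x + 2*pi*k) = p x" by (simp add: p_SUP)
  qed
  moreover have "((\<lambda>x. p (x + 2*pi*k)) has_real_derivative p' (b + 2*pi*k)) (at b)"
    using dp[of "b + 2*pi*k"] by (simp add: DERIV_shift)
  ultimately have "p' (b + 2*pi*k) = p' b" using DERIV_unique[OF dp[of b]] by simp
  then show "p' a = p' b" using k by simp
  then show "contact a = contact b" using eq assms by (simp add: contact_def tvec_eq_iff)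
qed

lemma p_2pi: "p (a + 2*pi) = p a" and p'_2pi: "p' (a + 2*pi) = p' a"
  by (rule p_cong; simp)+

lemma cont_p [continuous_intros]: "continuous_on S p"
  and cont_p' [continuous_intros]: "continuous_on S p'"
  by (meson dp dp' DERIV_isCont continuous_at_imp_continuous_on)+

lemma contact_inner [simp]: "contact a \<bullet> nvec a = p a" "contact a \<bullet> tvec a = p' a"
  by (simp_all add: contact_def inner_add_left)

lemma DERIV_inner_nvec: "((\<lambda>b. x \<bullet> nvec b) has_real_derivative (x \<bullet> tvec a)) (at a)"
  unfolding inner_real2 by (auto intro!: derivative_eq_intros simp: algebra_simps)

text \<open>The nonnegative function \<open>p b - x \<bullet> nvec b\<close> has a zero, hence a
  minimum, at b = a, and its vanishing derivative fixes the tangential coordinate of x as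
  \<open>p' a\<close>. This is where differentiability of p yields strict convexity of K.\<close>

lemma support_point_unique:
  assumes "x \<in> K" "x \<bullet> nvec a = p a" shows "x = contact a"
proof -
  have "((\<lambda>b. p b - x \<bullet> nvec b) has_real_derivative (p' a - x \<bullet> tvec a)) (at a)"
    by (intro derivative_intros dp DERIV_inner_nvec)
  then have "p' a - x \<bullet> tvec a = 0"
    by (rule DERIV_local_min[of _ _ _ 1]) (use le_p[OF assms(1)] assms(2) in auto)
  then show ?thesis
    using nvec_tvec_decomp[of x a] assms(2) by (simp add: contact_def)
qed

lemma contact_in_K: "contact a \<in> K"
  using p_attained support_point_unique by metis

text \<open>A ball inside K forces positive width in every direction. This excludes two opposite
  support lines through one point and supplies the sign change in the search for tangents.\<close>

lemma width_pos: "0 < p a + p (a + pi)"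
proof -
  obtain x e where e: "e > 0" "cball x e \<subseteq> K"
    using interior_K by (auto simp: mem_interior_cball)
  have "x + e *\<^sub>R nvec a \<in> K" "x \<in> K" using e by (auto simp: dist_norm subset_eq)
  then have "x \<bullet> nvec a + e \<le> p a" "- (x \<bullet> nvec a) \<le> p (a + pi)"
    using le_p[of "x + e *\<^sub>R nvec a" a] le_p[of x "a + pi"] by (auto simp: inner_add_left)
  then show ?thesis using e by linarith
qed

lemma mem_K_iff: "x \<in> K \<longleftrightarrow> (\<forall>a. x \<bullet> nvec a \<le> p a)"
proof
  assume r: "\<forall>a. x \<bullet> nvec a \<le> p a"
  show "x \<in> K"
  proof (rule ccontr)
    assume "x \<notin> K"
    then obtain v b where v: "v \<bullet> x < b" "\<forall>y\<in>K. v \<bullet> y > b"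
      using separating_hyperplane_closed_point[OF convex_K compact_imp_closed[OF compact_K]] by blast
    then have "v \<noteq> 0" using K_nonempty by (metis all_not_in_conv inner_zero_left less_asym)
    then have "norm (- v /\<^sub>R norm v) = 1" by simp
    then obtain a where a: "- v /\<^sub>R norm v = nvec a" using unit_vector_nvec by metis
    obtain y where y: "y \<in> K" "y \<bullet> nvec a = p a" using p_attained by blast
    have "v \<bullet> x < v \<bullet> y" using v y by force
    then have "(v \<bullet> x) / norm v < (v \<bullet> y) / norm v" using \<open>v \<noteq> 0\<close> by (simp add: divide_strict_right_mono)
    then have "y \<bullet> nvec a < x \<bullet> nvec a"
      unfolding a[symmetric] by (simp add: inner_commute divide_inverse mult.commute)
    then show False using r y by (simp add: not_less[symmetric])
  qed
qed (use le_p in auto)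

section \<open>The two tangents from an exterior point\<close>

lemma DERIV_gap: "((\<lambda>b. p b - P \<bullet> nvec b) has_real_derivative ((contact a - P) \<bullet> tvec a)) (at a)"
  by (rule derivative_eq_intros dp DERIV_inner_nvec refl | simp add: inner_diff_left)+

lemma tangent_point_repr:
  assumes "P \<bullet> nvec a = p a" shows "P = contact a + ((P - contact a) \<bullet> tvec a) *\<^sub>R tvec a"
  using nvec_tvec_decomp[of "P - contact a" a] assms by (simp add: inner_diff_left algebra_simps)

lemma exterior_gap_neg:
  assumes "P \<notin> K" obtains a where "p a < P \<bullet> nvec a" "P \<bullet> nvec (a + pi) < p (a + pi)"
proof -
  obtain a where a: "p a < P \<bullet> nvec a" using assms mem_K_iff by (auto simp: not_le)
  then show ?thesis using that[of a] width_pos[of a] by simp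
qed

text \<open>The gap \<open>p b - P \<bullet> nvec b\<close> is negative in some direction a and, by
  \<open>width_pos\<close>, positive in the opposite one. Between a + pi and a + 2 pi it crosses
  downwards, and there P lies ahead of the point of tangency. The upward crossing between a and a +
  pi gives the backward tangent of the next lemma.\<close>

lemma exists_forward_tangent:
  assumes "P \<notin> K"
  obtains a t where "0 \<le> a" "a < 2*pi" "0 < t" "P = contact a + t *\<^sub>R tvec a"
proof -
  obtain a where a: "p a < P \<bullet> nvec a" "P \<bullet> nvec (a + pi) < p (a + pi)"
    using exterior_gap_neg[OF assms] by blast
  obtain c where c: "p c - P \<bullet> nvec c = 0" "(contact c - P) \<bullet> tvec c \<le> 0"
  proof (rule downcrossing[OF DERIV_gap[of P], of "a + pi" "a + 2*pi"])
    show "p (a + 2*pi) - P \<bullet> nvec (a + 2*pi) < 0" using a(1) by (simp add: p_2pi)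
  qed (use a in auto)
  define t where "t = (P - contact c) \<bullet> tvec c"
  have P: "P = contact c + t *\<^sub>R tvec c" using tangent_point_repr[of P c] c(1) by (simp add: t_def)
  have "t \<noteq> 0" using P assms contact_in_K[of c] by auto
  moreover have "0 \<le> t" using c(2) by (simp add: t_def inner_diff_left)
  moreover obtain b where b: "0 \<le> b" "b < 2*pi" "nvec b = nvec c" using nvec_reduce by blast
  ultimately show ?thesis using that[of b t] P p_cong[OF b(3)] by simp
qed

lemma exists_backward_tangent:
  assumes "P \<notin> K"
  obtains a t where "0 < t" "P = contact a - t *\<^sub>R tvec a"
proof -
  obtain a where a: "p a < P \<bullet> nvec a" "P \<bullet> nvec (a + pi) < p (a + pi)"
    using exterior_gap_neg[OF assms] by blast
  obtain c where c: "- (p c - P \<bullet> nvec c) = 0" "- ((contact c - P) \<bullet> tvec c) \<le> 0"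
    by (rule downcrossing[OF DERIV_minus[OF DERIV_gap[of P]], of a "a + pi"]) (use a in auto)
  define t where "t = (contact c - P) \<bullet> tvec c"
  have P: "P = contact c - t *\<^sub>R tvec c"
    using tangent_point_repr[of P c] c(1) by (simp add: t_def inner_diff_left algebra_simps)
  have "t \<noteq> 0" using P assms contact_in_K[of c] by auto
  moreover have "0 \<le> t" using c(2) by (simp add: t_def)
  ultimately show ?thesis using that[of t c] P by simp
qed

lemma tangent_not_in_K:
  assumes "P = contact a + t *\<^sub>R tvec a" "t \<noteq> 0" shows "P \<notin> K"
proof
  assume "P \<in> K"
  moreover have "P \<bullet> nvec a = p a" using assms by (simp add: inner_add_left)
  ultimately have "P = contact a" by (rule support_point_unique)
  then show False using assms by (auto dest: arg_cong[of _ _ norm])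
qed

text \<open>The point \<open>contact a\<close> lies in K, hence on the inner side of the support
  line with normal b, which passes through P. Uniqueness of tangents rests on this inequality and on
  \<open>width_pos\<close>.\<close>

lemma tangent_sign:
  assumes "P = contact a + t *\<^sub>R tvec a" "P = contact b + s *\<^sub>R tvec b"
  shows "0 \<le> t * sin (b - a)"
proof -
  have "contact a \<bullet> nvec b \<le> p b" by (rule le_p[OF contact_in_K])
  also have "p b = P \<bullet> nvec b" unfolding assms(2) by (simp add: inner_add_left)
  also have "P \<bullet> nvec b = contact a \<bullet> nvec b + t * sin (b - a)"
    unfolding assms(1) by (simp add: inner_add_left nvec_tvec_inner_diff)
  finally show ?thesis by simp
qed

lemma tangent_not_parallel:
  assumes "P = contact a + t *\<^sub>R tvec a" "P = contact b + s *\<^sub>R tvec b" "sin (b - a) = 0"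
  shows "nvec b = nvec a" "s = t"
proof -
  have "nvec b \<noteq> - nvec a"
  proof
    assume *: "nvec b = - nvec a"
    then have "nvec b = nvec (a + pi)" by simp
    then have "p b = p (a + pi)" by (rule p_cong)
    moreover have "p b = P \<bullet> nvec b" unfolding assms(2) by (simp add: inner_add_left)
    moreover have "p a = P \<bullet> nvec a" unfolding assms(1) by (simp add: inner_add_left)
    ultimately show False using width_pos[of a] * by simp
  qed
  then show *: "nvec b = nvec a" using sin_diff_zero_nvec[OF assms(3)] by blast
  show "s = t" using assms(1,2) p_cong[OF *] by (auto dest: arg_cong[of _ _ norm])
qed

text \<open>Applied in both orders, \<open>tangent_sign\<close> gives t sin (b - a) >= 0 and s sin
  (b - a) <= 0; with t s > 0 only sin (b - a) = 0 is left.\<close>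

lemma tangent_same_side_unique:
  assumes "P = contact a + t *\<^sub>R tvec a" "P = contact b + s *\<^sub>R tvec b" "0 < t * s"
  shows "nvec b = nvec a" "s = t"
proof -
  have "sin (a - b) = - sin (b - a)" by (simp add: sin_diff)
  then have "s * sin (b - a) \<le> 0" using tangent_sign[OF assms(2,1)] by simp
  from mult_nonneg_nonpos[OF tangent_sign[OF assms(1,2)] this]
  have "(t * s) * (sin (b - a))\<^sup>2 \<le> 0" by (simp add: power2_eq_square mult_ac)
  moreover have "0 < (t * s) * (sin (b - a))\<^sup>2" if "sin (b - a) \<noteq> 0"
    by (rule mult_pos_pos[OF assms(3)]) (use that in simp)
  ultimately have "sin (b - a) = 0" by force
  then show "nvec b = nvec a" "s = t" using tangent_not_parallel[OF assms(1,2)] by auto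
qed

lemma tangent_pair:
  assumes P: "P = contact a + t *\<^sub>R tvec a" and t: "0 < t"
  obtains d s where "0 < d" "d < pi" "0 < s" "P = contact (a + d) - s *\<^sub>R tvec (a + d)"
proof -
  have "P \<notin> K" using tangent_not_in_K[OF P] t by simp
  then obtain b s where s: "0 < s" "P = contact b - s *\<^sub>R tvec b" using exists_backward_tangent by blast
  then have P': "P = contact b + (- s) *\<^sub>R tvec b" by simp
  have "0 \<le> sin (b - a)" using tangent_sign[OF P P'] t by (simp add: zero_le_mult_iff)
  moreover have "sin (b - a) \<noteq> 0" using tangent_not_parallel(2)[OF P P'] t s by auto
  ultimately have sp: "0 < sin (b - a)" by simp
  \<comment> \<open>Since sin (b - a) > 0, \<open>arccos\<close> reduces b - a modulo 2 pi to an
    angle strictly between 0 and pi.\<close>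
  define d where "d = arccos (cos (b - a))"
  have "cos d = cos (b - a)" unfolding d_def by (simp add: cos_arccos)
  moreover have "sin d = sin (b - a)"
    unfolding d_def using sp by (simp add: sin_arccos cos_squared_eq)
  ultimately have "nvec (a + d) = nvec b"
    using sin_cos_eq_iff[of d "b - a"] by (auto simp: nvec_eq_iff)
  moreover have "0 < d" "d < pi"
  proof -
    have "-1 < cos (b - a)" "cos (b - a) < 1"
    proof -
      have "(cos (b - a))\<^sup>2 < 1" unfolding cos_squared_eq using sp by simp
      then have "\<bar>cos (b - a)\<bar> < 1" by (simp add: abs_square_less_1)
      then show "-1 < cos (b - a)" "cos (b - a) < 1" by simp_all
    qed
    then show "0 < d" "d < pi" unfolding d_def using arccos_lt_bounded by auto
  qed
  ultimately show ?thesis using that[of d s] s p_cong[of "a + d" b] by simp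
qed

text \<open>Links the definition by supporting lines with the parametrised tangents. A supporting
  line through P whose ray meets K touches it at some \<open>contact c\<close>, so u is plus or
  minus \<open>tvec c\<close>, and the sign selects the forward or the backward tangent.\<close>

lemma tangent_direction_iff:
  assumes P: "P = contact a + t *\<^sub>R tvec a" "0 < t" and P2: "P = contact b - s *\<^sub>R tvec b" "0 < s"
  shows "tangent_direction K P u \<longleftrightarrow> u = - tvec a \<or> u = tvec b"
proof
  have PK: "P \<notin> K" using tangent_not_in_K[OF P(1)] P(2) by simp
  assume "tangent_direction K P u"
  then obtain r n where u: "norm u = 1" "r \<ge> 0" "P + r *\<^sub>R u \<in> K" "n \<noteq> 0" "n \<bullet> u = 0"
     "\<And>x. x \<in> K \<Longrightarrow> 0 \<le> n \<bullet> (x - P)" unfolding tangent_direction_def by auto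
  have "norm (- n /\<^sub>R norm n) = 1" using u by simp
  then obtain c where c: "- n /\<^sub>R norm n = nvec c" using unit_vector_nvec by metis
  have n: "n = - norm n *\<^sub>R nvec c" unfolding c[symmetric] using u by simp
  have nu: "u \<bullet> nvec c = 0" unfolding c[symmetric] using u by (simp add: inner_commute)
  have le: "x \<bullet> nvec c \<le> P \<bullet> nvec c" if "x \<in> K" for x
  proof -
    have "0 \<le> norm n * ((P - x) \<bullet> nvec c)"
      using u(6)[OF that] by (subst (asm) n) (simp add: inner_diff_left inner_diff_right inner_commute algebra_simps)
    then show ?thesis using u(4) by (simp add: zero_le_mult_iff inner_diff_left)
  qed
  have Pn: "(P + r *\<^sub>R u) \<bullet> nvec c = P \<bullet> nvec c" by (simp add: inner_add_left nu)
  have "p c = P \<bullet> nvec c"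
    using le[OF contact_in_K[of c]] le_p[OF u(3), of c] Pn by simp
  then have Xc: "P + r *\<^sub>R u = contact c" using support_point_unique[OF u(3), of c] Pn by simp
  define k where "k = u \<bullet> tvec c"
  have uk: "u = k *\<^sub>R tvec c" using nvec_tvec_decomp[of u c] nu by (simp add: k_def)
  then have k: "k = 1 \<or> k = -1" using u(1) by (auto simp: abs_if split: if_splits)
  have r0: "r > 0" using u(2,3) PK by (cases "r = 0") auto
  have Pc: "P = contact c + (- r * k) *\<^sub>R tvec c" using Xc unfolding uk by (simp add: algebra_simps)
  from k show "u = - tvec a \<or> u = tvec b"
  proof
    assume k1: "k = -1"
    then have "nvec c = nvec a" using tangent_same_side_unique(1)[OF P(1) Pc] r0 P(2) by simp
    then have "tvec c = tvec a" by (rule p_cong)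
    then show ?thesis using uk k1 by simp
  next
    assume k1: "k = 1"
    have Pb: "P = contact b + (- s) *\<^sub>R tvec b" using P2 by simp
    have "nvec c = nvec b" using tangent_same_side_unique(1)[OF Pb Pc] r0 P2(2) k1 by simp
    then have "tvec c = tvec b" by (rule p_cong)
    then show ?thesis using uk k1 by simp
  qed
next
  have *: "tangent_direction K P v" if "P + r *\<^sub>R v = contact c" "0 \<le> r" "norm v = 1" "nvec c \<bullet> v = 0" for r v c
    unfolding tangent_direction_def
  proof (intro conjI exI)
    have "v \<bullet> nvec c = 0" using that(4) by (simp add: inner_commute)
    then have "P \<bullet> nvec c = p c" using arg_cong[OF that(1), of "\<lambda>x. x \<bullet> nvec c"]
      by (simp add: inner_add_left)
    then show "\<forall>x\<in>K. 0 \<le> (- nvec c) \<bullet> (x - P)"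
      using le_p[of _ c] by (simp add: inner_diff_right inner_commute)
    show "- nvec c \<noteq> 0" by (metis neg_equal_0_iff_equal norm_nvec norm_zero zero_neq_one)
  qed (use that contact_in_K in auto)
  assume "u = - tvec a \<or> u = tvec b"
  then show "tangent_direction K P u"
  proof
    assume "u = - tvec a"
    moreover have "P + t *\<^sub>R (- tvec a) = contact a" using P(1) by simp
    ultimately show ?thesis using *[of t "- tvec a" a] P(2) by simp
  next
    assume "u = tvec b"
    moreover have "P + s *\<^sub>R tvec b = contact b" using P2(1) by simp
    ultimately show ?thesis using *[of s "tvec b" b] P2(2) by simp
  qed
qed

text \<open>The normals at the two points of tangency enclose d, but the directions from P towards K
  are \<open>- tvec a\<close> and \<open>tvec (a + d)\<close>, whose inner product is - cos
  d.\<close>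

lemma visual_angle_eq:
  assumes P: "P = contact a + t *\<^sub>R tvec a" "0 < t"
    and d: "0 < d" "d < pi" and P2: "P = contact (a + d) - s *\<^sub>R tvec (a + d)" "0 < s"
  shows "visual_angle K P = pi - d"
proof -
  note td = tangent_direction_iff[OF P P2]
  have ip: "(- tvec a) \<bullet> tvec (a + d) = - cos d"
    by (simp add: nvec_tvec_inner_diff)
  have arc: "arccos (- cos d) = pi - d" using d by (simp add: arccos_minus arccos_cos)
  have "tvec (a + d) \<noteq> - tvec a"
  proof
    assume "tvec (a + d) = - tvec a"
    then have "- cos d = tvec a \<bullet> tvec a * (-1) * (-1)" using ip by (simp only: inner_minus_left inner_minus_right)
    then have "cos d = -1" by simp
    then show False using cos_monotone_0_pi[of d pi] d by simp
  qed
  then have ne: "- tvec a \<noteq> tvec (a + d)" by metis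
  show ?thesis
    unfolding visual_angle_def td
  proof (rule the_equality)
    show "\<exists>u v. u \<noteq> v \<and> (u = - tvec a \<or> u = tvec (a + d)) \<and> (v = - tvec a \<or> v = tvec (a + d)) \<and> pi - d = arccos (u \<bullet> v)"
      by (rule exI[of _ "- tvec a"], rule exI[of _ "tvec (a + d)"]) (simp only: ne ip arc not_False_eq_True simp_thms)
  qed (use ip arc in \<open>auto simp: inner_commute\<close>)
qed

text \<open>The half-tangent with normal direction a leaves the curve of points seen under the angle t, that is,
  meets the support line with normal direction a + pi - t, at distance tau t a from the point of
  tangency.\<close>
definition tau :: "real \<Rightarrow> real \<Rightarrow> real" where
  "tau t a = (p (a + pi - t) + p a * cos t - p' a * sin t) / sin t"

lemma less_tau_iff:
  assumes "P = contact a + r *\<^sub>R tvec a" "0 < t" "t < pi"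
  shows "r < tau t a \<longleftrightarrow> P \<bullet> nvec (a + pi - t) < p (a + pi - t)"
proof -
  have "a + pi - t = a + (pi - t)" by simp
  then have "P \<bullet> nvec (a + pi - t) = - p a * cos t + (p' a + r) * sin t"
    unfolding assms(1) by (simp only:) (simp add: contact_def inner_add_left nvec_tvec_inner_diff algebra_simps)
  then show ?thesis unfolding tau_def using sin_gt_zero[OF assms(2,3)]
    by (simp only: less_divide_eq if_True) (simp only: distrib_right, linarith)
qed

text \<open>Let a + d be the normal of the second tangent and e = pi - t. The claim becomes: P is
  strictly inside the support line of normal a + e iff d < e. For d < e the second point of tangency
  lies in K and further out than P in that direction. For e <= d the direction a + e lies in the
  cone of the two tangent normals.\<close>

lemma visual_angle_props:
  assumes P: "P = contact a + r *\<^sub>R tvec a" "0 < r"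
  shows visual_angle_range: "0 < visual_angle K P" "visual_angle K P < pi"
    and visual_angle_gt_iff: "0 < t \<Longrightarrow> t < pi \<Longrightarrow> t < visual_angle K P \<longleftrightarrow> r < tau t a"
proof -
  obtain d s where d: "0 < d" "d < pi" "0 < s" "P = contact (a + d) - s *\<^sub>R tvec (a + d)"
    using tangent_pair[OF P] by blast
  have va: "visual_angle K P = pi - d" using visual_angle_eq[OF P d(1,2,4,3)] .
  then show "0 < visual_angle K P" "visual_angle K P < pi" using d by auto
  assume t: "0 < t" "t < pi"
  define e where "e = pi - t"
  have e: "0 < e" "e < pi" using t by (auto simp: e_def)
  have "r < tau t a \<longleftrightarrow> P \<bullet> nvec (a + e) < p (a + e)"
    using less_tau_iff[OF P(1) t] by (simp add: e_def add_diff_eq)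
  also have "\<dots> \<longleftrightarrow> d < e"
  proof
    assume "d < e"
    have "contact (a + d) \<bullet> nvec (a + e) \<le> p (a + e)" by (rule le_p[OF contact_in_K])
    moreover have "contact (a + d) = P + s *\<^sub>R tvec (a + d)" using d(4) by simp
    moreover have "0 < s * sin (e - d)" using \<open>d < e\<close> e d by (intro mult_pos_pos sin_gt_zero) auto
    ultimately show "P \<bullet> nvec (a + e) < p (a + e)"
      by (simp add: inner_add_left nvec_tvec_inner_diff)
  next
    assume lt: "P \<bullet> nvec (a + e) < p (a + e)"
    show "d < e"
    proof (rule ccontr)
      assume "\<not> d < e"
      then have "0 \<le> sin (d - e)" using d e by (intro sin_ge_zero) auto
      have sd: "0 < sin d" "0 < sin e" using d e by (auto intro: sin_gt_zero)
      \<comment> \<open>For e <= d this is a nonnegative combination of the two tangent normals.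
        Both support lines pass through P, so p at a + e is at most the value attained by P.\<close>
      have dec: "sin d *\<^sub>R nvec (a + e) = sin (d - e) *\<^sub>R nvec a + sin e *\<^sub>R nvec (a + d)"
        by (simp add: vec2_eq_iff sin_diff cos_add sin_add algebra_simps)
      define x where "x = contact (a + e)"
      have "sin d * p (a + e) = x \<bullet> (sin d *\<^sub>R nvec (a + e))" by (simp add: x_def)
      also have "\<dots> = sin (d - e) * (x \<bullet> nvec a) + sin e * (x \<bullet> nvec (a + d))"
        unfolding dec by (simp add: inner_add_right)
      also have "\<dots> \<le> sin (d - e) * p a + sin e * p (a + d)"
        using le_p[of x] contact_in_K sd \<open>0 \<le> sin (d - e)\<close> by (intro add_mono mult_left_mono) (auto simp: x_def)
      also have "\<dots> = sin (d - e) * (P \<bullet> nvec a) + sin e * (P \<bullet> nvec (a + d))"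
        using arg_cong[OF P(1), of "\<lambda>x. x \<bullet> nvec a"] arg_cong[OF d(4), of "\<lambda>x. x \<bullet> nvec (a + d)"]
        by (simp add: inner_add_left inner_diff_left)
      also have "\<dots> = P \<bullet> (sin d *\<^sub>R nvec (a + e))"
        unfolding dec by (simp add: inner_add_right)
      finally show False using lt sd by simp
    qed
  qed
  finally show "t < visual_angle K P \<longleftrightarrow> r < tau t a" unfolding va e_def by auto
qed

lemma exterior_visual_angle:
  assumes "P \<notin> K" shows "0 < visual_angle K P" "visual_angle K P < pi"
  using exists_forward_tangent[OF assms] visual_angle_range by metis+

lemma tau_nonneg:
  assumes "0 < t" "t < pi" shows "0 \<le> tau t a"
proof -
  have "contact a \<bullet> nvec (a + (pi - t)) \<le> p (a + (pi - t))" by (rule le_p[OF contact_in_K])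
  moreover have "contact a \<bullet> nvec (a + (pi - t)) = - p a * cos t + p' a * sin t"
    by (simp add: contact_def inner_add_left nvec_tvec_inner_diff)
  ultimately have "0 \<le> p (a + pi - t) + p a * cos t - p' a * sin t" by (simp add: algebra_simps)
  then show ?thesis using sin_gt_zero[OF assms] by (simp add: tau_def)
qed

text \<open>A projection along the compact range of directions of the forward tangent, hence closed; this makes the
  visual angle Borel, not just Lebesgue measurable.\<close>
lemma visual_angle_le_closed:
  assumes t: "0 < t" "t < pi"
  shows "\<exists>C. closed C \<and> {P. P \<notin> K \<and> visual_angle K P \<le> t} = C - K"
proof -
  define T where "T = {z :: real \<times> (real^2). p (fst z) = snd z $ 1 * cos (fst z) + snd z $ 2 * sin (fst z) \<and>
      p' (fst z) \<le> - (snd z $ 1) * sin (fst z) + snd z $ 2 * cos (fst z) \<and>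
      p (fst z + pi - t) \<le> snd z $ 1 * cos (fst z + pi - t) + snd z $ 2 * sin (fst z + pi - t)}"
  have cc: "continuous_on UNIV (\<lambda>z :: real \<times> (real^2). p (fst z))" "continuous_on UNIV (\<lambda>z :: real \<times> (real^2). p' (fst z))"
      "continuous_on UNIV (\<lambda>z :: real \<times> (real^2). p (fst z + pi - t))"
    by (auto intro!: continuous_on_compose2[OF cont_p[of UNIV]] continuous_on_compose2[OF cont_p'[of UNIV]] continuous_intros)
  have "closed T" unfolding T_def
    by (intro closed_Collect_conj closed_Collect_eq closed_Collect_le cc continuous_intros)
  define C where "C = {P. \<exists>a. a \<in> {0..2*pi} \<and> (a, P) \<in> T}"
  have "closed C" unfolding C_def
    by (rule closed_compact_projection[OF _ \<open>closed T\<close>]) simp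
  have memT: "(a, P) \<in> T \<longleftrightarrow> P \<bullet> nvec a = p a \<and> p' a \<le> P \<bullet> tvec a \<and> p (a + pi - t) \<le> P \<bullet> nvec (a + pi - t)" for a P
    by (auto simp: T_def inner_real2)
  have iff: "t < visual_angle K P \<longleftrightarrow> P \<bullet> nvec (a + pi - t) < p (a + pi - t)"
    if P: "P = contact a + r *\<^sub>R tvec a" "0 < r" for P a r
    using visual_angle_gt_iff[OF P t] less_tau_iff[OF P(1) t] by blast
  have "{P. P \<notin> K \<and> visual_angle K P \<le> t} = C - K"
  proof (intro equalityI subsetI)
    fix P assume "P \<in> {P. P \<notin> K \<and> visual_angle K P \<le> t}"
    then have PK: "P \<notin> K" and le: "visual_angle K P \<le> t" by auto
    obtain a r where a: "0 \<le> a" "a < 2*pi" "0 < r" "P = contact a + r *\<^sub>R tvec a"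
      using exists_forward_tangent[OF PK] by blast
    then have "P \<bullet> nvec a = p a" "P \<bullet> tvec a = p' a + r" by (auto simp: inner_add_left)
    then have "(a, P) \<in> T" using iff[OF a(4,3)] le a(3) by (auto simp: memT)
    then show "P \<in> C - K" using PK a by (auto simp: C_def intro!: exI[of _ a])
  next
    fix P assume "P \<in> C - K"
    then obtain a where PK: "P \<notin> K" and a: "P \<bullet> nvec a = p a" "p' a \<le> P \<bullet> tvec a" "p (a + pi - t) \<le> P \<bullet> nvec (a + pi - t)"
      by (auto simp: C_def memT)
    have P: "P = contact a + (P \<bullet> tvec a - p' a) *\<^sub>R tvec a"
      using tangent_point_repr[OF a(1)] by (simp add: inner_diff_left)
    have "P \<bullet> tvec a - p' a \<noteq> 0" using P PK contact_in_K[of a] by (metis add.right_neutral scale_zero_left)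
    then have "0 < P \<bullet> tvec a - p' a" using a(2) by simp
    then show "P \<in> {P. P \<notin> K \<and> visual_angle K P \<le> t}" using iff[OF P] PK a(3) by auto
  qed
  then show ?thesis using \<open>closed C\<close> by blast
qed

text \<open>The value of \<open>visual_angle\<close> on K is arbitrary. Putting it to 0, below all
  exterior values, makes each sublevel set with t in (0, pi) the union of K and the set from
  \<open>visual_angle_le_closed\<close>.\<close>

lemma measurable_visual_angle:
  "(\<lambda>P. indicator (- K) P * visual_angle K P) \<in> borel_measurable borel"
proof (rule borel_measurableI_le)
  fix t :: real
  have [measurable]: "K \<in> sets borel" using compact_K by (simp add: compact_imp_closed borel_closed)
  consider "t < 0" | "t = 0" | "0 < t" "t < pi" | "pi \<le> t" by linarith
  then show "{P \<in> space borel. indicator (- K) P * visual_angle K P \<le> t} \<in> sets borel"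
  proof cases
    case 1
    then have "{P \<in> space borel. indicator (- K) P * visual_angle K P \<le> t} = {}"
      using exterior_visual_angle by (auto simp: indicator_def not_le intro: less_trans)
    then show ?thesis by simp
  next
    case 2
    then have "{P \<in> space borel. indicator (- K) P * visual_angle K P \<le> t} = K"
      using exterior_visual_angle(1) by (auto simp: indicator_def) (meson not_le)
    then show ?thesis by simp
  next
    case 3
    obtain C where C: "closed C" "{P. P \<notin> K \<and> visual_angle K P \<le> t} = C - K"
      using visual_angle_le_closed[OF 3] by blast
    have "{P \<in> space borel. indicator (- K) P * visual_angle K P \<le> t} = K \<union> {P. P \<notin> K \<and> visual_angle K P \<le> t}"
      using 3 by (auto simp: indicator_def)
    also have "\<dots> \<in> sets borel" unfolding C(2) using C(1) by (intro sets.Un sets.Diff) auto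
    finally show ?thesis .
  next
    case 4
    then have "{P \<in> space borel. indicator (- K) P * visual_angle K P \<le> t} = UNIV"
      using exterior_visual_angle pi_gt_zero order_trans[of 0 pi t]
      by (auto simp: indicator_def intro: less_imp_le less_le_trans)
    then show ?thesis by simp
  qed
qed

end

section \<open>Area in tangent coordinates\<close>

lemma vector2_eq: "vector [a, b] = (\<chi> i::2. if i = 1 then a else (b::real))"
  by (simp add: vec_eq_iff forall_2)

lemma borel_measurable_vector2:
  "(\<lambda>(x, y). vector [x, y] :: real^2) \<in> borel_measurable (lborel \<Otimes>\<^sub>M lborel)"
proof -
  have "continuous_on UNIV (\<lambda>z :: real \<times> real. vector [fst z, snd z] :: real^2)"
    unfolding vector2_eq
  proof (rule continuous_on_vec_lambda)
    fix i :: 2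
    show "continuous_on UNIV (\<lambda>z :: real \<times> real. if i = 1 then fst z else snd z)"
      by (cases "i = 1") (simp_all add: continuous_on_fst continuous_on_snd continuous_on_id)
  qed
  then have "(\<lambda>z :: real \<times> real. vector [fst z, snd z] :: real^2) \<in> borel_measurable borel"
    by (rule borel_measurable_continuous_onI)
  then show ?thesis by (simp add: lborel_prod case_prod_beta)
qed

lemma prod_Basis_real2: "(\<Prod>b\<in>Basis. (x::real^2) \<bullet> b) = x $ 1 * x $ 2"
proof -
  have B: "(Basis :: (real^2) set) = {axis 1 1, axis 2 1}"
    by (auto simp: Basis_vec_def UNIV_2)
  have "axis (1::2) (1::real) \<noteq> axis 2 1" by (simp add: axis_eq_axis)
  then show ?thesis unfolding B by (subst prod.insert) (simp_all add: inner_axis)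
qed

text \<open>Comparison on boxes suffices. The identity opens integrals over \<open>real^2\<close> to
  Tonelli's theorem.\<close>

lemma lborel_real2: "lborel = distr (lborel \<Otimes>\<^sub>M lborel) borel (\<lambda>(x, y). vector [x, y] :: real^2)"
proof (rule lborel_eqI)
  fix l u :: "real^2" assume le: "\<And>b. b \<in> Basis \<Longrightarrow> l \<bullet> b \<le> u \<bullet> b"
  have le': "l $ i \<le> u $ i" for i using le[of "axis i 1"] by (simp add: inner_axis axis_in_Basis_iff)
  have "(\<lambda>(x, y). vector [x, y] :: real^2) -` box l u \<inter> space (lborel \<Otimes>\<^sub>M lborel)
      = {l $ 1 <..< u $ 1} \<times> {l $ 2 <..< u $ 2}"
    by (auto simp: mem_box_cart forall_2 space_pair_measure)
  then have "emeasure (distr (lborel \<Otimes>\<^sub>M lborel) borel (\<lambda>(x, y). vector [x, y] :: real^2)) (box l u)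
      = emeasure (lborel \<Otimes>\<^sub>M lborel) ({l $ 1 <..< u $ 1} \<times> {l $ 2 <..< u $ 2})"
    by (subst emeasure_distr[OF borel_measurable_vector2]) auto
  also have "\<dots> = ennreal (u $ 1 - l $ 1) * ennreal (u $ 2 - l $ 2)"
    using le' by (subst lborel.emeasure_pair_measure_Times) auto
  also have "\<dots> = (\<Prod>b\<in>Basis. (u - l) \<bullet> b)"
    unfolding prod_Basis_real2 using le' by (simp add: ennreal_mult)
  finally show "emeasure (distr (lborel \<Otimes>\<^sub>M lborel) borel (\<lambda>(x, y). vector [x, y] :: real^2)) (box l u)
      = (\<Prod>b\<in>Basis. (u - l) \<bullet> b)" .
qed simp

lemma nn_integral_real2:
  fixes f :: "real^2 \<Rightarrow> ennreal"
  assumes [measurable]: "f \<in> borel_measurable borel"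
  shows "(\<integral>\<^sup>+z. f z \<partial>lborel) = (\<integral>\<^sup>+x. \<integral>\<^sup>+y. f (vector [x, y]) \<partial>lborel \<partial>lborel)"
proof -
  note borel_measurable_vector2[measurable]
  have "(\<integral>\<^sup>+z. f z \<partial>lborel) = (\<integral>\<^sup>+z. f (case z of (x, y) \<Rightarrow> vector [x, y]) \<partial>(lborel \<Otimes>\<^sub>M lborel))"
    by (subst lborel_real2, subst nn_integral_distr) auto
  also have "\<dots> = (\<integral>\<^sup>+x. \<integral>\<^sup>+y. f (vector [x, y]) \<partial>lborel \<partial>lborel)"
    by (subst lborel.nn_integral_fst[symmetric]) (auto simp: measurable_split_conv)
  finally show ?thesis .
qed

lemma nn_integral_continuous_Ico:
  fixes g :: "real \<Rightarrow> real"
  assumes "continuous_on UNIV g" "\<And>x. 0 \<le> g x"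
  shows "(\<integral>\<^sup>+x. ennreal (g x) * indicator {a..<b} x \<partial>lborel) = ennreal (integral {a..b} g)"
proof -
  have "continuous_on {a..b} g" using assms(1) continuous_on_subset by blast
  then have hi: "(g has_integral integral {a..b} g) {a..b}"
    by (intro integrable_integral integrable_continuous_real)
  have "(\<integral>\<^sup>+x. ennreal (g x) * indicator {a..<b} x \<partial>lborel) = (\<integral>\<^sup>+x. ennreal (indicator {a..b} x * g x) \<partial>lborel)"
    by (rule nn_integral_cong_AE, rule AE_mp[OF AE_lborel_singleton[of b]]) (auto intro!: AE_I2 simp: indicator_def)
  also have "\<dots> = ennreal (integral {a..b} g)"
    by (rule nn_integral_has_integral_lebesgue[OF _ hi]) (use assms(2) in auto)
  finally show ?thesis .
qed

lemma nn_integral_id_Ioo: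
  assumes "0 \<le> r"
  shows "(\<integral>\<^sup>+y. ennreal y * indicator {0<..<r} y \<partial>lborel) = ennreal (r\<^sup>2 / 2)"
proof -
  have "(\<integral>\<^sup>+y. ennreal y * indicator {0<..<r} y \<partial>lborel) = (\<integral>\<^sup>+y. ennreal y * indicator {0..r} y \<partial>lborel)"
    by (rule nn_integral_cong_AE, rule AE_mp[OF AE_lborel_singleton[of r]]) (auto intro!: AE_I2 simp: indicator_def)
  also have "\<dots> = ennreal (r\<^sup>2 / 2 - 0\<^sup>2 / 2)"
    by (rule nn_integral_FTC_Icc[where F = "\<lambda>x. x\<^sup>2 / 2"])
      (use assms in \<open>auto intro!: derivative_eq_intros\<close>)
  finally show ?thesis by simp
qed

section \<open>The change of variables (a, r)\<close>

context planar_body begin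

text \<open>The pair (a, r) is stored as a vector because the change of variables theorem concerns
  maps of \<open>real^n\<close> into itself.\<close>

definition half_tangent :: "real^2 \<Rightarrow> real^2" where "half_tangent z = contact (z $ 1) + (z $ 2) *\<^sub>R tvec (z $ 1)"

definition half_tangent_deriv :: "real^2 \<Rightarrow> real^2 \<Rightarrow> real^2" where
  "half_tangent_deriv z h = (h $ 1) *\<^sub>R (- (z $ 2) *\<^sub>R nvec (z $ 1) + (p (z $ 1) + p'' (z $ 1)) *\<^sub>R tvec (z $ 1)) + (h $ 2) *\<^sub>R tvec (z $ 1)"

lemma has_derivative_half_tangent: "(half_tangent has_derivative half_tangent_deriv z) (at z)"
proof -
  have v1: "((\<lambda>z::real^2. z $ 1) has_derivative (\<lambda>h. h $ 1)) (at z)"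
    and v2: "((\<lambda>z::real^2. z $ 2) has_derivative (\<lambda>h. h $ 2)) (at z)"
    by (auto intro: bounded_linear_imp_has_derivative bounded_linear_vec_nth)
  have comp: "((\<lambda>z. f (z $ 1)) has_derivative (\<lambda>h. f' (z $ 1) * h $ 1)) (at z)"
    if "\<And>a. (f has_real_derivative f' a) (at a)" for f f' :: "real \<Rightarrow> real"
    using has_derivative_compose[OF v1 that[of "z $ 1", unfolded has_field_derivative_def]] .
  note d1 = comp[OF dp] and d2 = comp[OF dp'] and dc = comp[OF DERIV_cos] and ds = comp[OF DERIV_sin]
  have e1: "(\<lambda>z. half_tangent z $ 1) = (\<lambda>z. p (z $ 1) * cos (z $ 1) - p' (z $ 1) * sin (z $ 1) - z $ 2 * sin (z $ 1))"
    and e2: "(\<lambda>z. half_tangent z $ 2) = (\<lambda>z. p (z $ 1) * sin (z $ 1) + p' (z $ 1) * cos (z $ 1) + z $ 2 * cos (z $ 1))"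
    by (simp_all add: fun_eq_iff half_tangent_def contact_def)
  have n1: "((\<lambda>z. half_tangent z $ 1) has_derivative (\<lambda>h. half_tangent_deriv z h $ 1)) (at z)"
    unfolding e1 by (rule has_derivative_eq_rhs[OF has_derivative_diff[OF has_derivative_diff[OF
          has_derivative_mult[OF d1 dc] has_derivative_mult[OF d2 ds]] has_derivative_mult[OF v2 ds]]])
      (simp add: fun_eq_iff half_tangent_deriv_def algebra_simps)
  have n2: "((\<lambda>z. half_tangent z $ 2) has_derivative (\<lambda>h. half_tangent_deriv z h $ 2)) (at z)"
    unfolding e2 by (rule has_derivative_eq_rhs[OF has_derivative_add[OF has_derivative_add[OF
          has_derivative_mult[OF d1 ds] has_derivative_mult[OF d2 dc]] has_derivative_mult[OF v2 dc]]])
      (simp add: fun_eq_iff half_tangent_deriv_def algebra_simps)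
  show ?thesis
  proof (subst has_derivative_componentwise_within, rule ballI)
    fix b :: "real^2" assume "b \<in> Basis"
    then obtain j :: 2 where "b = axis j 1" by (auto simp: Basis_vec_def)
    then show "((\<lambda>x. half_tangent x \<bullet> b) has_derivative (\<lambda>x. half_tangent_deriv z x \<bullet> b)) (at z)"
      using exhaust_2[of j] n1 n2 by (auto simp: inner_axis)
  qed
qed

text \<open>The radius of curvature p + p'' of the boundary cancels.\<close>
lemma det_half_tangent_deriv: "\<bar>det (matrix (half_tangent_deriv z))\<bar> = \<bar>z $ 2\<bar>"
proof -
  have "det (matrix (half_tangent_deriv z)) = - (z $ 2) * (sin (z $ 1))\<^sup>2 - (z $ 2) * (cos (z $ 1))\<^sup>2"
    by (simp add: det_2 matrix_def half_tangent_deriv_def axis_def algebra_simps power2_eq_square)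
  also have "\<dots> = - (z $ 2) * ((sin (z $ 1))\<^sup>2 + (cos (z $ 1))\<^sup>2)"
    by (simp only: right_diff_distrib distrib_left)
  finally show ?thesis by simp
qed

lemma inj_on_half_tangent: "inj_on half_tangent {z. 0 \<le> z $ 1 \<and> z $ 1 < 2*pi \<and> 0 < z $ 2}"
proof (rule inj_onI, safe)
  fix z w :: "real^2"
  assume z: "0 \<le> z $ 1" "z $ 1 < 2*pi" "0 < z $ 2" and w: "0 \<le> w $ 1" "w $ 1 < 2*pi" "0 < w $ 2"
    and eq: "half_tangent z = half_tangent w"
  have "nvec (w $ 1) = nvec (z $ 1)" "w $ 2 = z $ 2"
    using tangent_same_side_unique[of "half_tangent z" "z $ 1" "z $ 2" "w $ 1" "w $ 2"] eq z w
    by (auto simp: half_tangent_def)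
  moreover then obtain k :: int where k: "w $ 1 = z $ 1 + 2*pi*k" using nvec_eq_iff by blast
  have "k = 0"
  proof (rule ccontr)
    assume "k \<noteq> 0"
    then have "1 \<le> \<bar>real_of_int k\<bar>" by linarith
    then have "2*pi * 1 \<le> 2*pi * \<bar>real_of_int k\<bar>" by (intro mult_left_mono) auto
    also have "\<dots> = \<bar>w $ 1 - z $ 1\<bar>" using k by (simp add: abs_mult)
    finally show False using z w by linarith
  qed
  ultimately show "z = w" using k by (simp add: vec2_eq_iff)
qed

definition under_graph :: "(real \<Rightarrow> real) \<Rightarrow> (real^2) set" where
  "under_graph r = {z. 0 \<le> z $ 1 \<and> z $ 1 < 2*pi \<and> 0 < z $ 2 \<and> z $ 2 < r (z $ 1)}"

lemma measure_half_tangent_under_graph: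
  assumes cont: "continuous_on UNIV r" and nonneg: "\<And>a. 0 \<le> r a"
  shows "half_tangent ` under_graph r \<in> lmeasurable"
    and "measure lebesgue (half_tangent ` under_graph r) = integral {0..2*pi} (\<lambda>a. (r a)\<^sup>2 / 2)"
proof -
  let ?U = "under_graph r" and ?I = "integral {0..2*pi} (\<lambda>a. (r a)\<^sup>2 / 2)"
  have rc: "continuous_on UNIV (\<lambda>z::real^2. r (z $ 1))"
    by (rule continuous_on_compose2[OF cont]) (auto intro!: continuous_intros)
  have [measurable]: "(\<lambda>z::real^2. r (z $ 1)) \<in> borel_measurable borel"
    "(\<lambda>z::real^2. z $ 1) \<in> borel_measurable borel" "(\<lambda>z::real^2. z $ 2) \<in> borel_measurable borel"
    by (auto intro!: borel_measurable_continuous_onI rc continuous_intros)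
  have U[measurable]: "?U \<in> sets borel" unfolding under_graph_def by measurable
  have ind: "indicator ?U (vector [x, y] :: real^2) = (indicator {0..<2*pi} x * indicator {0<..<r x} y :: ennreal)" for x y
    by (auto simp: under_graph_def indicator_def)
  have "(\<integral>\<^sup>+z. ennreal (indicator ?U z * \<bar>z $ 2\<bar>) \<partial>lborel)
      = (\<integral>\<^sup>+z. ennreal (z $ 2) * indicator ?U z \<partial>lborel)"
    by (intro nn_integral_cong) (auto simp: indicator_def under_graph_def)
  also have "\<dots> = (\<integral>\<^sup>+x. \<integral>\<^sup>+y. ennreal y * (indicator {0..<2*pi} x * indicator {0<..<r x} y) \<partial>lborel \<partial>lborel)"
    by (subst nn_integral_real2) (auto simp: ind)
  also have "\<dots> = (\<integral>\<^sup>+x. (\<integral>\<^sup>+y. ennreal y * indicator {0<..<r x} y \<partial>lborel) * indicator {0..<2*pi} x \<partial>lborel)"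
    by (intro nn_integral_cong, subst nn_integral_multc[symmetric]) (auto simp: ac_simps)
  also have "\<dots> = (\<integral>\<^sup>+x. ennreal ((r x)\<^sup>2 / 2) * indicator {0..<2*pi} x \<partial>lborel)"
    by (simp add: nn_integral_id_Ioo[OF nonneg])
  also have "\<dots> = ennreal ?I"
    by (rule nn_integral_continuous_Ico) (auto intro!: continuous_intros cont)
  finally have nn: "(\<integral>\<^sup>+z. ennreal (indicator ?U z * \<bar>z $ 2\<bar>) \<partial>lborel) = ennreal ?I" .
  have "0 \<le> ?I" by (intro Henstock_Kurzweil_Integration.integral_nonneg integrable_continuous_real)
      (auto intro!: continuous_intros continuous_on_subset[OF cont])
  then have "((\<lambda>z. indicator ?U z * \<bar>z $ 2\<bar>) has_integral ?I) UNIV"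
    by (intro nn_integral_has_integral nn) auto
  moreover have ifeq: "(\<lambda>z. indicator ?U z * \<bar>z $ 2\<bar>) = (\<lambda>z. if z \<in> ?U then \<bar>z $ 2\<bar> else 0)"
    by (auto simp: indicator_def)
  ultimately have "((\<lambda>z. \<bar>det (matrix (half_tangent_deriv z))\<bar>) has_integral ?I) ?U"
    unfolding det_half_tangent_deriv by (simp only: ifeq has_integral_restrict_UNIV)
  moreover have "inj_on half_tangent ?U"
    by (rule inj_on_subset[OF inj_on_half_tangent]) (auto simp: under_graph_def)
  ultimately show "half_tangent ` ?U \<in> lmeasurable" "measure lebesgue (half_tangent ` ?U) = ?I"
    using has_measure_differentiable_image[of ?U half_tangent half_tangent_deriv ?I] has_derivative_half_tangent U
    by (auto intro: has_derivative_at_withinI)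
qed

text \<open>Passes from \<open>lebesgue\<close>, where the change of variables takes place, to
  \<open>lborel\<close>, where the layers are measured. The Borel hypothesis on the image makes both
  measures agree on it.\<close>

lemma emeasure_half_tangent_under_graph:
  assumes cont: "continuous_on UNIV r" and nonneg: "\<And>a. 0 \<le> r a" and "half_tangent ` under_graph r \<in> sets borel"
  shows "emeasure lborel (half_tangent ` under_graph r) = ennreal (integral {0..2*pi} (\<lambda>a. (r a)\<^sup>2 / 2))"
proof -
  have "emeasure lebesgue (half_tangent ` under_graph r) = ennreal (integral {0..2*pi} (\<lambda>a. (r a)\<^sup>2 / 2))"
    unfolding measure_half_tangent_under_graph(2)[OF cont nonneg, symmetric]
    by (rule emeasure_eq_measure2[OF measure_half_tangent_under_graph(1)[OF cont nonneg]])
  then show ?thesis using emeasure_completion[of "half_tangent ` under_graph r" lborel] assms(3) by simp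
qed

lemma continuous_on_tau: "continuous_on S (tau t)"
proof -
  have "continuous_on S (\<lambda>a. p (a + pi - t))"
    by (rule continuous_on_compose2[OF cont_p[of UNIV]]) (auto intro!: continuous_intros)
  then show ?thesis unfolding tau_def[abs_def] divide_inverse by (intro continuous_intros)
qed

lemma emeasure_visual_angle_gt:
  assumes t: "0 < t" "t < pi"
  shows "emeasure lborel {P. t < indicator (- K) P * visual_angle K P}
    = ennreal (integral {0..2*pi} (\<lambda>a. (tau t a)\<^sup>2 / 2))"
proof -
  have "{P. t < indicator (- K) P * visual_angle K P} = half_tangent ` under_graph (tau t)"
  proof (intro equalityI subsetI)
    fix P assume "P \<in> {P. t < indicator (- K) P * visual_angle K P}"
    then have "P \<notin> K" and lt: "t < visual_angle K P" using t by (cases "P \<in> K"; simp)+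
    then obtain a r where a: "0 \<le> a" "a < 2*pi" "0 < r" "P = contact a + r *\<^sub>R tvec a"
      using exists_forward_tangent by blast
    then have "r < tau t a" using visual_angle_gt_iff[OF a(4,3) t] lt by simp
    then show "P \<in> half_tangent ` under_graph (tau t)"
      using a by (intro image_eqI[of _ _ "vector [a, r]"]) (auto simp: half_tangent_def under_graph_def)
  next
    fix P assume "P \<in> half_tangent ` under_graph (tau t)"
    then obtain z :: "real^2" where z: "0 < z $ 2" "z $ 2 < tau t (z $ 1)" and P: "P = contact (z $ 1) + (z $ 2) *\<^sub>R tvec (z $ 1)"
      by (auto simp: under_graph_def half_tangent_def)
    then show "P \<in> {P. t < indicator (- K) P * visual_angle K P}"
      using visual_angle_gt_iff[OF P z(1) t] tangent_not_in_K[OF P] by simp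
  qed
  moreover have "{P. t < indicator (- K) P * visual_angle K P} \<in> sets borel"
    using measurable_visual_angle by measurable
  ultimately show ?thesis
    using emeasure_half_tangent_under_graph[OF continuous_on_tau tau_nonneg[OF t]] by metis
qed

lemma norm_contact_tvec: "(norm (contact a + r *\<^sub>R tvec a))\<^sup>2 = (p a)\<^sup>2 + (p' a + r)\<^sup>2"
proof -
  have "contact a + r *\<^sub>R tvec a = p a *\<^sub>R nvec a + (p' a + r) *\<^sub>R tvec a" by (simp add: contact_def algebra_simps)
  then show ?thesis unfolding power2_norm_eq_inner by (simp add: inner_add_left inner_add_right power2_eq_square)
qed

text \<open>The complement of K in a large disc is a region in tangent coordinates, and the mixed term in its
  area is the derivative of a periodic function.\<close>
theorem area_K: "measure lborel K = (integral {0..2*pi} (\<lambda>a. (p a)\<^sup>2) - integral {0..2*pi} (\<lambda>a. (p' a)\<^sup>2)) / 2"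
proof -
  obtain R where R: "0 < R" "K \<subseteq> ball 0 R"
    using compact_imp_bounded[OF compact_K] bounded_subset_ballD by blast
  have XR: "(p a)\<^sup>2 + (p' a)\<^sup>2 < R\<^sup>2" for a
  proof -
    have "contact a \<in> ball 0 R" using contact_in_K[of a] R(2) by blast
    then have "norm (contact a) < R" by simp
    then have "(norm (contact a))\<^sup>2 < R\<^sup>2" by (simp add: power_strict_mono)
    then show ?thesis using norm_contact_tvec[of a 0] by simp
  qed
  \<comment> \<open>Half the chord that the support line cuts out of the disc of radius R. The point
    of tangency lies at signed distance \<open>p' a\<close> from the midpoint of the chord, so the
    half-tangent leaves the disc at r = \<open>q a - p' a\<close>.\<close>
  define q where "q a = sqrt (R\<^sup>2 - (p a)\<^sup>2)" for a
  have q2: "(q a)\<^sup>2 = R\<^sup>2 - (p a)\<^sup>2" for a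
    using XR[of a] zero_le_power2[of "p' a"] unfolding q_def by (intro real_sqrt_pow2) linarith
  have q0: "0 \<le> q a" for a using XR[of a] zero_le_power2[of "p' a"] unfolding q_def by (intro real_sqrt_ge_zero) linarith
  have qp: "\<bar>p' a\<bar> < q a" for a
  proof -
    have "\<not> (q a)\<^sup>2 \<le> (p' a)\<^sup>2" using XR[of a] q2[of a] by linarith
    then have "\<not> \<bar>q a\<bar> \<le> \<bar>p' a\<bar>" unfolding abs_le_square_iff .
    then show ?thesis using q0[of a] by linarith
  qed
  have qc: "continuous_on S q" for S unfolding q_def[abs_def] by (intro continuous_intros)
  let ?r = "\<lambda>a. q a - p' a"
  have im: "half_tangent ` under_graph ?r = ball 0 R - K"
  proof -
    have in_ball: "contact a + r *\<^sub>R tvec a \<in> ball 0 R \<longleftrightarrow> r < q a - p' a" if "0 < r" for a r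
    proof -
      have "contact a + r *\<^sub>R tvec a \<in> ball 0 R \<longleftrightarrow> (norm (contact a + r *\<^sub>R tvec a))\<^sup>2 < R\<^sup>2"
        using abs_le_square_iff[of R "norm (contact a + r *\<^sub>R tvec a)"] R(1) by (simp add: not_le[symmetric])
      also have "\<dots> \<longleftrightarrow> (p' a + r)\<^sup>2 < (q a)\<^sup>2" unfolding norm_contact_tvec q2 by auto
      also have "\<dots> \<longleftrightarrow> \<bar>p' a + r\<bar> < q a" 
        using abs_le_square_iff[of "q a" "p' a + r"] q0[of a] by (simp add: not_le[symmetric])
      also have "\<dots> \<longleftrightarrow> r < q a - p' a" using qp[of a] that by auto
      finally show ?thesis .
    qed
    show ?thesis
    proof (intro equalityI subsetI)
      fix P assume "P \<in> half_tangent ` under_graph ?r"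
      then obtain z :: "real^2" where z: "0 < z $ 2" "z $ 2 < ?r (z $ 1)" and P: "P = contact (z $ 1) + (z $ 2) *\<^sub>R tvec (z $ 1)"
        by (auto simp: under_graph_def half_tangent_def)
      then show "P \<in> ball 0 R - K" using in_ball tangent_not_in_K[OF P] by auto
    next
      fix P assume P: "P \<in> ball 0 R - K"
      then obtain a r where a: "0 \<le> a" "a < 2*pi" "0 < r" "P = contact a + r *\<^sub>R tvec a"
        using exists_forward_tangent by blast
      then show "P \<in> half_tangent ` under_graph ?r"
        using P in_ball by (intro image_eqI[of _ _ "vector [a, r]"]) (auto simp: half_tangent_def under_graph_def)
    qed
  qed
  have Kb[measurable]: "K \<in> sets borel" using compact_K by (simp add: compact_imp_closed borel_closed)
  have "emeasure lborel (ball 0 R - K) = ennreal (integral {0..2*pi} (\<lambda>a. (?r a)\<^sup>2 / 2))"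
    using emeasure_half_tangent_under_graph[of ?r] im qc qp
    by (auto intro!: continuous_intros simp: abs_less_iff less_imp_le)
  moreover have "0 \<le> integral {0..2*pi} (\<lambda>a. (?r a)\<^sup>2 / 2)"
    by (intro Henstock_Kurzweil_Integration.integral_nonneg integrable_continuous_real) (auto intro!: continuous_intros qc)
  ultimately have m: "measure lborel (ball 0 R - K) = integral {0..2*pi} (\<lambda>a. (?r a)\<^sup>2 / 2)"
    by (simp add: measure_def)
  have "emeasure lborel (ball (0::real^2) R) \<noteq> \<infinity>" using emeasure_lborel_ball_finite[of "0::real^2" R] by simp
  then have "measure lborel (ball 0 R - K) = measure lborel (ball (0::real^2) R) - measure lborel K"
    by (intro measure_Diff) (use R in auto)
  moreover have "measure lborel (ball (0::real^2) R) = pi * R\<^sup>2"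
    using R(1) content_ball[of R "0::real^2"] by (simp add: unit_ball_vol_2)
  ultimately have mK: "measure lborel K = pi * R\<^sup>2 - integral {0..2*pi} (\<lambda>a. (?r a)\<^sup>2 / 2)" using m by linarith
  obtain G where G: "\<And>y. (G has_real_derivative sqrt (R\<^sup>2 - y\<^sup>2)) (at y)"
    by (rule antiderivative_real[of "\<lambda>y. sqrt (R\<^sup>2 - y\<^sup>2)"]) (auto intro!: continuous_intros)
  have "((\<lambda>a. G (p a)) has_real_derivative q a * p' a) (at a)" for a
    unfolding q_def by (rule DERIV_chain2[OF G dp])
  from has_integral_antiderivative[OF _ this, of 0 "2*pi"]
  have cross: "((\<lambda>a. q a * p' a) has_integral 0) {0..2*pi}" using p_2pi[of 0] by simp
  have hp: "((\<lambda>a. (p a)\<^sup>2) has_integral integral {0..2*pi} (\<lambda>a. (p a)\<^sup>2)) {0..2*pi}"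
    and hp': "((\<lambda>a. (p' a)\<^sup>2) has_integral integral {0..2*pi} (\<lambda>a. (p' a)\<^sup>2)) {0..2*pi}"
    by (intro integrable_integral integrable_continuous_real continuous_intros)+
  have hR: "((\<lambda>a. R\<^sup>2) has_integral (2*pi) * R\<^sup>2) {0..2*pi}"
    using has_integral_const_real[of "R\<^sup>2" 0 "2*pi"] by simp
  have "((\<lambda>a. (R\<^sup>2 - (p a)\<^sup>2 + (p' a)\<^sup>2) / 2 - q a * p' a) has_integral
     ((2*pi) * R\<^sup>2 - integral {0..2*pi} (\<lambda>a. (p a)\<^sup>2) + integral {0..2*pi} (\<lambda>a. (p' a)\<^sup>2)) / 2 - 0) {0..2*pi}"
    by (intro has_integral_diff has_integral_divide has_integral_add hR hp hp' cross)
  moreover have "(R\<^sup>2 - (p a)\<^sup>2 + (p' a)\<^sup>2) / 2 - q a * p' a = (?r a)\<^sup>2 / 2" for a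
    using q2[of a] by (simp add: power2_eq_square field_simps)
  ultimately have "integral {0..2*pi} (\<lambda>a. (?r a)\<^sup>2 / 2) =
     ((2*pi) * R\<^sup>2 - integral {0..2*pi} (\<lambda>a. (p a)\<^sup>2) + integral {0..2*pi} (\<lambda>a. (p' a)\<^sup>2)) / 2 - 0"
    by (simp only: integral_unique)
  then show ?thesis unfolding mK by (simp only:) (simp add: field_simps)
qed

section \<open>The layer-cake formula\<close>

lemma layer_cake_pow_sin_deriv:
  assumes "0 \<le> w" "w \<le> pi" "m \<ge> 1"
  shows "ennreal (w^m - sin w^m) = (\<integral>\<^sup>+t. ennreal (pow_sin_deriv m t) * indicator {0<..<pi} t * (if t < w then 1 else 0) \<partial>lborel)"
proof -
  have [measurable]: "pow_sin_deriv m \<in> borel_measurable borel"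
    by (intro borel_measurable_continuous_onI continuous_intros)
  have "(\<integral>\<^sup>+t. ennreal (pow_sin_deriv m t) * indicator {0..w} t \<partial>lborel) = ennreal ((w^m - sin w^m) - (0^m - sin 0^m))"
    by (rule nn_integral_FTC_Icc) (use assms pow_sin_deriv_nonneg DERIV_pow_sin_deriv in \<open>auto intro!: DERIV_pow_sin_deriv\<close>)
  also have "\<dots> = ennreal (w^m - sin w^m)" by simp
  finally have "ennreal (w^m - sin w^m) = (\<integral>\<^sup>+t. ennreal (pow_sin_deriv m t) * indicator {0..w} t \<partial>lborel)" ..
  also have "\<dots> = (\<integral>\<^sup>+t. ennreal (pow_sin_deriv m t) * indicator {0<..<pi} t * (if t < w then 1 else 0) \<partial>lborel)"
    by (rule nn_integral_cong_AE, rule AE_mp[OF AE_lborel_singleton[of w]], rule AE_mp[OF AE_lborel_singleton[of 0]])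
      (use assms in \<open>auto intro!: AE_I2 simp: indicator_def\<close>)
  finally show ?thesis .
qed

theorem nn_integral_visual_angle:
  assumes "m \<ge> 1"
  shows "(\<integral>\<^sup>+P. ennreal (indicator (- K) P * (visual_angle K P ^ m - sin (visual_angle K P) ^ m)) \<partial>lborel)
    = (\<integral>\<^sup>+t. ennreal (pow_sin_deriv m t * integral {0..2*pi} (\<lambda>a. (tau t a)\<^sup>2 / 2)) * indicator {0<..<pi} t \<partial>lborel)"
proof -
  let ?V = "\<lambda>P. indicator (- K) P * visual_angle K P"
  note measurable_visual_angle[measurable]
  have [measurable]: "pow_sin_deriv m \<in> borel_measurable borel"
    by (intro borel_measurable_continuous_onI continuous_intros)
  have "(\<integral>\<^sup>+P. ennreal (indicator (- K) P * (visual_angle K P ^ m - sin (visual_angle K P) ^ m)) \<partial>lborel)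
     = (\<integral>\<^sup>+P. \<integral>\<^sup>+t. ennreal (pow_sin_deriv m t) * indicator {0<..<pi} t * (if t < ?V P then 1 else 0) \<partial>lborel \<partial>lborel)"
  proof (rule nn_integral_cong)
    fix P
    have "0 \<le> ?V P" "?V P \<le> pi"
      using exterior_visual_angle[of P] by (auto simp: indicator_def intro: less_imp_le)
    then have "ennreal (?V P ^ m - sin (?V P) ^ m) = (\<integral>\<^sup>+t. ennreal (pow_sin_deriv m t) * indicator {0<..<pi} t * (if t < ?V P then 1 else 0) \<partial>lborel)"
      using assms by (rule layer_cake_pow_sin_deriv)
    \<comment> \<open>As m >= 1, the function w^m - (sin w)^m vanishes at 0, so the indicator can be
      moved inside the angle.\<close>
    moreover have "indicator (- K) P * (visual_angle K P ^ m - sin (visual_angle K P) ^ m) = ?V P ^ m - sin (?V P) ^ m"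
      using assms by (auto simp: indicator_def)
    ultimately show "ennreal (indicator (- K) P * (visual_angle K P ^ m - sin (visual_angle K P) ^ m))
      = (\<integral>\<^sup>+t. ennreal (pow_sin_deriv m t) * indicator {0<..<pi} t * (if t < ?V P then 1 else 0) \<partial>lborel)" by simp
  qed
  also have "\<dots> = (\<integral>\<^sup>+t. \<integral>\<^sup>+P. ennreal (pow_sin_deriv m t) * indicator {0<..<pi} t * (if t < ?V P then 1 else 0) \<partial>lborel \<partial>lborel)"
    by (rule lborel_pair.Fubini'[symmetric]) measurable
  also have "\<dots> = (\<integral>\<^sup>+t. ennreal (pow_sin_deriv m t * integral {0..2*pi} (\<lambda>a. (tau t a)\<^sup>2 / 2)) * indicator {0<..<pi} t \<partial>lborel)"
  proof (rule nn_integral_cong)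
    fix t :: real
    have "(\<integral>\<^sup>+P. ennreal (pow_sin_deriv m t) * indicator {0<..<pi} t * (if t < ?V P then 1 else 0) \<partial>lborel)
      = (\<integral>\<^sup>+P. ennreal (pow_sin_deriv m t) * indicator {0<..<pi} t * indicator {P. t < ?V P} P \<partial>lborel)"
      by (intro nn_integral_cong) (auto simp: indicator_def)
    also have "\<dots> = ennreal (pow_sin_deriv m t) * indicator {0<..<pi} t * emeasure lborel {P. t < ?V P}"
      by (rule nn_integral_cmult_indicator) measurable
    also have "\<dots> = ennreal (pow_sin_deriv m t * integral {0..2*pi} (\<lambda>a. (tau t a)\<^sup>2 / 2)) * indicator {0<..<pi} t"
    proof (cases "t \<in> {0<..<pi}")
      case True
      then have "0 \<le> pow_sin_deriv m t" by (intro pow_sin_deriv_nonneg) auto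
      then show ?thesis
        using True emeasure_visual_angle_gt[of t] ennreal_mult'[of "pow_sin_deriv m t" "integral {0..2*pi} (\<lambda>a. (tau t a)\<^sup>2 / 2)"]
        by simp
    qed simp
    finally show "(\<integral>\<^sup>+P. ennreal (pow_sin_deriv m t) * indicator {0<..<pi} t * (if t < ?V P then 1 else 0) \<partial>lborel)
      = ennreal (pow_sin_deriv m t * integral {0..2*pi} (\<lambda>a. (tau t a)\<^sup>2 / 2)) * indicator {0<..<pi} t" .
  qed
  finally show ?thesis .
qed

end

section \<open>Length of the boundary\<close>

context planar_body begin

text \<open>The least gap over all directions is attained, by compactness of a period. If it were
  positive, the ball with that radius around x would satisfy all support inequalities, and x would
  be interior.\<close>

lemma frontier_support:
  assumes "x \<in> frontier K" obtains a where "x \<bullet> nvec a = p a"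
proof -
  have xK: "x \<in> K" using assms compact_imp_closed[OF compact_K] frontier_subset_closed by blast
  obtain a where a: "\<And>b. p a - x \<bullet> nvec a \<le> p b - x \<bullet> nvec b"
  proof -
    have "continuous_on {0..2*pi} (\<lambda>b. p b - x \<bullet> nvec b)"
      unfolding inner_real2 nvec_nth by (intro continuous_intros)
    from continuous_attains_inf[OF _ _ this]
    obtain a where a: "\<forall>b\<in>{0..2*pi}. p a - x \<bullet> nvec a \<le> p b - x \<bullet> nvec b" by auto
    have "p a - x \<bullet> nvec a \<le> p b - x \<bullet> nvec b" for b
    proof -
      obtain c where "0 \<le> c" "c < 2*pi" "nvec c = nvec b" by (rule nvec_reduce)
      then show ?thesis using bspec[OF a, of c] p_cong(1)[of c b] by simp
    qed
    then show ?thesis using that by blast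
  qed
  define e where "e = p a - x \<bullet> nvec a"
  have "e = 0"
  proof (rule ccontr)
    assume "e \<noteq> 0"
    then have "e > 0" using le_p[OF xK, of a] by (simp add: e_def)
    have "ball x e \<subseteq> K"
    proof
      fix y assume "y \<in> ball x e"
      then have "norm (y - x) < e" by (simp add: dist_norm norm_minus_commute)
      have "y \<bullet> nvec b \<le> p b" for b
      proof -
        have "(y - x) \<bullet> nvec b \<le> norm (y - x)" using norm_cauchy_schwarz[of "y - x" "nvec b"] by simp
        then show ?thesis using a[of b] \<open>norm (y - x) < e\<close> by (simp add: e_def inner_diff_left)
      qed
      then show "y \<in> K" using mem_K_iff by blast
    qed
    then have "x \<in> interior K" using \<open>e > 0\<close> by (meson centre_in_ball interiorI open_ball)
    then show False using assms by (simp add: frontier_def)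
  qed
  then show ?thesis using that[of a] by (simp add: e_def)
qed

end

text \<open>The angle \<open>h\<close> is an antiderivative of the angular velocity \<open>w\<close>
  with the right initial value. The unit vector (a, b), rotated back by \<open>h\<close>, has
  derivative 0 and starts at (1, 0), so it is (1, 0) throughout.\<close>

lemma angle_lift:
  fixes x y x' y' :: "real \<Rightarrow> real"
  assumes dx: "\<And>t. (x has_real_derivative x' t) (at t)" and dy: "\<And>t. (y has_real_derivative y' t) (at t)"
    and cont: "continuous_on UNIV x'" "continuous_on UNIV y'" and nz: "\<And>t. (x t)\<^sup>2 + (y t)\<^sup>2 > 0"
  obtains h w where "\<And>t. (h has_real_derivative w t) (at t)"
    and "\<And>t. x t = sqrt ((x t)\<^sup>2 + (y t)\<^sup>2) * cos (h t)" and "\<And>t. y t = sqrt ((x t)\<^sup>2 + (y t)\<^sup>2) * sin (h t)"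
proof -
  define v where "v t = sqrt ((x t)\<^sup>2 + (y t)\<^sup>2)" for t
  define w where "w t = (x t * y' t - y t * x' t) / (v t)\<^sup>2" for t
  define a where "a t = x t / v t" for t
  define b where "b t = y t / v t" for t
  have v0: "v t > 0" and v2: "(v t)\<^sup>2 = (x t)\<^sup>2 + (y t)\<^sup>2" for t
    using nz[of t] by (auto simp: v_def)
  have nz': "(x t)\<^sup>2 + (y t)\<^sup>2 \<noteq> 0" for t using nz[of t] by linarith
  have cxy: "continuous_on UNIV x" "continuous_on UNIV y"
    by (meson dx dy DERIV_isCont continuous_at_imp_continuous_on)+
  have "continuous_on UNIV w"
    unfolding w_def v2 by (intro continuous_intros cont cxy) (use nz' in blast)+
  then obtain A where A: "\<And>t. (A has_real_derivative w t) (at t)" using antiderivative_real by blast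
  have "(a 0)\<^sup>2 + (b 0)\<^sup>2 = 1"
    unfolding a_def b_def power_divide add_divide_distrib[symmetric] v2[symmetric] using v0[of 0] by simp
  then obtain s where s: "a 0 = cos s" "b 0 = sin s" using sincos_total_2pi by metis
  define h where "h t = A t - A 0 + s" for t
  have dh: "(h has_real_derivative w t) (at t)" for t
    unfolding h_def by (auto intro!: derivative_eq_intros A)
  have dv: "(v has_real_derivative ((x t * x' t + y t * y' t) / v t)) (at t)" for t
  proof -
    have "((\<lambda>t. (x t)\<^sup>2 + (y t)\<^sup>2) has_real_derivative 2 * (x t * x' t + y t * y' t)) (at t)"
      by (auto intro!: derivative_eq_intros dx dy)
    from DERIV_chain2[OF DERIV_real_sqrt[OF nz[of t]] this]
    have "(v has_real_derivative inverse (v t) / 2 * (2 * (x t * x' t + y t * y' t))) (at t)"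
      unfolding v_def .
    also have "inverse (v t) / 2 * (2 * (x t * x' t + y t * y' t)) = (x t * x' t + y t * y' t) / v t"
      using v0[of t] by (simp add: field_simps)
    finally show ?thesis .
  qed
  have da: "(a has_real_derivative (- w t * b t)) (at t)" for t
  proof -
    have "(a has_real_derivative (x' t * v t - x t * ((x t * x' t + y t * y' t) / v t)) / (v t * v t)) (at t)"
      unfolding a_def using v0[of t] by (intro DERIV_divide dx dv) auto
    also have "(x' t * v t - x t * ((x t * x' t + y t * y' t) / v t)) / (v t * v t)
      = (x' t * (v t)\<^sup>2 - x t * (x t * x' t + y t * y' t)) / (v t) ^ 3"
      using v0[of t] by (simp add: field_simps power2_eq_square power3_eq_cube)
    also have "\<dots> = - w t * b t"
      using v0[of t] unfolding w_def b_def
      by (subst v2) (simp add: field_simps power2_eq_square power3_eq_cube)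
    finally show ?thesis .
  qed
  have db: "(b has_real_derivative (w t * a t)) (at t)" for t
  proof -
    have "(b has_real_derivative (y' t * v t - y t * ((x t * x' t + y t * y' t) / v t)) / (v t * v t)) (at t)"
      unfolding b_def using v0[of t] by (intro DERIV_divide dy dv) auto
    also have "(y' t * v t - y t * ((x t * x' t + y t * y' t) / v t)) / (v t * v t)
      = (y' t * (v t)\<^sup>2 - y t * (x t * x' t + y t * y' t)) / (v t) ^ 3"
      using v0[of t] by (simp add: field_simps power2_eq_square power3_eq_cube)
    also have "\<dots> = w t * a t"
      using v0[of t] unfolding w_def a_def
      by (subst v2) (simp add: field_simps power2_eq_square power3_eq_cube)
    finally show ?thesis .
  qed
  have "((\<lambda>t. a t * cos (h t) + b t * sin (h t)) has_real_derivative 0) (at t)" for t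
    by (rule derivative_eq_intros da db dh refl | simp add: algebra_simps)+
  then have C: "a t * cos (h t) + b t * sin (h t) = a 0 * cos (h 0) + b 0 * sin (h 0)" for t
    using DERIV_isconst_all by blast
  have "((\<lambda>t. b t * cos (h t) - a t * sin (h t)) has_real_derivative 0) (at t)" for t
    by (rule derivative_eq_intros da db dh refl | simp add: algebra_simps)+
  then have D: "b t * cos (h t) - a t * sin (h t) = b 0 * cos (h 0) - a 0 * sin (h 0)" for t
    using DERIV_isconst_all by blast
  have h0: "h 0 = s" by (simp add: h_def)
  have C1: "a t * cos (h t) + b t * sin (h t) = 1" and D0: "b t * cos (h t) - a t * sin (h t) = 0" for t
    using C[of t] D[of t] s h0 sin_cos_squared_add2[of s] by (auto simp: power2_eq_square)
  have ab: "a t = cos (h t)" "b t = sin (h t)" for t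
  proof -
    have sc: "cos (h t) * cos (h t) + sin (h t) * sin (h t) = 1"
      using sin_cos_squared_add2[of "h t"] by (simp add: power2_eq_square)
    have "a t * (cos (h t) * cos (h t) + sin (h t) * sin (h t))
      = (a t * cos (h t) + b t * sin (h t)) * cos (h t) - (b t * cos (h t) - a t * sin (h t)) * sin (h t)"
      by (simp add: algebra_simps del: sin_cos_squared_add3)
    then show "a t = cos (h t)" unfolding sc C1 D0 by simp
    have "b t * (cos (h t) * cos (h t) + sin (h t) * sin (h t))
      = (a t * cos (h t) + b t * sin (h t)) * sin (h t) + (b t * cos (h t) - a t * sin (h t)) * cos (h t)"
      by (simp add: algebra_simps del: sin_cos_squared_add3)
    then show "b t = sin (h t)" unfolding sc C1 D0 by simp
  qed
  have "x t = v t * cos (h t)" "y t = v t * sin (h t)" for t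
    using ab[of t] v0[of t] by (auto simp: a_def b_def field_simps)
  then show ?thesis using that[OF dh] unfolding v_def by blast
qed

lemma C2_boundary_curveD:
  assumes "C2_boundary_curve K \<gamma>"
  obtains g g' where "\<And>t. (\<gamma> has_vector_derivative g t) (at t)" "\<And>t. (g has_vector_derivative g' t) (at t)"
    "continuous_on UNIV g'" "\<And>t. g t \<noteq> 0" "\<And>t. vector_derivative \<gamma> (at t) = g t"
    "\<And>t. g (t + 1) = g t" "\<And>t. \<gamma> t \<in> frontier K"
proof -
  obtain g where g: "\<And>t. (\<gamma> has_vector_derivative g t) (at t)" and C1: "g C1_differentiable_on UNIV"
    using assms unfolding C2_boundary_curve_def C2_differentiable_def by blast
  obtain g' where g': "\<And>t. (g has_vector_derivative g' t) (at t)" "continuous_on UNIV g'"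
    using C1 unfolding C1_differentiable_on_def by auto
  have vd: "vector_derivative \<gamma> (at t) = g t" for t using g vector_derivative_at by blast
  have per: "\<gamma> (t + 1) = \<gamma> t" for t using assms by (simp add: C2_boundary_curve_def)
  have "g (t + 1) = g t" for t
  proof -
    have "((\<lambda>t::real. t + 1) has_vector_derivative 1) (at t)"
      unfolding has_real_derivative_iff_has_vector_derivative[symmetric] by (auto intro!: derivative_eq_intros)
    then have "((\<lambda>t. \<gamma> (t + 1)) has_vector_derivative (1 + 0) *\<^sub>R g (t + 1)) (at t)"
      using vector_diff_chain_at[of "\<lambda>t. t + 1" "1 + 0" t \<gamma> "g (t+1)"] g[of "t + 1"]
      by (auto simp: o_def intro!: derivative_eq_intros)
    then show ?thesis using vector_derivative_unique_at[OF g[of t]] by (simp add: per)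
  qed
  moreover have "\<gamma> t \<in> frontier K" for t
  proof -
    have "\<gamma> (t + 1 * real_of_int (- \<lfloor>t\<rfloor>)) = \<gamma> t" by (rule periodic_int[of \<gamma> 1, OF per])
    moreover have "t + 1 * real_of_int (- \<lfloor>t\<rfloor>) \<in> {0..1}" by (simp add: of_int_floor_le) linarith
    ultimately show ?thesis using assms unfolding C2_boundary_curve_def path_image_def by (metis imageI)
  qed
  ultimately show ?thesis using that[OF g g'] assms vd by (auto simp: C2_boundary_curve_def)
qed

lemma DERIV_inner_curve:
  "(\<gamma> has_vector_derivative g) (at t) \<Longrightarrow> ((\<lambda>s. c \<bullet> \<gamma> s) has_real_derivative c \<bullet> g) (at t)"
  unfolding has_real_derivative_iff_has_vector_derivative
  by (rule bounded_linear.has_vector_derivative[OF bounded_linear_inner_right])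

text \<open>Otherwise K lies in a line, and by Rolle's theorem a closed curve in a line has a stationary point.\<close>
lemma C2_boundary_interior:
  fixes K :: "(real^2) set"
  assumes "compact K" "convex K" "C2_boundary_curve K \<gamma>"
  shows "interior K \<noteq> {}"
proof
  assume "interior K = {}"
  then obtain a b where a: "a \<noteq> 0" "K \<subseteq> {x. a \<bullet> x = b}"
    using empty_interior_subset_hyperplane[OF assms(2)] by blast
  obtain g g' where g: "\<And>t. (\<gamma> has_vector_derivative g t) (at t)" "\<And>t. g t \<noteq> 0" "\<And>t. \<gamma> t \<in> frontier K"
    using C2_boundary_curveD[OF assms(3)] by metis
  have "\<gamma> t \<in> K" for t using g(3) frontier_subset_compact[OF assms(1)] by blast
  then have "(\<lambda>s. a \<bullet> \<gamma> s) = (\<lambda>s. b)" using a(2) by blast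
  moreover have "((\<lambda>s. a \<bullet> \<gamma> s) has_real_derivative a \<bullet> g t) (at t)" for t by (rule DERIV_inner_curve[OF g(1)])
  ultimately have ag: "a \<bullet> g t = 0" for t using DERIV_unique[OF DERIV_const[of b]] by metis
  \<comment> \<open>A direction vector of the line. At the Rolle point the velocity is orthogonal to
    both \<open>a\<close> and \<open>c\<close>, hence 0.\<close>
  define c :: "real^2" where "c = vector [- (a $ 2), a $ 1]"
  have dc: "((\<lambda>s. c \<bullet> \<gamma> s) has_real_derivative c \<bullet> g t) (at t)" for t by (rule DERIV_inner_curve[OF g(1)])
  have "\<gamma> (0 + 1) = \<gamma> 0" using assms(3) unfolding C2_boundary_curve_def by blast
  then have "\<exists>z::real>0. z < 1 \<and> ((\<lambda>s. c \<bullet> \<gamma> s) has_real_derivative 0) (at z)"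
  proof -
    assume *: "\<gamma> (0 + 1) = \<gamma> 0"
    have "\<exists>z>0. z < 1 \<and> (\<lambda>v. (c \<bullet> g z) * v) = (\<lambda>v. 0)"
      by (rule Rolle_deriv[of 0 1 "\<lambda>s. c \<bullet> \<gamma> s" "\<lambda>z v. (c \<bullet> g z) * v"])
        (use * dc in \<open>auto simp: has_field_derivative_def intro!: continuous_at_imp_continuous_on DERIV_isCont[OF dc]\<close>)
    then obtain z where "z > 0" "z < 1" "c \<bullet> g z = 0" by (metis mult.right_neutral)
    then show ?thesis using dc[of z] by metis
  qed
  then obtain z where "((\<lambda>s. c \<bullet> \<gamma> s) has_real_derivative 0) (at z)" by blast
  then have cg: "c \<bullet> g z = 0" using DERIV_unique[OF dc] by blast
  have "a $ 1 * g z $ 1 + a $ 2 * g z $ 2 = 0" "- (a $ 2) * g z $ 1 + a $ 1 * g z $ 2 = 0"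
    using ag[of z] cg by (simp_all add: inner_real2 c_def)
  then have g12: "((a $ 1)\<^sup>2 + (a $ 2)\<^sup>2) * g z $ 1 = 0" "((a $ 1)\<^sup>2 + (a $ 2)\<^sup>2) * g z $ 2 = 0"
    unfolding power2_eq_square by algebra+
  have "(a $ 1)\<^sup>2 + (a $ 2)\<^sup>2 \<noteq> 0" using a(1) by (simp add: vec2_eq_iff sum_power2_eq_zero_iff)
  then have "g z $ 1 = 0" "g z $ 2 = 0" using g12 mult_eq_0_iff by blast+
  then show False using g(2)[of z] by (simp add: vec2_eq_iff)
qed

context planar_body begin

text \<open>Let q be the direction of the outer normal along the curve and P a primitive of p. Up to sign, the inner
  product of the curve with its tangent plus P q is a primitive of the speed, and q makes exactly one
  turn because each direction has only one support point.\<close>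
theorem curve_length_eq:
  assumes C: "C2_boundary_curve K \<gamma>"
  shows "curve_length \<gamma> = integral {0..2*pi} p"
proof -
  obtain g g' where g: "\<And>t. (\<gamma> has_vector_derivative g t) (at t)" and g': "\<And>t. (g has_vector_derivative g' t) (at t)"
    "continuous_on UNIV g'" and g0: "\<And>t. g t \<noteq> 0" and vd: "\<And>t. vector_derivative \<gamma> (at t) = g t"
    and gper: "\<And>t. g (t + 1) = g t" and fr: "\<And>t. \<gamma> t \<in> frontier K"
    using C2_boundary_curveD[OF C] by metis
  have comp: "((\<lambda>s. f s $ i) has_real_derivative f' $ i) (at t)" if "(f has_vector_derivative f') (at t)"
    for f :: "real \<Rightarrow> real^2" and f' t i
    unfolding has_real_derivative_iff_has_vector_derivative
    by (rule bounded_linear.has_vector_derivative[OF bounded_linear_vec_nth that])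
  define v where "v t = norm (g t)" for t
  have v_sqrt: "sqrt ((g t $ 1)\<^sup>2 + (g t $ 2)\<^sup>2) = v t" for t
    by (simp add: v_def norm_eq_sqrt_inner inner_real2 power2_eq_square)
  have v0: "v t > 0" for t using g0 by (simp add: v_def)
  have nz: "(g t $ 1)\<^sup>2 + (g t $ 2)\<^sup>2 > 0" for t
    using g0[of t] by (simp add: vec2_eq_iff sum_power2_gt_zero_iff)
  have ci: "continuous_on UNIV (\<lambda>t. g' t $ i)" for i by (intro continuous_intros g')
  obtain h w where dh: "\<And>t. (h has_real_derivative w t) (at t)"
    and gx: "\<And>t. g t $ 1 = v t * cos (h t)" and gy: "\<And>t. g t $ 2 = v t * sin (h t)"
    using angle_lift[of "\<lambda>t. g t $ 1" "\<lambda>t. g' t $ 1" "\<lambda>t. g t $ 2" "\<lambda>t. g' t $ 2", OF comp[OF g'(1)] comp[OF g'(1)] ci ci nz]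
    unfolding v_sqrt by metis
  have g_nvec: "g t = v t *\<^sub>R nvec (h t)" for t by (simp add: vec2_eq_iff gx gy)
  have hc: "continuous_on UNIV h" by (meson dh DERIV_isCont continuous_at_imp_continuous_on)
  have gc: "continuous_on UNIV (\<lambda>t. \<gamma> t $ i)" for i
    by (intro continuous_at_imp_continuous_on ballI DERIV_isCont[OF comp[OF g]])
  have gK: "\<gamma> t \<in> K" for t using fr frontier_subset_compact[OF compact_K] by blast
  have nv_half: "nvec (b + pi/2) = tvec b" "nvec (b - pi/2) = - tvec b" for b
    by (simp_all add: vec2_eq_iff cos_add sin_add cos_diff sin_diff)
  \<comment> \<open>The parameters at which the tangent direction turned by d is an outer normal.
    The sets for d = pi/2 and d = - pi/2 are closed, cover the line, and are disjoint because widths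
    are positive. By connectedness one of them is everything: the orientation is constant.\<close>
  define S where "S d = {t. \<gamma> t \<bullet> nvec (h t + d) = p (h t + d)}" for d
  have S_closed: "closed (S d)" for d
  proof -
    have c: "continuous_on UNIV (\<lambda>t. h t + d)" by (intro continuous_intros hc)
    show ?thesis unfolding S_def inner_real2 nvec_nth
      by (intro closed_Collect_eq continuous_intros gc c continuous_on_compose2[OF cont_p[of UNIV] c]) auto
  qed
  have S_cover: "t \<in> S (pi/2) \<union> S (- pi/2)" for t
  proof -
    obtain a where a: "\<gamma> t \<bullet> nvec a = p a" using frontier_support[OF fr] by blast
    have "((\<lambda>s. nvec a \<bullet> \<gamma> s) has_real_derivative nvec a \<bullet> g t) (at t)" by (rule DERIV_inner_curve[OF g])
    then have "nvec a \<bullet> g t = 0"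
      by (rule DERIV_local_max[of _ _ _ 1]) (use a le_p[OF gK, of _ a] in \<open>auto simp: inner_commute\<close>)
    then have "cos (h t - a) = 0" using v0[of t] by (simp add: g_nvec nvec_tvec_inner_diff)
    then have "sin (a - (h t + pi/2)) = 0" by (simp add: sin_diff sin_add cos_add cos_diff algebra_simps)
    then have "nvec a = nvec (h t + pi/2) \<or> nvec a = - nvec (h t + pi/2)" by (rule sin_diff_zero_nvec)
    then have "nvec a = nvec (h t + pi/2) \<or> nvec a = nvec (h t + - pi/2)"
      using nv_half[of "h t"] by simp
    then show ?thesis
    proof
      assume *: "nvec a = nvec (h t + pi/2)"
      then have "p a = p (h t + pi/2)" by (rule p_cong)
      then show ?thesis using a * by (simp add: S_def)
    next
      assume *: "nvec a = nvec (h t + - pi/2)"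
      then have "p a = p (h t + - pi/2)" by (rule p_cong)
      then show ?thesis using a * by (simp add: S_def)
    qed
  qed
  have S_disj: "S (pi/2) \<inter> S (- pi/2) = {}"
  proof (rule ccontr)
    assume "S (pi/2) \<inter> S (- pi/2) \<noteq> {}"
    then obtain t where t: "\<gamma> t \<bullet> nvec (h t + pi/2) = p (h t + pi/2)" "\<gamma> t \<bullet> nvec (h t - pi/2) = p (h t - pi/2)"
      by (auto simp: S_def)
    have "p (h t - pi/2) + p (h t - pi/2 + pi) > 0" by (rule width_pos)
    moreover have "h t - pi/2 + pi = h t + pi/2" by simp
    ultimately show False using t nv_half[of "h t"] by simp
  qed
  have "S (pi/2) = UNIV \<or> S (- pi/2) = UNIV"
  proof -
    have "S (pi/2) = {} \<or> S (- pi/2) = {}"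
      using connected_closedD[OF connected_UNIV, of "S (pi/2)" "S (- pi/2)"] S_closed S_cover S_disj by blast
    then show ?thesis using S_cover by blast
  qed
  then obtain e :: real where e: "e = 1 \<or> e = -1" and eS: "S (e * (pi/2)) = UNIV"
    by (metis minus_divide_left mult_1 mult_minus1)
  define q where "q t = h t + e * (pi/2)" for t
  have supp: "\<gamma> t \<bullet> nvec (q t) = p (q t)" for t using eS by (auto simp: S_def q_def)
  have \<gamma>contact: "\<gamma> t = contact (q t)" for t by (rule support_point_unique[OF gK supp])
  have dq: "(q has_real_derivative w t) (at t)" for t unfolding q_def by (auto intro!: derivative_eq_intros dh)
  have tq: "tvec (q t) = - e *\<^sub>R nvec (h t)" for t
    using e by (auto simp: q_def vec2_eq_iff cos_add sin_add cos_diff sin_diff)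
  have nq: "nvec (q t) = e *\<^sub>R tvec (h t)" for t
    using e nv_half[of "h t"] by (auto simp: q_def)
  obtain P where P: "\<And>x. (P has_real_derivative p x) (at x)" using antiderivative_real[OF cont_p] by blast
  have dPs: "((\<lambda>x. P (x + c)) has_real_derivative p (x + c)) (at x)" for c x
    using P[of "x + c"] by (simp add: DERIV_shift)
  define Lam where "Lam = integral {0..2*pi} p"
  have PL: "P (x + 2*pi) - P x = Lam" for x
  proof -
    have "((\<lambda>x. P (x + 2*pi) - P x) has_real_derivative 0) (at x)" for x
      using DERIV_diff[OF dPs P, of "2*pi" x] by (simp add: p_2pi)
    then have "P (x + 2*pi) - P x = P (0 + 2*pi) - P 0" using DERIV_isconst_all by blast
    also have "\<dots> = Lam" using integral_unique[OF has_integral_antiderivative[OF _ P, of 0 "2*pi"]] by (simp add: Lam_def)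
    finally show ?thesis .
  qed
  have PLk: "P (x + 2*pi * real_of_int k) = P x + real_of_int k * Lam" for x k
  proof -
    have "P (x + 2*pi * real_of_int k) - (x + 2*pi * real_of_int k) / (2*pi) * Lam = P x - x / (2*pi) * Lam"
      by (rule periodic_int[of "\<lambda>x. P x - x / (2*pi) * Lam"]) (use PL in \<open>simp add: field_simps\<close>)
    moreover have "(x + 2*pi * real_of_int k) / (2*pi) = x / (2*pi) + real_of_int k" by (simp add: add_divide_distrib)
    ultimately show ?thesis by (simp add: distrib_right)
  qed
  \<comment> \<open>The function p itself is negative somewhere if the origin lies outside K; p x +
    p (x + pi) is a width and therefore positive.\<close>
  have Lam_pos: "Lam > 0"
  proof -
    have "((\<lambda>x. P x + P (x + pi)) has_real_derivative p x + p (x + pi)) (at x)" for x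
      by (intro DERIV_add P dPs)
    then have "P 0 + P (0 + pi) < P pi + P (pi + pi)"
      using DERIV_pos_imp_increasing[of 0 pi "\<lambda>x. P x + P (x + pi)"] width_pos by (metis pi_gt_zero)
    then show ?thesis using PL[of 0] by simp
  qed
  \<comment> \<open>Differentiating \<open>tvec (q t)\<close> produces minus the support value p (q
    t) times the angular velocity, and the derivative of \<open>P (q t)\<close> cancels exactly this
    term.\<close>
  have dH: "((\<lambda>t. - e * (\<gamma> t \<bullet> tvec (q t) + P (q t))) has_real_derivative v t) (at t)" for t
  proof -
    have "((\<lambda>t. - (\<gamma> t $ 1) * sin (q t) + \<gamma> t $ 2 * cos (q t) + P (q t)) has_real_derivative
        (g t \<bullet> tvec (q t) - (\<gamma> t \<bullet> nvec (q t)) * w t + p (q t) * w t)) (at t)"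
      by (rule derivative_eq_intros comp[OF g] dq DERIV_chain2[OF P dq] refl | simp add: inner_real2 algebra_simps)+
    moreover have "g t \<bullet> tvec (q t) = - e * v t" by (simp add: g_nvec tq)
    moreover have "\<gamma> s \<bullet> tvec (q s) + P (q s) = - (\<gamma> s $ 1) * sin (q s) + \<gamma> s $ 2 * cos (q s) + P (q s)" for s
      by (simp add: inner_real2)
    ultimately have "((\<lambda>t. \<gamma> t \<bullet> tvec (q t) + P (q t)) has_real_derivative (- e * v t)) (at t)"
      using supp[of t] by simp
    from DERIV_cmult[OF this, of "- e"] show ?thesis using e by auto
  qed
  have L: "curve_length \<gamma> = - e * (\<gamma> 1 \<bullet> tvec (q 1) + P (q 1)) - (- e * (\<gamma> 0 \<bullet> tvec (q 0) + P (q 0)))"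
    unfolding curve_length_def vd
    using integral_unique[OF has_integral_antiderivative[OF _ dH, of 0 1]] by (simp add: v_def)
  have "\<gamma> (0 + 1) = \<gamma> 0" using C unfolding C2_boundary_curve_def by blast
  then have "\<gamma> 1 = \<gamma> 0" by simp
  have g10: "g 1 = g 0" using gper[of 0] by simp
  then have "v 1 = v 0" by (simp add: v_def)
  then have "v 0 *\<^sub>R nvec (h 1) = v 0 *\<^sub>R nvec (h 0)"
    using g10 unfolding g_nvec[of 1] g_nvec[of 0] by simp
  then have "nvec (h 1) = nvec (h 0)" using v0[of 0] scaleR_cancel_left by fastforce
  then have nq01: "nvec (q 1) = nvec (q 0)" by (simp add: nq tvec_eq_iff)
  from this[unfolded nvec_eq_iff] obtain j :: int where j: "q 1 = q 0 + 2*pi * j" by blast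
  have Lj: "curve_length \<gamma> = - e * real_of_int j * Lam"
    unfolding L using \<open>\<gamma> 1 = \<gamma> 0\<close> p_cong(3)[OF nq01] PLk[of "q 0" j] j by (simp add: algebra_simps)
  have Lpos: "curve_length \<gamma> > 0"
  proof -
    have "continuous_on {0..1} (\<lambda>t. norm (g t))"
      by (intro continuous_intros continuous_at_imp_continuous_on ballI has_vector_derivative_continuous[OF g'(1)])
    then show ?thesis unfolding curve_length_def vd
      by (rule integral_pos_if_continuous[where c = 0]) (use g0 in auto)
  qed
  \<comment> \<open>With more than one turn, q would pass q 0 + 2 pi or q 0 - 2 pi strictly before
    the end, and the curve would revisit its starting point there, against simplicity. The sign of j
    is settled afterwards by positivity of the length and of \<open>Lam\<close>.\<close>
  have "\<bar>j\<bar> \<le> 1"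
  proof (rule ccontr)
    assume "\<not> \<bar>j\<bar> \<le> 1"
    then consider "j \<ge> 2" | "j \<le> -2" by linarith
    then obtain k :: int where k: "k = 1 \<or> k = -1" and
      between: "q 0 \<le> q 0 + 2*pi*k \<and> q 0 + 2*pi*k \<le> q 1 \<or> q 1 \<le> q 0 + 2*pi*k \<and> q 0 + 2*pi*k \<le> q 0"
      and kj: "k \<noteq> j"
    proof cases
      case 1
      then have "2*pi * 1 \<le> 2*pi * real_of_int j" by (intro mult_left_mono) auto
      then show ?thesis using that[of 1] 1 j by auto
    next
      case 2
      then have "2*pi * real_of_int j \<le> 2*pi * (-1)" by (intro mult_left_mono) auto
      then show ?thesis using that[of "-1"] 2 j by auto
    qed
    have qc: "continuous_on {0..1} q" by (meson dq DERIV_isCont continuous_at_imp_continuous_on)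
    obtain t where t: "0 \<le> t" "t \<le> 1" "q t = q 0 + 2*pi*k"
    proof -
      from between have "\<exists>t. 0 \<le> t \<and> t \<le> 1 \<and> q t = q 0 + 2*pi*k"
      proof
        assume "q 0 \<le> q 0 + 2*pi*k \<and> q 0 + 2*pi*k \<le> q 1"
        then show ?thesis by (intro IVT') (use qc in auto)
      next
        assume "q 1 \<le> q 0 + 2*pi*k \<and> q 0 + 2*pi*k \<le> q 0"
        then show ?thesis by (intro IVT2') (use qc in auto)
      qed
      then show ?thesis using that by blast
    qed
    have "nvec (q t) = nvec (q 0)" unfolding nvec_eq_iff using t(3) by blast
    then have "contact (q t) = contact (q 0)" by (rule p_cong)
    then have "\<gamma> t = \<gamma> 0" using \<gamma>contact[of t] \<gamma>contact[of 0] by simp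
    moreover have lf: "\<forall>x\<in>{0..1}. \<forall>y\<in>{0..1}. \<gamma> x = \<gamma> y \<longrightarrow> x = y \<or> x = 0 \<and> y = 1 \<or> x = 1 \<and> y = 0"
      using C unfolding C2_boundary_curve_def simple_path_def loop_free_def by blast
    ultimately have "t = 0 \<or> t = 1" using t bspec[OF bspec[OF lf, of t], of 0] by auto
    then show False
    proof
      assume "t = 0"
      then show False using t(3) k by auto
    next
      assume "t = 1"
      then have "2*pi * real_of_int k = 2*pi * real_of_int j" using t(3) j by simp
      then show False using kj by simp
    qed
  qed
  then have "j = 0 \<or> j = 1 \<or> j = -1" by linarith
  then have "- e * real_of_int j = 1"
    using e Lj Lpos Lam_pos by (auto simp: not_less)
  then show ?thesis using Lj by (simp add: Lam_def)
qed

end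

section \<open>Fourier expansion of the integral\<close>

lemma integral_shift_period:
  fixes f :: "real \<Rightarrow> real"
  assumes cont: "continuous_on UNIV f" and per: "\<And>x. f (x + 2*pi) = f x"
  shows "integral {0..2*pi} (\<lambda>x. f (x + s)) = integral {0..2*pi} f"
proof -
  obtain A where A: "\<And>x. (A has_real_derivative f x) (at x)" using antiderivative_real[OF cont] by blast
  have As: "((\<lambda>x. A (x + c)) has_real_derivative f (x + c)) (at x)" for c x
    using A[of "x + c"] by (simp add: DERIV_shift)
  have "((\<lambda>x. A (x + 2*pi) - A x) has_real_derivative 0) (at x)" for x
    using DERIV_diff[OF As A, of "2*pi" x] by (simp add: per)
  then have "A (s + 2*pi) - A s = A (0 + 2*pi) - A 0" using DERIV_isconst_all by blast
  moreover have "integral {0..2*pi} (\<lambda>x. f (x + s)) = A (2*pi + s) - A (0 + s)"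
    by (rule integral_unique[OF has_integral_antiderivative[OF _ As]]) simp
  moreover have "integral {0..2*pi} f = A (2*pi) - A 0"
    by (rule integral_unique[OF has_integral_antiderivative[OF _ A]]) simp
  ultimately show ?thesis by (simp add: add.commute)
qed

lemma has_integral_fourier_cos:
  "continuous_on UNIV g \<Longrightarrow> ((\<lambda>x. g x * cos (real k * x)) has_integral fourier_cos g k) {0..2*pi}"
  and has_integral_fourier_sin:
  "continuous_on UNIV g \<Longrightarrow> ((\<lambda>x. g x * sin (real k * x)) has_integral fourier_sin g k) {0..2*pi}"
  unfolding fourier_cos_def fourier_sin_def
  by (intro integrable_integral integrable_continuous_real continuous_intros; auto intro: continuous_on_subset)+

lemma fourier_shift:
  assumes cont: "continuous_on UNIV g" and per: "\<And>x. g (x + 2*pi) = g x"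
  shows "fourier_cos (\<lambda>x. g (x + s)) k = cos (real k * s) * fourier_cos g k + sin (real k * s) * fourier_sin g k"
    and "fourier_sin (\<lambda>x. g (x + s)) k = cos (real k * s) * fourier_sin g k - sin (real k * s) * fourier_cos g k"
proof -
  have trig: "cos (real k * (x + 2*pi - s)) = cos (real k * (x - s))" "sin (real k * (x + 2*pi - s)) = sin (real k * (x - s))" for x
  proof -
    have "real k * (x + 2*pi - s) = real k * (x - s) + 2 * pi * of_nat k" by (simp add: algebra_simps)
    then show "cos (real k * (x + 2*pi - s)) = cos (real k * (x - s))" "sin (real k * (x + 2*pi - s)) = sin (real k * (x - s))"
      using sin_cos_eq_iff[of "real k * (x + 2*pi - s)" "real k * (x - s)"] by (auto intro: exI[of _ "int k"])
  qed
  have "fourier_cos (\<lambda>x. g (x + s)) k = integral {0..2*pi} (\<lambda>x. g (x + s) * cos (real k * (x + s - s)))"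
    by (simp add: fourier_cos_def)
  also have "\<dots> = integral {0..2*pi} (\<lambda>x. g x * cos (real k * (x - s)))"
    by (rule integral_shift_period[of "\<lambda>x. g x * cos (real k * (x - s))"]) (auto intro!: continuous_intros cont simp: per trig)
  also have "\<dots> = integral {0..2*pi} (\<lambda>x. cos (real k * s) * (g x * cos (real k * x)) + sin (real k * s) * (g x * sin (real k * x)))"
    by (simp add: right_diff_distrib cos_diff algebra_simps)
  also have "\<dots> = cos (real k * s) * fourier_cos g k + sin (real k * s) * fourier_sin g k"
    by (intro integral_unique has_integral_add has_integral_mult_right has_integral_fourier_cos has_integral_fourier_sin cont)
  finally show "fourier_cos (\<lambda>x. g (x + s)) k = cos (real k * s) * fourier_cos g k + sin (real k * s) * fourier_sin g k" .
  have "fourier_sin (\<lambda>x. g (x + s)) k = integral {0..2*pi} (\<lambda>x. g (x + s) * sin (real k * (x + s - s)))"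
    by (simp add: fourier_sin_def)
  also have "\<dots> = integral {0..2*pi} (\<lambda>x. g x * sin (real k * (x - s)))"
    by (rule integral_shift_period[of "\<lambda>x. g x * sin (real k * (x - s))"]) (auto intro!: continuous_intros cont simp: per trig)
  also have "\<dots> = integral {0..2*pi} (\<lambda>x. cos (real k * s) * (g x * sin (real k * x)) - sin (real k * s) * (g x * cos (real k * x)))"
    by (simp add: right_diff_distrib sin_diff algebra_simps)
  also have "\<dots> = cos (real k * s) * fourier_sin g k - sin (real k * s) * fourier_cos g k"
    by (intro integral_unique has_integral_diff has_integral_mult_right has_integral_fourier_cos has_integral_fourier_sin cont)
  finally show "fourier_sin (\<lambda>x. g (x + s)) k = cos (real k * s) * fourier_sin g k - sin (real k * s) * fourier_cos g k" .
qed

context planar_body begin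

lemma fourier_p': "fourier_cos p' k = real k * fourier_sin p k" "fourier_sin p' k = - real k * fourier_cos p k"
proof -
  have "((\<lambda>x. p x * cos (real k * x)) has_real_derivative (p' x * cos (real k * x) - real k * (p x * sin (real k * x)))) (at x)" for x
    by (rule derivative_eq_intros dp refl | simp)+
  from has_integral_antiderivative[OF _ this, of 0 "2*pi"]
  have "((\<lambda>x. p' x * cos (real k * x) - real k * (p x * sin (real k * x))) has_integral 0) {0..2*pi}"
    using p_2pi[of 0] cos_int_2pin[of "int k"] by (simp add: mult_ac)
  moreover have "((\<lambda>x. p' x * cos (real k * x) - real k * (p x * sin (real k * x))) has_integral
      (fourier_cos p' k - real k * fourier_sin p k)) {0..2*pi}"
    by (intro has_integral_diff has_integral_mult_right has_integral_fourier_cos has_integral_fourier_sin cont_p cont_p')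
  ultimately have "fourier_cos p' k - real k * fourier_sin p k = 0" using has_integral_unique by blast
  then show "fourier_cos p' k = real k * fourier_sin p k" by simp
  have "((\<lambda>x. p x * sin (real k * x)) has_real_derivative (p' x * sin (real k * x) + real k * (p x * cos (real k * x)))) (at x)" for x
    by (rule derivative_eq_intros dp refl | simp)+
  from has_integral_antiderivative[OF _ this, of 0 "2*pi"]
  have "((\<lambda>x. p' x * sin (real k * x) + real k * (p x * cos (real k * x))) has_integral 0) {0..2*pi}"
    using p_2pi[of 0] sin_int_2pin[of "int k"] by (simp add: mult_ac)
  moreover have "((\<lambda>x. p' x * sin (real k * x) + real k * (p x * cos (real k * x))) has_integral
      (fourier_sin p' k + real k * fourier_cos p k)) {0..2*pi}"
    by (intro has_integral_add has_integral_mult_right has_integral_fourier_cos has_integral_fourier_sin cont_p cont_p')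
  ultimately have "fourier_sin p' k + real k * fourier_cos p k = 0" using has_integral_unique by blast
  then show "fourier_sin p' k = - real k * fourier_cos p k" by simp
qed

lemma fourier_energy_p': "fourier_energy p' k = (real k)\<^sup>2 * fourier_energy p k"
  by (simp add: fourier_energy_def fourier_p' power_mult_distrib algebra_simps)

text \<open>The factor by which passing from p to \<open>tau t\<close> multiplies the energy of mode
  k, for 0 < t < pi. It is split so that the first part integrates against f' to
  \<open>mode_coeff\<close>, while the part independent of t reproduces the area series and accounts
  for - pi^m F.\<close>

definition mode_wt :: "nat \<Rightarrow> real \<Rightarrow> real" where
  "mode_wt k t = 2 * (iso_num k t / (sin t)\<^sup>2) + ((real k)\<^sup>2 - 1)"

lemma fourier_energy_tau:
  assumes t: "0 < t" "t < pi"
  shows "fourier_energy (tau t) k = fourier_energy p k * mode_wt k t"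
proof -
  have s: "0 < sin t" using t by (rule sin_gt_zero)
  \<comment> \<open>On the coefficient pair of frequency k, \<open>tau t\<close> acts as a rotation
    combined with a dilation, with entries A, B and - B, divided by sin t. Hence the energy is
    multiplied by (A^2 + B^2) / (sin t)^2.\<close>
  define A where "A = cos (real k * (pi - t)) + cos t"
  define B where "B = sin (real k * (pi - t)) - real k * sin t"
  have cs: "continuous_on UNIV (\<lambda>x. p (x + (pi - t)))"
    by (rule continuous_on_compose2[OF cont_p[of UNIV]]) (auto intro!: continuous_intros)
  have C: "fourier_cos (tau t) k = (A * fourier_cos p k + B * fourier_sin p k) / sin t"
  proof -
    have "((\<lambda>x. (p (x + (pi - t)) * cos (real k * x) + cos t * (p x * cos (real k * x)) - sin t * (p' x * cos (real k * x))) / sin t)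
      has_integral (fourier_cos (\<lambda>x. p (x + (pi - t))) k + cos t * fourier_cos p k - sin t * fourier_cos p' k) / sin t) {0..2*pi}"
      by (intro has_integral_divide has_integral_diff has_integral_add has_integral_mult_right has_integral_fourier_cos cs cont_p cont_p')
    moreover have "(p (x + (pi - t)) * cos (real k * x) + cos t * (p x * cos (real k * x)) - sin t * (p' x * cos (real k * x))) / sin t
      = tau t x * cos (real k * x)" for x
      by (simp add: tau_def add_diff_eq algebra_simps)
    ultimately have "fourier_cos (tau t) k = (fourier_cos (\<lambda>x. p (x + (pi - t))) k + cos t * fourier_cos p k - sin t * fourier_cos p' k) / sin t"
      unfolding fourier_cos_def[of "tau t"] by (simp add: integral_unique)
    then show ?thesis
      unfolding fourier_shift[OF cont_p p_2pi] fourier_p' A_def B_def by (simp add: algebra_simps)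
  qed
  have S: "fourier_sin (tau t) k = (A * fourier_sin p k - B * fourier_cos p k) / sin t"
  proof -
    have "((\<lambda>x. (p (x + (pi - t)) * sin (real k * x) + cos t * (p x * sin (real k * x)) - sin t * (p' x * sin (real k * x))) / sin t)
      has_integral (fourier_sin (\<lambda>x. p (x + (pi - t))) k + cos t * fourier_sin p k - sin t * fourier_sin p' k) / sin t) {0..2*pi}"
      by (intro has_integral_divide has_integral_diff has_integral_add has_integral_mult_right has_integral_fourier_sin cs cont_p cont_p')
    moreover have "(p (x + (pi - t)) * sin (real k * x) + cos t * (p x * sin (real k * x)) - sin t * (p' x * sin (real k * x))) / sin t
      = tau t x * sin (real k * x)" for x
      by (simp add: tau_def add_diff_eq algebra_simps)
    ultimately have "fourier_sin (tau t) k = (fourier_sin (\<lambda>x. p (x + (pi - t))) k + cos t * fourier_sin p k - sin t * fourier_sin p' k) / sin t"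
      unfolding fourier_sin_def[of "tau t"] by (simp add: integral_unique)
    then show ?thesis
      unfolding fourier_shift[OF cont_p p_2pi] fourier_p' A_def B_def by (simp add: algebra_simps)
  qed
  have ang: "cos (real k * (pi - t)) = (-1)^k * cos (real k * t)" "sin (real k * (pi - t)) = - ((-1)^k * sin (real k * t))"
    by (simp_all add: right_diff_distrib cos_diff sin_diff cos_npi sin_npi)
  have m1: "((-1)^k)\<^sup>2 = (1::real)" by (simp add: power_even_eq[symmetric] flip: power_mult)
  have AB: "A\<^sup>2 + B\<^sup>2 = 2 * iso_num k t + ((real k)\<^sup>2 - 1) * (sin t)\<^sup>2"
  proof -
    define c where "c = cos (real k * t)"
    define d where "d = sin (real k * t)"
    define e :: real where "e = (-1)^k"
    have "A\<^sup>2 + B\<^sup>2 = e\<^sup>2 * (c\<^sup>2 + d\<^sup>2) + (cos t)\<^sup>2 + 2 * e * (cos t * c + real k * d * sin t) + (real k)\<^sup>2 * (sin t)\<^sup>2"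
      unfolding A_def B_def ang c_def[symmetric] d_def[symmetric] e_def[symmetric]
      by (simp add: power2_eq_square algebra_simps)
    also have "c\<^sup>2 + d\<^sup>2 = 1" by (simp add: c_def d_def)
    also have "e\<^sup>2 = 1" using m1 by (simp add: e_def)
    also have "(cos t)\<^sup>2 = 1 - (sin t)\<^sup>2" by (rule cos_squared_eq)
    finally show ?thesis by (simp add: iso_num_def c_def d_def e_def algebra_simps)
  qed
  have "(fourier_cos (tau t) k)\<^sup>2 + (fourier_sin (tau t) k)\<^sup>2
      = ((A * fourier_cos p k + B * fourier_sin p k)\<^sup>2 + (A * fourier_sin p k - B * fourier_cos p k)\<^sup>2) / (sin t)\<^sup>2"
    unfolding C S power_divide by (rule add_divide_distrib[symmetric])
  also have "(A * fourier_cos p k + B * fourier_sin p k)\<^sup>2 + (A * fourier_sin p k - B * fourier_cos p k)\<^sup>2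
     = ((fourier_cos p k)\<^sup>2 + (fourier_sin p k)\<^sup>2) * (A\<^sup>2 + B\<^sup>2)"
    by (simp add: power2_eq_square algebra_simps)
  also have "\<dots> / (sin t)\<^sup>2 = ((fourier_cos p k)\<^sup>2 + (fourier_sin p k)\<^sup>2) * mode_wt k t"
    unfolding AB mode_wt_def using s by (simp add: field_simps)
  finally show ?thesis by (simp add: fourier_energy_def)
qed

lemma tau_2pi: "tau t (a + 2*pi) = tau t a"
proof -
  have "p (a + 2*pi + pi - t) = p (a + pi - t)" using p_2pi[of "a + pi - t"] by (simp add: algebra_simps)
  then show ?thesis by (simp add: tau_def p_2pi p'_2pi)
qed

lemma tau_energy_sums:
  assumes "0 < t" "t < pi"
  shows "(\<lambda>k. fourier_energy p k * mode_wt k t) sums integral {0..2*pi} (\<lambda>a. (tau t a)\<^sup>2)"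
proof -
  have "fourier_energy (tau t) = (\<lambda>k. fourier_energy p k * mode_wt k t)"
    by (rule ext) (rule fourier_energy_tau[OF assms])
  then show ?thesis using parseval[OF continuous_on_tau tau_2pi, of t] by simp
qed

text \<open>The contribution of mode k to the integral over the exterior; the second summand is pi^m
  times the k-th term of the series for minus the area.\<close>

definition mode_int :: "nat \<Rightarrow> nat \<Rightarrow> real" where
  "mode_int m k = fourier_energy p k * mode_coeff m k + pi^m * (fourier_energy p k * ((real k)\<^sup>2 - 1) / 2)"

lemma has_integral_mode:
  assumes "m \<ge> 1"
  shows "((\<lambda>t. pow_sin_deriv m t * (fourier_energy p k * mode_wt k t / 2)) has_integral mode_int m k) {0..pi}"
proof -
  have pow_sin_deriv: "(pow_sin_deriv m has_integral pi^m) {0..pi}"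
    using has_integral_antiderivative[OF _ DERIV_pow_sin_deriv, of 0 pi m] assms by (simp add: zero_power)
  have "((\<lambda>t. fourier_energy p k * (pow_sin_deriv m t * iso_num k t / (sin t)\<^sup>2) + (fourier_energy p k * ((real k)\<^sup>2 - 1) / 2) * pow_sin_deriv m t)
    has_integral (fourier_energy p k * mode_coeff m k + (fourier_energy p k * ((real k)\<^sup>2 - 1) / 2) * pi^m)) {0..pi}"
    by (intro has_integral_add has_integral_mult_right has_integral_mode_coeff pow_sin_deriv)
  moreover have "(\<lambda>t. fourier_energy p k * (pow_sin_deriv m t * iso_num k t / (sin t)\<^sup>2) + (fourier_energy p k * ((real k)\<^sup>2 - 1) / 2) * pow_sin_deriv m t)
    = (\<lambda>t. pow_sin_deriv m t * (fourier_energy p k * mode_wt k t / 2))"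
    unfolding mode_wt_def by (simp add: fun_eq_iff algebra_simps add_divide_distrib diff_divide_distrib)
  ultimately show ?thesis unfolding mode_int_def by (simp only: mult.commute[of "pi^m"])
qed

text \<open>The sign is not visible in the formula for \<open>mode_wt\<close>; it is inherited from
  the energy of \<open>tau t\<close>.\<close>

lemma mode_integrand_nonneg:
  assumes "t \<in> {0<..<pi}"
  shows "0 \<le> pow_sin_deriv m t * (fourier_energy p k * mode_wt k t / 2)"
proof -
  have "0 \<le> fourier_energy p k * mode_wt k t"
    using fourier_energy_tau[of t k] fourier_energy_nonneg[of "tau t" k] assms by simp
  then show ?thesis using assms pow_sin_deriv_nonneg[of t m] by (intro mult_nonneg_nonneg) auto
qed

lemma mode_int_nonneg:
  assumes "m \<ge> 1" shows "0 \<le> mode_int m k"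
  using has_integral_mode[OF assms, of k] unfolding has_integral_Icc_iff_Ioo
  by (rule has_integral_nonneg) (rule mode_integrand_nonneg)

lemma nn_integral_mode:
  assumes "m \<ge> 1"
  shows "(\<integral>\<^sup>+t. ennreal (pow_sin_deriv m t * (fourier_energy p k * mode_wt k t / 2)) * indicator {0<..<pi} t \<partial>lborel) = ennreal (mode_int m k)"
proof -
  have "(\<integral>\<^sup>+t. ennreal (indicator {0<..<pi} t * (pow_sin_deriv m t * (fourier_energy p k * mode_wt k t / 2))) \<partial>lborel) = ennreal (mode_int m k)"
    by (rule nn_integral_has_integral_lebesgue[OF mode_integrand_nonneg])
      (use has_integral_mode[OF assms] in \<open>auto simp: has_integral_Icc_iff_Ioo\<close>)
  moreover have "(\<lambda>t. ennreal (indicator {0<..<pi} t * (pow_sin_deriv m t * (fourier_energy p k * mode_wt k t / 2))))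
     = (\<lambda>t. ennreal (pow_sin_deriv m t * (fourier_energy p k * mode_wt k t / 2)) * indicator {0<..<pi} t)"
    by (auto simp: fun_eq_iff indicator_def)
  ultimately show ?thesis by simp
qed

lemma area_sums: "(\<lambda>k. fourier_energy p k * ((real k)\<^sup>2 - 1) / 2) sums (- measure lborel K)"
proof -
  have "(\<lambda>k. (fourier_energy p' k - fourier_energy p k) / 2) sums
     ((integral {0..2*pi} (\<lambda>a. (p' a)\<^sup>2) - integral {0..2*pi} (\<lambda>a. (p a)\<^sup>2)) / 2)"
    by (intro sums_divide sums_diff parseval cont_p cont_p' p_2pi p'_2pi)
  then show ?thesis unfolding area_K fourier_energy_p' by (simp add: algebra_simps diff_divide_distrib)
qed

text \<open>The integral is first computed in the extended reals as the sum of the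
  \<open>mode_int\<close>. Finiteness of this sum gives integrability, and subtracting pi^m times
  the area series leaves the mode constants.\<close>

theorem visual_angle_spectral:
  assumes m: "m \<ge> 1"
  shows "(\<lambda>k. fourier_energy p k * mode_coeff m k) sums
     ((LINT P:(- K)|lborel. visual_angle K P ^ m - sin (visual_angle K P) ^ m) + pi^m * measure lborel K)"
   and "set_integrable lborel (- K) (\<lambda>P. visual_angle K P ^ m - sin (visual_angle K P) ^ m)"
proof -
  let ?f = "\<lambda>P. visual_angle K P ^ m - sin (visual_angle K P) ^ m"
  let ?E = "fourier_energy p"
  let ?a = "\<lambda>k. ?E k * ((real k)\<^sup>2 - 1) / 2"
  have [measurable]: "pow_sin_deriv m \<in> borel_measurable borel"
    by (intro borel_measurable_continuous_onI continuous_intros)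
  have [measurable]: "mode_wt k \<in> borel_measurable borel" for k
    unfolding mode_wt_def iso_num_def by measurable
  have "(\<integral>\<^sup>+P. ennreal (indicator (- K) P * ?f P) \<partial>lborel)
    = (\<integral>\<^sup>+t. (\<Sum>k. ennreal (pow_sin_deriv m t * (?E k * mode_wt k t / 2)) * indicator {0<..<pi} t) \<partial>lborel)"
    unfolding nn_integral_visual_angle[OF m]
  proof (rule nn_integral_cong)
    fix t :: real
    show "ennreal (pow_sin_deriv m t * integral {0..2*pi} (\<lambda>a. (tau t a)\<^sup>2 / 2)) * indicator {0<..<pi} t
      = (\<Sum>k. ennreal (pow_sin_deriv m t * (?E k * mode_wt k t / 2)) * indicator {0<..<pi} t)"
    proof (cases "t \<in> {0<..<pi}")
      case True
      have "(\<lambda>k. pow_sin_deriv m t * (?E k * mode_wt k t / 2)) sums (pow_sin_deriv m t * (integral {0..2*pi} (\<lambda>a. (tau t a)\<^sup>2) / 2))"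
        using True by (intro sums_mult sums_divide tau_energy_sums) auto
      then have "(\<Sum>k. ennreal (pow_sin_deriv m t * (?E k * mode_wt k t / 2))) = ennreal (pow_sin_deriv m t * (integral {0..2*pi} (\<lambda>a. (tau t a)\<^sup>2) / 2))"
        by (intro suminf_ennreal_eq mode_integrand_nonneg[OF True])
      then show ?thesis using True by simp
    qed simp
  qed
  also have "\<dots> = (\<Sum>k. ennreal (mode_int m k))"
    unfolding nn_integral_mode[OF m, symmetric] by (rule nn_integral_suminf) measurable
  finally have nn: "(\<integral>\<^sup>+P. ennreal (indicator (- K) P * ?f P) \<partial>lborel) = (\<Sum>k. ennreal (mode_int m k))" .
  have sa: "summable ?a" using area_sums by (rule sums_summable)
  \<comment> \<open>For k >= 1 the constant \<open>mode_coeff m k\<close> is nonpositive, so the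
    convergent area series dominates. Mode 0 carries M together with a nonpositive area term, hence
    the comparison starts at 1.\<close>
  have sm: "summable (mode_int m)"
  proof (rule summable_comparison_test'[of "\<lambda>k. pi^m * ?a k" 1])
    show "summable (\<lambda>k. pi^m * ?a k)" by (intro summable_mult sa)
    fix k :: nat assume "k \<ge> 1"
    then have "?E k * mode_coeff m k \<le> 0" using mode_coeff_nonpos[OF m] fourier_energy_nonneg by (intro mult_nonneg_nonpos)
    then have "mode_int m k \<le> pi^m * ?a k" unfolding mode_int_def by linarith
    then show "norm (mode_int m k) \<le> pi^m * ?a k"
      unfolding real_norm_def abs_of_nonneg[OF mode_int_nonneg[OF m]] .
  qed
  have nn': "(\<integral>\<^sup>+P. ennreal (indicator (- K) P * ?f P) \<partial>lborel) = ennreal (suminf (mode_int m))"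
    unfolding nn by (rule suminf_ennreal_eq[OF mode_int_nonneg[OF m] summable_sums[OF sm]])
  have meas: "(\<lambda>P. indicator (- K) P * ?f P) \<in> borel_measurable lborel"
  proof -
    note measurable_visual_angle[measurable]
    have "(\<lambda>P. (indicator (- K) P * visual_angle K P) ^ m - sin (indicator (- K) P * visual_angle K P) ^ m) \<in> borel_measurable borel"
      by measurable
    moreover have "(\<lambda>P. (indicator (- K) P * visual_angle K P) ^ m - sin (indicator (- K) P * visual_angle K P) ^ m)
       = (\<lambda>P. indicator (- K) P * ?f P)"
      using m by (auto simp: fun_eq_iff indicator_def)
    ultimately show ?thesis by simp
  qed
  have nonneg: "0 \<le> indicator (- K) P * ?f P" for P
  proof (cases "P \<in> K")
    case False
    then have "0 < visual_angle K P" "visual_angle K P < pi" using exterior_visual_angle by auto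
    then have "sin (visual_angle K P) ^ m \<le> visual_angle K P ^ m"
      by (intro power_mono sin_x_le_x sin_ge_zero) auto
    then show ?thesis by simp
  qed simp
  show "set_integrable lborel (- K) ?f"
    unfolding set_integrable_def real_scaleR_def
    by (rule integrableI_nn_integral_finite[OF meas _ nn']) (use nonneg in simp)
  have "(LINT P:(- K)|lborel. ?f P) = enn2real (ennreal (suminf (mode_int m)))"
    unfolding set_lebesgue_integral_def real_scaleR_def nn'[symmetric]
    by (rule integral_eq_nn_integral[OF meas]) (use nonneg in simp)
  also have "\<dots> = suminf (mode_int m)"
    using suminf_nonneg[OF sm mode_int_nonneg[OF m]] by simp
  finally have LINT: "(LINT P:(- K)|lborel. ?f P) = suminf (mode_int m)" .
  have "(\<lambda>k. mode_int m k - pi^m * ?a k) sums ((LINT P:(- K)|lborel. ?f P) - pi^m * (- measure lborel K))"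
    unfolding LINT by (intro sums_diff sums_mult summable_sums sm area_sums)
  then show "(\<lambda>k. ?E k * mode_coeff m k) sums ((LINT P:(- K)|lborel. ?f P) + pi^m * measure lborel K)"
    by (simp add: mode_int_def)
qed

text \<open>By Parseval the squared distance of p from its Fourier sum of degree 1 is 0, and by
  continuity both agree. So p has the form r + c . n, which is the support function of a disc, and K
  is recovered from its support inequalities.\<close>

lemma energy_vanish_imp_ball:
  assumes "\<And>k. k \<ge> 2 \<Longrightarrow> fourier_energy p k = 0"
  shows "\<exists>a r. 0 < r \<and> K = cball a r"
proof -
  define A where "A k = fourier_wt k * fourier_cos p k" for k
  define B where "B k = fourier_wt k * fourier_sin p k" for k
  have wt: "fourier_wt k \<noteq> 0" for k by (simp add: fourier_wt_def)
  have "fourier_energy p sums (\<Sum>k\<le>1. fourier_energy p k)"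
    by (rule sums_finite) (use assms in auto)
  then have I2: "integral {0..2*pi} (\<lambda>x. (p x)\<^sup>2) = (\<Sum>k\<le>1. fourier_energy p k)"
    using parseval[OF cont_p p_2pi] sums_unique2 by blast
  have "((\<lambda>x. (p x - trig_sum 1 A B x)\<^sup>2) has_integral 0) {0..2*pi}"
  proof -
    have s0: "fourier_sin p 0 = 0" by (simp add: fourier_sin_def)
    have "integral {0..2*pi} (\<lambda>x. (p x)\<^sup>2) - 2 * (\<Sum>k\<le>1. A k * fourier_cos p k + B k * fourier_sin p k)
       + (\<Sum>k\<le>1. (A k)\<^sup>2 / fourier_wt k + (if k = 0 then 0 else (B k)\<^sup>2 / fourier_wt k)) = 0"
      unfolding I2 using wt[of 0] wt[of 1]
      by (simp add: A_def B_def fourier_energy_def s0 power2_eq_square algebra_simps)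
    then show ?thesis using has_integral_diff_trig_sum[OF cont_p, of 1 A B] by (simp only:)
  qed
  moreover have "continuous_on {0..2*pi} (\<lambda>x. (p x - trig_sum 1 A B x)\<^sup>2)" by (intro continuous_intros)
  moreover have "\<not> pi \<le> 0" using pi_gt_zero by linarith
  ultimately have "(p x - trig_sum 1 A B x)\<^sup>2 = 0" if "x \<in> {0..2*pi}" for x
    using has_integral_0_cbox_imp_0[of 0 "2*pi" "\<lambda>x. (p x - trig_sum 1 A B x)\<^sup>2" x] that
    by (simp add: box_real)
  then have ptrig: "p x = trig_sum 1 A B x" if "x \<in> {0..2*pi}" for x using that by simp
  define c :: "real^2" where "c = vector [A 1, B 1]"
  define r where "r = A 0"
  have pc: "p x = r + c \<bullet> nvec x" for x
  proof -
    obtain y where y: "0 \<le> y" "y < 2*pi" "nvec y = nvec x" by (rule nvec_reduce)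
    have "p y = r + c \<bullet> nvec y" using ptrig[of y] y(1,2) by (simp add: trig_sum_def inner_real2 c_def r_def)
    then show ?thesis unfolding y(3) p_cong(1)[OF y(3)] .
  qed
  have "0 < r" using width_pos[of 0] unfolding pc nvec_pi by simp
  moreover have "K = cball c r"
  proof (intro equalityI subsetI)
    fix x assume x: "x \<in> K"
    show "x \<in> cball c r"
    proof (cases "x = c")
      case False
      then have "norm ((x - c) /\<^sub>R norm (x - c)) = 1" by simp
      then obtain a where a: "(x - c) /\<^sub>R norm (x - c) = nvec a" using unit_vector_nvec by metis
      have "norm (x - c) = (x - c) \<bullet> nvec a"
        unfolding a[symmetric] using False by (simp add: power2_norm_eq_inner[symmetric] power2_eq_square)
      also have "\<dots> \<le> r" using le_p[OF x, of a] by (simp add: pc inner_diff_left)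
      finally show ?thesis by (simp add: dist_norm norm_minus_commute)
    qed (use \<open>0 < r\<close> in simp)
  next
    fix x assume "x \<in> cball c r"
    then have n: "norm (x - c) \<le> r" by (simp add: dist_norm norm_minus_commute)
    have "x \<bullet> nvec a \<le> p a" for a
      using norm_cauchy_schwarz[of "x - c" "nvec a"] n by (simp add: pc inner_diff_left)
    then show "x \<in> K" using mem_K_iff by blast
  qed
  ultimately show ?thesis by blast
qed

lemma ball_energy_vanish:
  assumes K: "K = cball c r" and "0 < r" and "k \<ge> 2"
  shows "fourier_energy p k = 0"
proof -
  have pc: "p x = r + c \<bullet> nvec x" for x
  proof (rule antisym)
    obtain y where y: "y \<in> K" "y \<bullet> nvec x = p x" by (rule p_attained)
    have "norm (y - c) \<le> r" using y(1) by (simp add: K dist_norm norm_minus_commute)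
    then show "p x \<le> r + c \<bullet> nvec x"
      using norm_cauchy_schwarz[of "y - c" "nvec x"] y(2) by (simp add: inner_diff_left)
    have "c + r *\<^sub>R nvec x \<in> K" using \<open>0 < r\<close> by (simp add: K dist_norm)
    from le_p[OF this, of x] show "r + c \<bullet> nvec x \<le> p x" by (simp add: inner_add_left)
  qed
  define A where "A i = (if i = 0 then r else c $ 1)" for i :: nat
  define B where "B i = (if i = 0 then 0 else c $ 2)" for i :: nat
  have "p = trig_sum 1 A B" by (simp add: fun_eq_iff pc trig_sum_def A_def B_def inner_real2)
  \<comment> \<open>Padding to degree k, so that the coefficient formulas for trigonometric sums
    reach frequency k.\<close>
  also have "\<dots> = trig_sum k (\<lambda>i. if i \<le> 1 then A i else 0) (\<lambda>i. if i \<le> 1 then B i else 0)"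
    using \<open>k \<ge> 2\<close> by (intro trig_sum_pad) simp
  finally have p: "p = trig_sum k (\<lambda>i. if i \<le> 1 then A i else 0) (\<lambda>i. if i \<le> 1 then B i else 0)" .
  have "fourier_cos p k = 0" "fourier_sin p k = 0"
    unfolding p using \<open>k \<ge> 2\<close> by (simp_all add: fourier_cos_trig_sum fourier_sin_trig_sum)
  then show ?thesis by (simp add: fourier_energy_def)
qed

end

section \<open>The inequality and the cases of equality\<close>

lemma planar_bodyI:
  assumes "compact K" "convex K" "C2_boundary_curve K \<gamma>" "C2_differentiable (support_function K)"
  obtains p' p'' where "planar_body K (support_function K) p' p''"
proof -
  obtain p' where p': "\<And>t. (support_function K has_vector_derivative p' t) (at t)" "p' C1_differentiable_on UNIV"
    using assms(4) unfolding C2_differentiable_def by blast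
  obtain p'' where "\<And>t. (p' has_vector_derivative p'' t) (at t)"
    using p'(2) unfolding C1_differentiable_on_def by auto
  then have "planar_body K (support_function K) p' p''"
    using assms C2_boundary_interior[OF assms(1-3)] p'(1)
    by unfold_locales (auto simp: has_real_derivative_iff_has_vector_derivative)
  then show ?thesis using that by blast
qed

theorem theorem7p1:
  fixes K :: "(real^2) set" and \<gamma> :: "real \<Rightarrow> real^2" and F L I :: real and m :: nat
  assumes "compact K" and "convex K"
    and "C2_boundary_curve K \<gamma>"
    and "C2_differentiable (support_function K)"
    and "F = measure lborel K"
    and "L = curve_length \<gamma>"
    and "m \<ge> 1"
    and "I = (LINT P:(- K)|lborel. visual_angle K P ^ m - sin (visual_angle K P) ^ m)"
  shows "set_integrable lborel (- K)
           (\<lambda>P. visual_angle K P ^ m - sin (visual_angle K P) ^ m)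
       \<and> set_integrable lborel {0..pi} (M_integrand m)
       \<and> I \<le> - (pi ^ m) * F + M_const m * (L\<^sup>2 / (2 * pi))
       \<and> ((\<exists>a r. 0 < r \<and> K = cball a r) \<longrightarrow>
            I = - (pi ^ m) * F + M_const m * (L\<^sup>2 / (2 * pi)))
       \<and> (m \<ge> 3 \<and> I = - (pi ^ m) * F + M_const m * (L\<^sup>2 / (2 * pi)) \<longrightarrow>
            (\<exists>a r. 0 < r \<and> K = cball a r))"
proof -
  obtain p' p'' where "planar_body K (support_function K) p' p''" using planar_bodyI[OF assms(1-4)] by blast
  then interpret planar_body K "support_function K" p' p'' .
  let ?E = "fourier_energy (support_function K)"
  let ?b = "\<lambda>k. ?E k * mode_coeff m k"
  have sums: "?b sums (I + pi^m * F)" using visual_angle_spectral(1)[OF assms(7)] assms(5,8) by simp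
  have b0: "?b 0 = M_const m * (L\<^sup>2 / (2 * pi))"
    by (simp add: fourier_energy_def fourier_wt_def fourier_sin_def fourier_cos_def mode_coeff_0
        assms(6) curve_length_eq[OF assms(3)])
  have bk: "?b k \<le> 0" if "k \<ge> 1" for k
    using mode_coeff_nonpos[OF assms(7) that] fourier_energy_nonneg by (intro mult_nonneg_nonpos)
  \<comment> \<open>All terms outside S are nonpositive, so a finite partial sum containing mode 0
    bounds the whole series from above. The set {0} gives the inequality; {0, k} shows that under
    equality mode k cannot contribute.\<close>
  have le: "I + pi^m * F \<le> sum ?b S" if "finite S" "0 \<in> S" for S
  proof -
    have "sum (\<lambda>k. - ?b k) S \<le> suminf (\<lambda>k. - ?b k)"
    proof (rule sum_le_suminf)
      fix n assume "n \<in> - S"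
      then have "n \<ge> 1" using that(2) by (cases n) auto
      then show "0 \<le> - ?b n" using bk[of n] by simp
    qed (use that sums_summable[OF sums_minus[OF sums]] in auto)
    also have "\<dots> = - (I + pi^m * F)" using sums_unique[OF sums_minus[OF sums]] by simp
    finally show ?thesis by (simp add: sum_negf)
  qed
  have ineq: "I \<le> - (pi ^ m) * F + M_const m * (L\<^sup>2 / (2 * pi))"
    using le[of "{0}"] b0 by simp
  have circ: "I = - (pi ^ m) * F + M_const m * (L\<^sup>2 / (2 * pi))" if "0 < r" "K = cball a r" for a r
  proof -
    have "?b k = 0" if "k \<noteq> 0" for k
      using ball_energy_vanish[OF \<open>K = cball a r\<close> \<open>0 < r\<close>, of k] mode_coeff_1[of m] that by (cases "k = 1") auto
    then have "?b sums sum ?b {0}" by (intro sums_finite) auto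
    then have "I + pi^m * F = ?b 0" using sums_unique2[OF sums] by simp
    then show ?thesis using b0 by simp
  qed
  have conv: "\<exists>a r. 0 < r \<and> K = cball a r"
    if m3: "m \<ge> 3" and eq: "I = - (pi ^ m) * F + M_const m * (L\<^sup>2 / (2 * pi))"
  proof (rule energy_vanish_imp_ball)
    fix k :: nat assume k: "k \<ge> 2"
    have "0 \<le> ?b k" using le[of "{0, k}"] b0 eq k by simp
    moreover have "mode_coeff m k < 0" using mode_coeff_neg[OF m3 k] .
    ultimately have "?E k \<le> 0" by (simp add: zero_le_mult_iff)
    then show "?E k = 0" using fourier_energy_nonneg by (intro antisym)
  qed
  show ?thesis
    using visual_angle_spectral(2)[OF assms(7)] set_integrable_M_integrand ineq circ conv by blast
qed

end
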